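(* Let $T\subset\mathbb{R}^2$ be a convex polygon with $n$ vertices, satisfying the shape regularity conditions of the context with constant $c_0$. Then there are a constant $C$ depending only on $n$ and $c_0$, and a constant $C'$ depending only on $c_0$, such that for all $\mathbf{q}\in(H^1(T))^2$, $$\|\mathbf{q}-\Pi_T\mathbf{q}\|_T\le C\,h_T\,\|\mathbf{q}\|_{1,T}.$$ Moreover, if $\mathrm{div}\,\mathbf{q}\in H^1(T)$, then $$\|\mathrm{div}(\mathbf{q}-\Pi_T\mathbf{q})\|_T\le C'\,h_T\,\|\mathrm{div}\,\mathbf{q}\|_{1,T}.$$
   Context: $T\subset\mathbb{R}^2$ is a (closed) convex polygon with vertices $\mathbf{v}_1,\dots,\mathbf{v}_n$ ordered counterclockwise (indices modulo $n$), edges $e_i$ connecting $\mathbf{v}_i$ and $\mathbf{v}_{i+1}$, unit outward normals $\mathbf{n}_i$ on $e_i$, area $|T|$, diameter $h_T$, edge lengths $|e_i|$. $\|\cdot\|_T$ and $\|\cdot\|_{1,T}$ are the $L^2(T)$ and full $H^1(T)$ norms. Generalized barycentric coordinates on $T$ are functions $\lambda_1,\dots,\lambda_n$ on $T$ that are non-negative and satisfy $L(\mathbf{x})=\sum_i L(\mathbf{v}_i)\lambda_i(\mathbf{x})$ for every linear (affine) function $L$ and all $\mathbf{x}\in T$. Standing assumption: $\lambda_i(\mathbf{v}_j)=\delta_{ij}$, each $\lambda_i$ is linear on each edge, and $\lambda_i\in C^1(T)$. With $\mathrm{curl}\,\phi=(-\partial_y\phi,\partial_x\phi)^t$ and $\mathbf{x}_*$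 a fixed interior point of $T$, let $\chi(\mathcal{M}\Lambda^1(T))=\mathrm{span}\{\mathrm{curl}\,\lambda_i\}_{i=1}^n+\mathrm{span}\{\mathbf{x}-\mathbf{x}_*\}$. It is known that every element of this space has constant normal component on each edge and is uniquely determined by these $n$ arbitrary constants. For $\mathbf{q}\in H(\mathrm{div},T)\cap(L^p(T))^2$ with $p>2$ (in particular for $\mathbf{q}\in (H^1(T))^2$), $\Pi_T\mathbf{q}\in\chi(\mathcal{M}\Lambda^1(T))$ is defined by $(\Pi_T\mathbf{q})\cdot\mathbf{n}_j|_{e_j}=\frac1{|e_j|}\int_{e_j}\mathbf{q}\cdot\mathbf{n}_j\,ds$, $1\le j\le n$. Shape regularity conditions with constant $c_0>0$: (i) $c_0^{-1}h_T^2\le|T|\le c_0h_T^2$; (ii) $|\nabla\lambda_i(\mathbf{x})|\le c_0h_T^{-1}$ for all $\mathbf{x}\in T$, $1\le i\le n$; (iii) for all $\phi\in H^1(T)$, $\|\phi\|_{L^2(\partial T)}^2\le c_0(h_T^{-1}\|\phi\|_T^2+h_T\|\nabla\phi\|_T^2)$ and $\|\phi-P_T\phi\|_T\le c_0h_T\|\phi\|_{1,T}$, where $P_T$ is the $L^2(T)$-orthogonal projection onto constants. (In the paper, bounds are written with $\lesssim$, meaning up to a constant independent of the shape of the polygons in the mesh, i.e. depending only on $c_0$.) *)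

theory Defs
  imports "HOL-Analysis.Analysis"
begin

section \<open>Convex polygons\<close>

definition cross2 :: "real^2 \<Rightarrow> real^2 \<Rightarrow> real" where
  "cross2 a b = a $ 1 * b $ 2 - a $ 2 * b $ 1"

definition next_vertex :: "nat \<Rightarrow> (nat \<Rightarrow> real^2) \<Rightarrow> nat \<Rightarrow> real^2" where
  "next_vertex n v i = v (Suc i mod n)"

text \<open>The vertices (extreme points) are \<open>v 0, \<dots>, v (n - 1)\<close>. The ordering is
  counterclockwise: \<open>T\<close> lies to the left of each oriented line from \<open>v i\<close> to its successor.\<close>

definition convex_polygon :: "(real^2) set \<Rightarrow> nat \<Rightarrow> (nat \<Rightarrow> real^2) \<Rightarrow> bool" where
  "convex_polygon T n v \<longleftrightarrow>
     polytope T \<and> interior T \<noteq> {} \<and>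
     bij_betw v {..<n} {x. x extreme_point_of T} \<and>
     (\<forall>i<n. \<forall>x\<in>T. cross2 (next_vertex n v i - v i) (x - v i) \<ge> 0)"

definition edge :: "nat \<Rightarrow> (nat \<Rightarrow> real^2) \<Rightarrow> nat \<Rightarrow> (real^2) set" where
  "edge n v j = closed_segment (v j) (next_vertex n v j)"

definition edge_length :: "nat \<Rightarrow> (nat \<Rightarrow> real^2) \<Rightarrow> nat \<Rightarrow> real" where
  "edge_length n v j = dist (v j) (next_vertex n v j)"

text \<open>The unit tangent rotated clockwise by a right angle; it points outward because the
  vertices are ordered counterclockwise.\<close>

definition edge_normal :: "nat \<Rightarrow> (nat \<Rightarrow> real^2) \<Rightarrow> nat \<Rightarrow> real^2" where
  "edge_normal n v j =
     (let d = next_vertex n v j - v j in (1 / norm d) *\<^sub>R vector [d $ 2, - d $ 1])"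

text \<open>Arc-length integral over an edge, by the constant-speed parametrization.\<close>

definition edge_integral :: "nat \<Rightarrow> (nat \<Rightarrow> real^2) \<Rightarrow> nat \<Rightarrow> (real^2 \<Rightarrow> real) \<Rightarrow> real" where
  "edge_integral n v j g =
     edge_length n v j *
     integral\<^sup>L (lebesgue_on {0..1}) (\<lambda>t. g (linepath (v j) (next_vertex n v j) t))"

section \<open>Classical derivatives\<close>

text \<open>At the points of a convex set with nonempty interior (boundary points included) the
  derivative within the set is unique.\<close>

definition grad_within :: "(real^2) set \<Rightarrow> (real^2 \<Rightarrow> real) \<Rightarrow> real^2 \<Rightarrow> real^2" where
  "grad_within T f x = (\<chi> i. frechet_derivative f (at x within T) (axis i 1))"

definition C1_on :: "(real^2) set \<Rightarrow> (real^2 \<Rightarrow> real) \<Rightarrow> bool" where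
  "C1_on T f \<longleftrightarrow> f differentiable_on T \<and> continuous_on T (grad_within T f)"

definition curl_within :: "(real^2) set \<Rightarrow> (real^2 \<Rightarrow> real) \<Rightarrow> real^2 \<Rightarrow> real^2" where
  "curl_within T f x = vector [- (grad_within T f x $ 2), grad_within T f x $ 1]"

definition partial_deriv :: "2 \<Rightarrow> (real^2 \<Rightarrow> real) \<Rightarrow> real^2 \<Rightarrow> real" where
  "partial_deriv i f x = frechet_derivative f (at x) (axis i 1)"

primrec C_k :: "nat \<Rightarrow> (real^2 \<Rightarrow> real) \<Rightarrow> bool" where
  "C_k 0 f \<longleftrightarrow> continuous_on UNIV f"
| "C_k (Suc k) f \<longleftrightarrow> f differentiable_on UNIV \<and> (\<forall>i. C_k k (partial_deriv i f))"

text \<open>Smooth functions with compact support in \<open>U\<close>, extended by zero to the plane.\<close>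

definition test_functions :: "(real^2) set \<Rightarrow> (real^2 \<Rightarrow> real) set" where
  "test_functions U =
     {\<psi>. (\<forall>k. C_k k \<psi>) \<and> compact (closure {x. \<psi> x \<noteq> 0}) \<and> closure {x. \<psi> x \<noteq> 0} \<subseteq> U}"

section \<open>Lebesgue and Sobolev spaces\<close>

definition L2_on :: "'a::euclidean_space set \<Rightarrow> ('a \<Rightarrow> 'b::euclidean_space) \<Rightarrow> bool" where
  "L2_on S f \<longleftrightarrow> f \<in> borel_measurable (lebesgue_on S) \<and>
     integrable (lebesgue_on S) (\<lambda>x. (norm (f x))\<^sup>2)"

definition L2_norm :: "'a::euclidean_space set \<Rightarrow> ('a \<Rightarrow> 'b::euclidean_space) \<Rightarrow> real" where
  "L2_norm S f = sqrt (integral\<^sup>L (lebesgue_on S) (\<lambda>x. (norm (f x))\<^sup>2))"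

definition is_weak_grad ::
  "(real^2) set \<Rightarrow> (real^2 \<Rightarrow> real) \<Rightarrow> (real^2 \<Rightarrow> real^2) \<Rightarrow> bool" where
  "is_weak_grad T f G \<longleftrightarrow> L2_on T G \<and>
     (\<forall>\<psi> \<in> test_functions (interior T). \<forall>i.
        integral\<^sup>L (lebesgue_on T) (\<lambda>x. f x * partial_deriv i \<psi> x) =
        - integral\<^sup>L (lebesgue_on T) (\<lambda>x. G x $ i * \<psi> x))"

text \<open>Weak derivatives are unique up to null sets, so the choices below do not affect norms.\<close>

definition weak_grad :: "(real^2) set \<Rightarrow> (real^2 \<Rightarrow> real) \<Rightarrow> real^2 \<Rightarrow> real^2" where
  "weak_grad T f = (SOME G. is_weak_grad T f G)"

definition H1_on :: "(real^2) set \<Rightarrow> (real^2 \<Rightarrow> real) \<Rightarrow> bool" where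
  "H1_on T f \<longleftrightarrow> L2_on T f \<and> (\<exists>G. is_weak_grad T f G)"

definition H1_norm :: "(real^2) set \<Rightarrow> (real^2 \<Rightarrow> real) \<Rightarrow> real" where
  "H1_norm T f = sqrt ((L2_norm T f)\<^sup>2 + (L2_norm T (weak_grad T f))\<^sup>2)"

definition H1_vec_on :: "(real^2) set \<Rightarrow> (real^2 \<Rightarrow> real^2) \<Rightarrow> bool" where
  "H1_vec_on T q \<longleftrightarrow> (\<forall>i. H1_on T (\<lambda>x. q x $ i))"

definition H1_vec_norm :: "(real^2) set \<Rightarrow> (real^2 \<Rightarrow> real^2) \<Rightarrow> real" where
  "H1_vec_norm T q = sqrt (\<Sum>i\<in>UNIV. (H1_norm T (\<lambda>x. q x $ i))\<^sup>2)"

definition is_weak_div ::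
  "(real^2) set \<Rightarrow> (real^2 \<Rightarrow> real^2) \<Rightarrow> (real^2 \<Rightarrow> real) \<Rightarrow> bool" where
  "is_weak_div T q d \<longleftrightarrow> L2_on T d \<and>
     (\<forall>\<psi> \<in> test_functions (interior T).
        integral\<^sup>L (lebesgue_on T) (\<lambda>x. q x \<bullet> (\<chi> i. partial_deriv i \<psi> x)) =
        - integral\<^sup>L (lebesgue_on T) (\<lambda>x. d x * \<psi> x))"

definition weak_div :: "(real^2) set \<Rightarrow> (real^2 \<Rightarrow> real^2) \<Rightarrow> real^2 \<Rightarrow> real" where
  "weak_div T q = (SOME d. is_weak_div T q d)"

text \<open>The \<open>L\<^sup>2\<close>-orthogonal projection onto constants: \<open>f - c\<close> is orthogonal to every constant.\<close>

definition const_proj :: "(real^2) set \<Rightarrow> (real^2 \<Rightarrow> real) \<Rightarrow> real" where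
  "const_proj T f = (THE c. \<forall>k. integral\<^sup>L (lebesgue_on T) (\<lambda>x. (f x - c) * k) = 0)"

section \<open>Traces\<close>

definition bd_L2 :: "nat \<Rightarrow> (nat \<Rightarrow> real^2) \<Rightarrow> (real^2 \<Rightarrow> real) \<Rightarrow> bool" where
  "bd_L2 n v g \<longleftrightarrow> (\<forall>j<n. L2_on {0..1} (\<lambda>t. g (linepath (v j) (next_vertex n v j) t)))"

definition bd_L2_norm :: "nat \<Rightarrow> (nat \<Rightarrow> real^2) \<Rightarrow> (real^2 \<Rightarrow> real) \<Rightarrow> real" where
  "bd_L2_norm n v g = sqrt (\<Sum>j<n. edge_integral n v j (\<lambda>x. (g x)\<^sup>2))"

text \<open>The trace operator is the continuous extension to \<open>H\<^sup>1(T)\<close>, with values in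
  \<open>L\<^sup>2(\<partial>T)\<close>, of restriction to the boundary, defined on the dense subspace \<open>C\<^sup>1(T)\<close>.\<close>

definition is_trace ::
  "(real^2) set \<Rightarrow> nat \<Rightarrow> (nat \<Rightarrow> real^2) \<Rightarrow> (real^2 \<Rightarrow> real) \<Rightarrow> (real^2 \<Rightarrow> real) \<Rightarrow> bool" where
  "is_trace T n v f g \<longleftrightarrow> bd_L2 n v g \<and>
     (\<exists>u :: nat \<Rightarrow> real^2 \<Rightarrow> real. (\<forall>k. C1_on T (u k)) \<and>
        (\<lambda>k. H1_norm T (\<lambda>x. u k x - f x)) \<longlonglongrightarrow> 0 \<and>
        (\<lambda>k. bd_L2_norm n v (\<lambda>x. u k x - g x)) \<longlonglongrightarrow> 0)"

definition trace_op ::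
  "(real^2) set \<Rightarrow> nat \<Rightarrow> (nat \<Rightarrow> real^2) \<Rightarrow> (real^2 \<Rightarrow> real) \<Rightarrow> real^2 \<Rightarrow> real" where
  "trace_op T n v f = (SOME g. is_trace T n v f g)"

definition trace_vec ::
  "(real^2) set \<Rightarrow> nat \<Rightarrow> (nat \<Rightarrow> real^2) \<Rightarrow> (real^2 \<Rightarrow> real^2) \<Rightarrow> real^2 \<Rightarrow> real^2" where
  "trace_vec T n v q x = (\<chi> i. trace_op T n v (\<lambda>y. q y $ i) x)"

section \<open>Generalized barycentric coordinates and the interpolation operator\<close>

definition barycentric_coords ::
  "(real^2) set \<Rightarrow> nat \<Rightarrow> (nat \<Rightarrow> real^2) \<Rightarrow> (nat \<Rightarrow> real^2 \<Rightarrow> real) \<Rightarrow> bool" where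
  "barycentric_coords T n v lam \<longleftrightarrow>
     (\<forall>i<n. \<forall>x\<in>T. lam i x \<ge> 0) \<and>
     (\<forall>a b. \<forall>x\<in>T. a \<bullet> x + b = (\<Sum>i<n. (a \<bullet> v i + b) * lam i x)) \<and>
     (\<forall>i<n. \<forall>j<n. lam i (v j) = (if i = j then 1 else 0)) \<and>
     (\<forall>i<n. \<forall>j<n. \<exists>a b. \<forall>x\<in>edge n v j. lam i x = a \<bullet> x + b) \<and>
     (\<forall>i<n. C1_on T (lam i))"

text \<open>Elements are functions on \<open>T\<close>, represented by extensional functions on the plane, so that
  functions agreeing on \<open>T\<close> are equal.\<close>

definition chi_space ::
  "(real^2) set \<Rightarrow> nat \<Rightarrow> (nat \<Rightarrow> real^2 \<Rightarrow> real) \<Rightarrow> real^2 \<Rightarrow> (real^2 \<Rightarrow> real^2) set" where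
  "chi_space T n lam xs =
     {p. \<exists>(a :: nat \<Rightarrow> real) (b :: real).
        p = (\<lambda>x\<in>T. (\<Sum>i<n. a i *\<^sub>R curl_within T (lam i) x) + b *\<^sub>R (x - xs))}"

definition interp ::
  "(real^2) set \<Rightarrow> nat \<Rightarrow> (nat \<Rightarrow> real^2) \<Rightarrow> (nat \<Rightarrow> real^2 \<Rightarrow> real) \<Rightarrow> real^2 \<Rightarrow>
   (real^2 \<Rightarrow> real^2) \<Rightarrow> real^2 \<Rightarrow> real^2" where
  "interp T n v lam xs q =
     (THE p. p \<in> chi_space T n lam xs \<and>
        (\<forall>j<n. \<forall>x\<in>edge n v j. p x \<bullet> edge_normal n v j =
           1 / edge_length n v j *
           edge_integral n v j (\<lambda>y. trace_vec T n v q y \<bullet> edge_normal n v j)))"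

definition shape_regular ::
  "(real^2) set \<Rightarrow> nat \<Rightarrow> (nat \<Rightarrow> real^2) \<Rightarrow> (nat \<Rightarrow> real^2 \<Rightarrow> real) \<Rightarrow> real \<Rightarrow> bool" where
  "shape_regular T n v lam c\<^sub>0 \<longleftrightarrow>
     (let h = diameter T in
       inverse c\<^sub>0 * h\<^sup>2 \<le> measure lebesgue T \<and> measure lebesgue T \<le> c\<^sub>0 * h\<^sup>2 \<and>
       (\<forall>i<n. \<forall>x\<in>T. norm (grad_within T (lam i) x) \<le> c\<^sub>0 * inverse h) \<and>
       (\<forall>\<phi>. H1_on T \<phi> \<longrightarrow>
          (bd_L2_norm n v (trace_op T n v \<phi>))\<^sup>2
            \<le> c\<^sub>0 * (inverse h * (L2_norm T \<phi>)\<^sup>2 + h * (L2_norm T (weak_grad T \<phi>))\<^sup>2) \<and>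
          L2_norm T (\<lambda>x. \<phi> x - const_proj T \<phi>) \<le> c\<^sub>0 * h * H1_norm T \<phi>))"

end

(* Gauss' theorem for C^1 functions on T is proved by integrating along lines parallel to an axis: the
   cyclic sequence of vertices crosses a generic line exactly once in each direction, at the two end
   points of its intersection with T. Mollifying by averages over T (the kernel at x is supported in a
   shrunken copy of T with centre x) shows that C^1(T) is dense in H^1(T) and that test functions
   determine L^2 functions; Gauss' theorem for u^2 (x - z) bounds boundary values of C^1 functions.
   Hence traces exist, are unique and additive under constants, and satisfy Gauss' theorem.
   On the edge e_j the field sum_i a_i curl lam_i + b (x - xs) has the normal component
   (a_j - a_{j+1}) / |e_j| + b d_j with d_j the distance from xs to e_j, so prescribing the fluxes
   determines b = (total flux) / (2 |T|) and the a_j up to a common constant, which does not matter because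
   sum_i lam_i = 1. The interpolant reproduces constants c, so the first estimate follows by bounding a and
   b for the traces of q - c, where c is the mean of q; the second one holds because
   div (Pi q) = 2 b is the mean of div q. *)

theory Submission
  imports Defs
begin

section \<open>Convex polygons\<close>

text \<open>Traces, weak gradients, weak divergences, the projection onto constants and the
  interpolant are all introduced by choice or by definite description. The assumed inequalities
  speak about these chosen objects, so existence and uniqueness have to be settled before they can
  be exploited; this is what most of the development does. The trace bound derived from Gauss'
  theorem has a constant that depends on \<open>T\<close> and serves only this purpose; all
  constants in the estimates come from shape regularity. In the averages the sample point (1 - s) x
  + s y, with y in a compact part of the interior, is interior even if x lies on the boundary. So no
  extension of f beyond \<open>T\<close> is needed and the averages are C^1 up to the boundary.
  Powers of h in the first estimate: the traces of q - c are O(h^(1/2)), Cauchy-Schwarz on an edge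
  gives another h^(1/2), so fluxes and coefficients a_j are O(h); gradients of lam_i are O(1/h), and
  the square root of the area is O(h). The number n enters because fluxes are summed around the
  polygon and n curls are added. In the second estimate the curls drop out and only the constant of
  the Poincare inequality remains.\<close>

locale polygon =
  fixes T :: "(real^2) set" and n :: nat and v :: "nat \<Rightarrow> real^2"
  assumes polygon: "convex_polygon T n v"
begin

definition side :: "nat \<Rightarrow> real^2" where
  "side j = next_vertex n v j - v j"

definition on_edge :: "nat \<Rightarrow> real \<Rightarrow> real^2" where
  "on_edge j t = linepath (v j) (next_vertex n v j) t"

lemma on_edge_eq: "on_edge j t = v j + t *\<^sub>R side j"
  by (simp add: on_edge_def side_def linepath_def algebra_simps)

lemma polytope: "polytope T" and interior_nonempty: "interior T \<noteq> {}"
  and vertices: "bij_betw v {..<n} {x. x extreme_point_of T}"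
  and cross2_side_nonneg: "\<And>i x. i < n \<Longrightarrow> x \<in> T \<Longrightarrow> cross2 (side i) (x - v i) \<ge> 0"
  using polygon by (auto simp: convex_polygon_def side_def)

lemma compact: "compact T" and convex: "convex T" and closed: "closed T"
  using polytope polytope_imp_compact polytope_imp_convex polytope_imp_closed by auto

lemma lmeasurable: "T \<in> lmeasurable" using compact by (rule lmeasurable_compact)

lemma hull_vertices: "convex hull (v ` {..<n}) = T"
  using Krein_Milman_Minkowski[OF compact convex] vertices by (simp add: bij_betw_def)

lemma vertex_extreme: "i < n \<Longrightarrow> v i extreme_point_of T"
  using vertices by (auto simp: bij_betw_def)

lemma vertex_in: "i < n \<Longrightarrow> v i \<in> T"
  using vertex_extreme by (auto simp: extreme_point_of_def)

lemma vertex_inj: "i < n \<Longrightarrow> j < n \<Longrightarrow> v i = v j \<longleftrightarrow> i = j"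
  using vertices by (auto simp: bij_betw_def inj_on_def)

text \<open>The hull of at most one vertex has empty interior. The bound 2 is what makes
  \<open>Suc j mod n\<close> differ from \<open>j\<close>, so that edges are nondegenerate.\<close>

lemma two_le_n: "2 \<le> n"
proof (rule ccontr)
  assume "\<not> 2 \<le> n"
  then have "{..<n} \<subseteq> {0}" by auto
  then have "v ` {..<n} \<subseteq> {v 0}" by auto
  then have "T \<subseteq> {v 0}"
    using hull_vertices hull_mono[of "v ` {..<n}" "{v 0}" convex] by simp
  then have "interior T \<subseteq> interior {v 0}" by (rule interior_mono)
  then show False using interior_nonempty by simp
qed

lemma n_pos: "0 < n" using two_le_n by simp

lemma next_vertex_in: "j < n \<Longrightarrow> next_vertex n v j \<in> T"
  using two_le_n by (auto simp: next_vertex_def intro!: vertex_in)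

lemma next_vertex_neq: "j < n \<Longrightarrow> next_vertex n v j \<noteq> v j"
  using two_le_n vertex_inj[of "Suc j mod n" j] by (auto simp: next_vertex_def mod_Suc)

lemma side_nonzero: "j < n \<Longrightarrow> side j \<noteq> 0"
  using next_vertex_neq by (simp add: side_def)

lemma norm_side: "norm (side j) = edge_length n v j"
  by (simp add: side_def edge_length_def dist_norm norm_minus_commute)

lemma edge_length_pos: "j < n \<Longrightarrow> 0 < edge_length n v j"
  using side_nonzero norm_side[of j] by (metis zero_less_norm_iff)

lemma edge_subset: "j < n \<Longrightarrow> edge n v j \<subseteq> T"
  unfolding edge_def using closed_segment_subset[OF vertex_in next_vertex_in convex] by simp

lemma on_edge_edge: "0 \<le> t \<Longrightarrow> t \<le> 1 \<Longrightarrow> on_edge j t \<in> edge n v j"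
  unfolding on_edge_def edge_def by (simp add: linepath_in_path)

lemma on_edge_in: "j < n \<Longrightarrow> 0 \<le> t \<Longrightarrow> t \<le> 1 \<Longrightarrow> on_edge j t \<in> T"
  using edge_subset on_edge_edge by blast

lemma edge_onE:
  assumes "x \<in> edge n v j" obtains t where "0 \<le> t" "t \<le> 1" "x = on_edge j t"
  using assms unfolding edge_def on_edge_def linepath_def in_segment by auto

lemma edge_normal_eq:
  "edge_normal n v j = (1 / edge_length n v j) *\<^sub>R vector [side j $ 2, - side j $ 1]"
  by (simp add: edge_normal_def Let_def side_def[symmetric] norm_side)

lemma inner_edge_normal:
  "edge_length n v j * (x \<bullet> edge_normal n v j) = cross2 x (side j)" if "j < n"
  using edge_length_pos[OF that]
  by (simp add: edge_normal_eq inner_vec_def sum_2 cross2_def field_simps)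

text \<open>From an interior point a short step along the outward normal \<open>w\<close> stays in
  \<open>T\<close> but lowers the cross product by a positive multiple of the squared side length;
  as the value after the step is still nonnegative, it was positive before. This is how the ordering
  of the vertices separates the interior from the edges.\<close>

lemma cross2_side_pos:
  assumes "j < n" "x \<in> interior T"
  shows "0 < cross2 (side j) (x - v j)"
proof -
  obtain e where e: "0 < e" "ball x e \<subseteq> T"
    using assms(2) mem_interior by blast
  define w :: "real^2" where "w = vector [side j $ 2, - side j $ 1]"
  have nw: "norm w = norm (side j)"
    by (simp add: w_def norm_vec_def L2_set_def sum_2 add.commute)
  have w0: "norm w > 0" using nw side_nonzero[OF assms(1)] by simp
  define y where "y = x + (e / (2 * norm w)) *\<^sub>R w"
  have "y \<in> T" using e w0 by (auto simp: y_def dist_norm intro!: subsetD[OF e(2)])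
  then have "0 \<le> cross2 (side j) (y - v j)" using cross2_side_nonneg assms by simp
  also have "cross2 (side j) (y - v j) =
      cross2 (side j) (x - v j) - (e / (2 * norm w)) * ((side j $ 1)^2 + (side j $ 2)^2)"
    by (simp add: cross2_def y_def w_def algebra_simps power2_eq_square)
  also have "(side j $ 1)^2 + (side j $ 2)^2 = (norm (side j))^2"
    by (simp add: norm_vec_def L2_set_def sum_2)
  finally show ?thesis using e(1) w0 nw
    by (smt (verit) divide_pos_pos mult_pos_pos zero_less_power)
qed

lemma diameter_pos: "0 < diameter T"
proof -
  have "norm (side 0) \<le> diameter T"
    using diameter_bounded_bound[OF compact_imp_bounded[OF compact] next_vertex_in[OF n_pos] vertex_in[OF n_pos]]
    by (simp add: side_def dist_norm)
  then show ?thesis using side_nonzero[OF n_pos] by (smt (verit) zero_less_norm_iff)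
qed

lemma norm_diff_le_diameter: "x \<in> T \<Longrightarrow> y \<in> T \<Longrightarrow> norm (x - y) \<le> diameter T"
  using diameter_bounded_bound[OF compact_imp_bounded[OF compact]] by (simp add: dist_norm)

lemma edge_length_le: "j < n \<Longrightarrow> edge_length n v j \<le> diameter T"
  using norm_diff_le_diameter[OF next_vertex_in vertex_in]
  by (simp add: side_def norm_side[symmetric])

text \<open>The differences \<open>y - x\<close> with \<open>y \<in> T\<close> span the plane, so a linear map vanishing on them is 0;
  axis-parallel segments at \<open>x\<close> need not exist in \<open>T\<close>.\<close>

lemma derivative_unique:
  fixes f :: "real^2 \<Rightarrow> real"
  assumes x: "x \<in> T" and D: "(f has_derivative D) (at x within T)"
    and D': "(f has_derivative D') (at x within T)"
  shows "D = D'"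
proof -
  interpret D: bounded_linear D using D has_derivative_bounded_linear by blast
  interpret D': bounded_linear D' using D' has_derivative_bounded_linear by blast
  have eq: "D (y - x) = D' (y - x)" if y: "y \<in> T" for y
  proof -
    let ?p = "\<lambda>t::real. x + t *\<^sub>R (y - x)"
    have sub: "?p ` {0..1} \<subseteq> T"
    proof clarsimp
      fix t :: real assume "0 \<le> t" "t \<le> 1"
      then show "x + t *\<^sub>R (y - x) \<in> T"
        using convexD_alt[OF convex x y, of t] by (simp add: algebra_simps)
    qed
    have p: "(?p has_derivative (\<lambda>t. t *\<^sub>R (y - x))) (at 0 within {0..1})"
      by (auto intro!: derivative_eq_intros)
    have comp: "((\<lambda>t. f (?p t)) has_derivative (\<lambda>t. E (t *\<^sub>R (y - x)))) (at 0 within {0..1})"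
      if "(f has_derivative E) (at x within T)" for E
      using has_derivative_in_compose[OF p, of f E] has_derivative_subset[OF that sub] by simp
    have "(\<lambda>t::real. D (t *\<^sub>R (y - x))) = (\<lambda>t. D' (t *\<^sub>R (y - x)))"
      by (rule frechet_derivative_unique_within_closed_interval
          [of 0 "1::real" 0 "\<lambda>t. f (?p t)", unfolded cbox_interval])
         (use comp[OF D] comp[OF D'] in auto)
    from fun_cong[OF this, of 1] show ?thesis by simp
  qed
  obtain z where z: "z \<in> interior T" using interior_nonempty by auto
  then obtain e where e: "0 < e" "cball z e \<subseteq> T" using mem_interior_cball by blast
  have zT: "z \<in> T" using z interior_subset by blast
  show ?thesis
  proof
    fix h
    show "D h = D' h"
    proof (cases "h = 0")
      case True then show ?thesis using D.zero D'.zero by simp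
    next
      case False
      define c where "c = e / norm h"
      have c: "c > 0" "z + c *\<^sub>R h \<in> T"
        using False e by (auto simp: c_def dist_norm intro!: subsetD[OF e(2)])
      \<comment> \<open>The vector c h is the difference of \<open>z + c h - x\<close> and
        \<open>z - x\<close>, which both are differences to points of \<open>T\<close>.\<close>
      have "D (c *\<^sub>R h) = D' (c *\<^sub>R h)"
        using eq[OF c(2)] eq[OF zT] D.add[of "z - x" "c *\<^sub>R h"] D'.add[of "z - x" "c *\<^sub>R h"]
        by (simp add: algebra_simps)
      then show ?thesis using c(1) by (simp add: D.scaleR D'.scaleR)
    qed
  qed
qed

end

section \<open>The divergence theorem on a convex polygon\<close>

text \<open>Starting at \<open>a\<close> and never crossing upwards, the values would stay below
  \<open>s\<close> all round the cycle, in particular at \<open>b\<close>.\<close>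

lemma cyclic_crossing:
  fixes f :: "nat \<Rightarrow> real"
  assumes "a < n" "b < n" "f a < s" "s < f b" and neq: "\<And>k. k < n \<Longrightarrow> f k \<noteq> s"
  shows "\<exists>j<n. f j < s \<and> s < f (Suc j mod n)"
proof (rule ccontr)
  assume "\<not> ?thesis"
  then have step: "f (Suc j mod n) < s" if "j < n" "f j < s" for j
    using that neq[of "Suc j mod n"] by (metis bot_nat_0.extremum_strict linorder_neqE_linordered_idom mod_less_divisor neq0_conv)
  have "f ((a + m) mod n) < s" for m
  proof (induction m)
    case 0 then show ?case using assms by simp
  next
    case (Suc m)
    then show ?case using step[of "(a + m) mod n"] assms(1) by (simp add: mod_Suc_eq)
  qed
  \<comment> \<open>Since \<open>a < n\<close>, this number of steps leads from \<open>a\<close> to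
    index \<open>n + b\<close>, which is \<open>b\<close> modulo \<open>n\<close>.\<close>
  from this[of "n - a + b"] show False using assms by simp
qed

lemma cyclic_crossing_down:
  fixes f :: "nat \<Rightarrow> real"
  assumes "a < n" "b < n" "f a < s" "s < f b" and "\<And>k. k < n \<Longrightarrow> f k \<noteq> s"
  shows "\<exists>j<n. s < f j \<and> f (Suc j mod n) < s"
  using cyclic_crossing[of b n a "\<lambda>k. - f k" "- s"] assms by auto

section \<open>Slicing the polygon by parallel lines\<close>

definition frame :: "real^2 \<Rightarrow> real \<times> real \<Rightarrow> real^2" where
  "frame w p = fst p *\<^sub>R vector [w $ 2, - w $ 1] + snd p *\<^sub>R w"

text \<open>Slices of the plane are parametrized along \<open>w\<close>, one of the two axis directions; the first
  coordinate runs along \<open>w\<close> rotated clockwise.\<close>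

locale polygon_slices = polygon +
  fixes w :: "real^2"
  assumes unit: "(w $ 1)\<^sup>2 + (w $ 2)\<^sup>2 = 1"
    and frame_lborel: "distr (lborel \<Otimes>\<^sub>M lborel) borel (frame w) = lborel"
begin

definition e :: "real^2" where "e = vector [w $ 2, - w $ 1]"

lemma frame_eq: "frame w (s, t) = s *\<^sub>R e + t *\<^sub>R w"
  by (simp add: frame_def e_def)

lemma e_inner: "e \<bullet> e = 1" "w \<bullet> w = 1" "e \<bullet> w = 0" "w \<bullet> e = 0"
  using unit by (simp_all add: e_def inner_vec_def sum_2 power2_eq_square algebra_simps)

lemma frame_surj: "frame w (x \<bullet> e, x \<bullet> w) = x"
proof -
  have "w$2 * (w$2 * x$1) + w$1 * (w$1 * x$1) = ((w$1)\<^sup>2 + (w$2)\<^sup>2) * x$1"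
    "w$2 * (w$2 * x$2) + w$1 * (w$1 * x$2) = ((w$1)\<^sup>2 + (w$2)\<^sup>2) * x$2"
    by (simp_all add: power2_eq_square algebra_simps)
  then show ?thesis using unit
    by (simp add: vec_eq_iff forall_2 frame_def e_def inner_vec_def sum_2 algebra_simps)
qed

lemma frame_inner_e: "frame w (s, t) \<bullet> e = s"
  by (simp add: frame_eq inner_add_left e_inner)

lemma cross2_w: "cross2 d w = d \<bullet> e"
  by (simp add: cross2_def e_def inner_vec_def sum_2)

abbreviation slope :: "nat \<Rightarrow> real" where "slope j \<equiv> side j \<bullet> e"

definition \<tau> :: "real \<Rightarrow> nat \<Rightarrow> real" where "\<tau> s j = (s - v j \<bullet> e) / slope j"

text \<open>The boundary value that edge \<open>j\<close> contributes on the line at position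
  \<open>s\<close>, with the sign of the \<open>w\<close>-component of the outward normal: plus
  where the line leaves \<open>T\<close>, minus where it enters. For an edge parallel to the lines
  \<open>\<tau>\<close> divides by zero, but then the factor \<open>sgn\<close> is zero.\<close>

definition edge_slice :: "(real^2 \<Rightarrow> real) \<Rightarrow> nat \<Rightarrow> real \<Rightarrow> real" where
  "edge_slice g j s = - sgn (slope j) * (indicator {0..1} (\<tau> s j) * g (on_edge j (\<tau> s j)))"

lemma on_edge_\<tau>:
  assumes "slope j \<noteq> 0" shows "on_edge j (\<tau> s j) = frame w (s, on_edge j (\<tau> s j) \<bullet> w)"
proof -
  have "on_edge j (\<tau> s j) \<bullet> e = s"
    using assms by (simp add: on_edge_eq \<tau>_def inner_add_left)
  then show ?thesis using frame_surj[of "on_edge j (\<tau> s j)"] by simp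
qed

text \<open>Along a line the cross product with side \<open>j\<close> is affine in \<open>t\<close>
  with rate \<open>cross2 (side j) w\<close>, which is \<open>slope j\<close>, and it vanishes where
  the line meets the edge's line. So an edge of positive slope bounds \<open>T\<close> from below
  and one of negative slope from above.\<close>

lemma slice_side:
  assumes "j < n" "slope j \<noteq> 0" "frame w (s, t) \<in> T"
  shows "0 \<le> (t - on_edge j (\<tau> s j) \<bullet> w) * slope j"
proof -
  let ?P = "on_edge j (\<tau> s j)"
  have "frame w (s, t) - v j = \<tau> s j *\<^sub>R side j + (t - ?P \<bullet> w) *\<^sub>R w"
  proof -
    define a where "a = ?P \<bullet> w"
    have "?P = frame w (s, a)" unfolding a_def by (rule on_edge_\<tau>[OF assms(2)])
    then have eq: "v j + \<tau> s j *\<^sub>R side j = s *\<^sub>R e + a *\<^sub>R w"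
      by (simp only: on_edge_eq frame_eq)
    have "frame w (s, t) = (v j + \<tau> s j *\<^sub>R side j) + (t - a) *\<^sub>R w"
      unfolding eq frame_eq by (simp add: scaleR_diff_left)
    then show ?thesis unfolding a_def[symmetric] by simp
  qed
  then have "cross2 (side j) (frame w (s, t) - v j) =
      cross2 (side j) (\<tau> s j *\<^sub>R side j + (t - ?P \<bullet> w) *\<^sub>R w)"
    by (rule arg_cong)
  also have "\<dots> = (t - ?P \<bullet> w) * cross2 (side j) w"
    by (simp add: cross2_def algebra_simps)
  finally have "cross2 (side j) (frame w (s, t) - v j) = (t - ?P \<bullet> w) * cross2 (side j) w" .
  then show ?thesis using cross2_side_nonneg[OF assms(1,3)] cross2_w by simp
qed

text \<open>Both ends of edge \<open>j\<close> lie to the left of edge \<open>i\<close>, yet an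
  inner point of \<open>j\<close> lies on it; hence the edges are parallel. Two distinct overlapping
  parallel edges with the same direction would put a vertex strictly between two points of
  \<open>T\<close>, against extremality.\<close>

lemma edge_interiors_disjoint:
  assumes ij: "i < n" "j < n" and a: "0 < a" "a < 1" and b: "0 < b" "b < 1"
    and eq: "on_edge i a = on_edge j b" and sl: "0 < slope i * slope j"
  shows "i = j"
proof -
  have vv: "v j - v i = a *\<^sub>R side i - b *\<^sub>R side j"
    using eq by (simp add: on_edge_eq algebra_simps)
  have nz: "slope i \<noteq> 0" "slope j \<noteq> 0" using sl by auto
  let ?c = "cross2 (side i) (side j)"
  have "0 \<le> cross2 (side i) (v j - v i)" using cross2_side_nonneg ij vertex_in by simp
  then have 1: "0 \<le> - b * ?c" unfolding vv by (simp add: cross2_def algebra_simps)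
  have "0 \<le> cross2 (side i) (next_vertex n v j - v i)"
    using cross2_side_nonneg ij next_vertex_in by simp
  also have "next_vertex n v j - v i = (v j - v i) + side j" by (simp add: side_def)
  finally have 2: "0 \<le> (1 - b) * ?c" unfolding vv by (simp add: cross2_def algebra_simps)
  have c0: "?c = 0" using 1 2 b by (smt (verit) mult_neg_pos mult_pos_neg mult_less_0_iff zero_le_mult_iff)
  define k where "k = slope j / slope i"
  have k: "k > 0" using sl by (auto simp: k_def zero_less_divide_iff zero_less_mult_iff)
  \<comment> \<open>The difference has no \<open>e\<close>-component by the choice of
    \<open>k\<close>, and being parallel to side \<open>i\<close>, which is not parallel to
    \<open>w\<close>, it has no \<open>w\<close>-component either.\<close>
  have par: "side j = k *\<^sub>R side i"
  proof -
    let ?x = "side j - k *\<^sub>R side i"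
    have "?x \<bullet> e = 0" using nz by (simp add: k_def inner_diff_left)
    then have x: "?x = (?x \<bullet> w) *\<^sub>R w" using frame_surj[of ?x] by (simp add: frame_eq)
    have "cross2 (side i) ?x = 0" using c0 by (simp add: cross2_def algebra_simps)
    moreover have "cross2 (side i) ((?x \<bullet> w) *\<^sub>R w) = (?x \<bullet> w) * cross2 (side i) w"
      by (simp add: cross2_def algebra_simps)
    ultimately have "?x \<bullet> w = 0" using x cross2_w nz by (metis mult_eq_0_iff)
    then show ?thesis using x by simp
  qed
  have not_between: False
    if "l < n" "m < n" "v m = v l + c *\<^sub>R side l" "0 < c" "c < q" "q < 1" "v l + q *\<^sub>R side l \<in> T"
    for l m c q
  proof -
    let ?P = "v l + q *\<^sub>R side l"
    have "v m \<in> open_segment (v l) ?P"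
      unfolding in_segment using that side_nonzero[OF that(1)]
      by (auto simp: algebra_simps intro!: exI[of _ "c / q"])
    then show False
      using vertex_extreme[OF that(2)] vertex_in[OF that(1)] that(7) by (auto simp: extreme_point_of_def)
  qed
  \<comment> \<open>Position of \<open>v j\<close> along edge \<open>i\<close>, measured from
    \<open>v i\<close> in units of side \<open>i\<close>. Its sign tells which of the two vertices
    lies inside a segment starting at the other one.\<close>
  define c where "c = a - b * k"
  have vj: "v j = v i + c *\<^sub>R side i" using vv par by (simp add: c_def algebra_simps)
  consider "c = 0" | "0 < c" | "c < 0" by linarith
  then show "i = j"
  proof cases
    case 1 then show ?thesis using vj vertex_inj ij by simp
  next
    case 2
    have "v i + a *\<^sub>R side i \<in> T" using on_edge_in[of i a] ij a by (simp add: on_edge_eq)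
    moreover have "c < a" using k b by (simp add: c_def)
    ultimately show ?thesis using not_between[of i j c a] ij vj 2 a by simp
  next
    case 3
    have "v j + b *\<^sub>R side j \<in> T" using on_edge_in[of j b] ij b by (simp add: on_edge_eq)
    moreover have "v i = v j + (- c / k) *\<^sub>R side j" using vj k par by simp
    moreover have "- c / k < b" "0 < - c / k" using k a 3 by (simp_all add: c_def field_simps)
    ultimately show ?thesis using not_between[of j i "- c / k" b] ij b by simp
  qed
qed

lemma crossing_iff:
  assumes "j < n" "s \<noteq> v j \<bullet> e" "s \<noteq> next_vertex n v j \<bullet> e" "slope j \<noteq> 0"
  shows "0 \<le> \<tau> s j \<and> \<tau> s j \<le> 1 \<longleftrightarrow>
      (v j \<bullet> e < s \<and> s < next_vertex n v j \<bullet> e) \<or> (next_vertex n v j \<bullet> e < s \<and> s < v j \<bullet> e)"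
  using assms by (auto simp: \<tau>_def side_def inner_diff_left divide_simps split: if_splits)

lemma crossing_strict:
  assumes "j < n" "s \<noteq> v j \<bullet> e" "s \<noteq> next_vertex n v j \<bullet> e" "slope j \<noteq> 0" "0 \<le> \<tau> s j" "\<tau> s j \<le> 1"
  shows "0 < \<tau> s j" "\<tau> s j < 1"
  using assms by (auto simp: \<tau>_def side_def inner_diff_left divide_simps order_less_le split: if_splits)

text \<open>For equal signs of the slopes, \<open>slice_side\<close> applied to each edge at the
  crossing point of the other gives two opposite inequalities, so both edges meet the line in the
  same point, which is inner to both because the line avoids all vertices.\<close>

lemma crossing_unique:
  assumes ij: "i < n" "j < n" and s: "\<And>k. k < n \<Longrightarrow> s \<noteq> v k \<bullet> e"
    and sl: "0 < slope i * slope j"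
    and i: "0 \<le> \<tau> s i" "\<tau> s i \<le> 1" and j: "0 \<le> \<tau> s j" "\<tau> s j \<le> 1"
  shows "i = j"
proof -
  have nz: "slope i \<noteq> 0" "slope j \<noteq> 0" using sl by auto
  have nxt: "s \<noteq> next_vertex n v k \<bullet> e" for k
    using s[of "Suc k mod n"] n_pos by (simp add: next_vertex_def)
  let ?a = "on_edge i (\<tau> s i) \<bullet> w" and ?b = "on_edge j (\<tau> s j) \<bullet> w"
  have "frame w (s, ?a) \<in> T" "frame w (s, ?b) \<in> T"
    using on_edge_\<tau>[OF nz(1), of s] on_edge_\<tau>[OF nz(2), of s] on_edge_in ij i j by metis+
  then have "0 \<le> (?b - ?a) * slope i" "0 \<le> (?a - ?b) * slope j"
    using slice_side ij nz by auto
  then have "?a = ?b" using sl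
    by (smt (verit) mult_less_0_iff zero_less_mult_iff mult_pos_pos mult_neg_neg)
  then have "on_edge i (\<tau> s i) = on_edge j (\<tau> s j)"
    using on_edge_\<tau>[OF nz(1), of s] on_edge_\<tau>[OF nz(2), of s] by simp
  then show ?thesis
    using edge_interiors_disjoint[OF ij] crossing_strict[of _ s] ij s nxt nz i j sl by meson
qed

text \<open>This puts the boundary terms into the form of the fundamental theorem of calculus on the
  line. The first alternative covers lines that miss \<open>T\<close>, where no edge may contribute
  either.\<close>

lemma sum_edge_slice:
  assumes s: "\<And>k. k < n \<Longrightarrow> s \<noteq> v k \<bullet> e"
  shows "{t. frame w (s, t) \<in> T} = {} \<and> (\<Sum>j<n. edge_slice g j s) = 0 \<or>
    (\<exists>a b. a \<le> b \<and> {t. frame w (s, t) \<in> T} = {a..b} \<and>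
       (\<Sum>j<n. edge_slice g j s) = g (frame w (s, b)) - g (frame w (s, a)))"
proof (cases "{t. frame w (s, t) \<in> T} = {}")
  case True
  have "edge_slice g j s = 0" if "j < n" for j
  proof (rule ccontr)
    assume "edge_slice g j s \<noteq> 0"
    then have j: "slope j \<noteq> 0" "0 \<le> \<tau> s j" "\<tau> s j \<le> 1"
      by (auto simp: edge_slice_def sgn_zero_iff indicator_def split: if_splits)
    have "on_edge j (\<tau> s j) \<bullet> w \<in> {t. frame w (s, t) \<in> T}"
      using on_edge_in[OF that j(2,3)] on_edge_\<tau>[OF j(1), of s] by (metis mem_Collect_eq)
    then show False using True by simp
  qed
  then show ?thesis using True by simp
next
  case False
  let ?S = "{t. frame w (s, t) \<in> T}"
  have "?S = (\<lambda>x. x \<bullet> w) ` (T \<inter> {x. e \<bullet> x = s})"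
  proof safe
    fix t assume "frame w (s, t) \<in> T"
    then show "t \<in> (\<lambda>x. x \<bullet> w) ` (T \<inter> {x. e \<bullet> x = s})"
      by (intro image_eqI[of _ _ "frame w (s, t)"])
        (auto simp: frame_eq inner_add_left inner_add_right e_inner)
  next
    fix x assume "x \<in> T" then show "frame w (e \<bullet> x, x \<bullet> w) \<in> T"
      using frame_surj[of x] by (simp add: inner_commute)
  qed
  moreover have "compact (T \<inter> {x. e \<bullet> x = s})" "convex (T \<inter> {x. e \<bullet> x = s})"
    using compact convex by (auto intro!: compact_Int_closed closed_hyperplane convex_Int convex_hyperplane)
  ultimately have "compact ?S" "connected ?S"
    by (auto intro!: compact_continuous_image connected_continuous_image continuous_intros
        simp: convex_connected)
  then obtain a b where ab: "?S = {a..b}" using connected_compact_interval_1[of ?S] by (auto simp: cbox_interval)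
  have "a \<le> b" using False ab by auto
  obtain t0 where t0: "frame w (s, t0) \<in> T" using False by auto
  \<comment> \<open>With all vertices on one side of the line, their hull would lie in an open half
    plane and the line would miss \<open>T\<close>.\<close>
  have left: "\<exists>k<n. v k \<bullet> e < s"
  proof (rule ccontr)
    assume "\<not> ?thesis"
    then have "v ` {..<n} \<subseteq> {x. e \<bullet> x > s}" using s by (force simp: inner_commute)
    then have "T \<subseteq> {x. e \<bullet> x > s}"
      using hull_minimal[of "v ` {..<n}" "{x. e \<bullet> x > s}" convex] hull_vertices
      by (simp add: convex_halfspace_gt)
    then show False using t0 frame_inner_e[of s t0] by (auto simp: inner_commute)
  qed
  have right: "\<exists>k<n. s < v k \<bullet> e"
  proof (rule ccontr)
    assume "\<not> ?thesis"
    then have "v ` {..<n} \<subseteq> {x. e \<bullet> x < s}" using s by (force simp: inner_commute)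
    then have "T \<subseteq> {x. e \<bullet> x < s}"
      using hull_minimal[of "v ` {..<n}" "{x. e \<bullet> x < s}" convex] hull_vertices
      by (simp add: convex_halfspace_lt)
    then show False using t0 frame_inner_e[of s t0] by (auto simp: inner_commute)
  qed
  obtain i where i: "i < n" "v i \<bullet> e < s" "s < next_vertex n v i \<bullet> e"
    using left right s cyclic_crossing[of _ n _ "\<lambda>k. v k \<bullet> e" s] unfolding next_vertex_def by metis
  obtain k where k: "k < n" "s < v k \<bullet> e" "next_vertex n v k \<bullet> e < s"
    using left right s cyclic_crossing_down[of _ n _ "\<lambda>k. v k \<bullet> e" s] unfolding next_vertex_def by metis
  have sli: "0 < slope i" and slk: "slope k < 0"
    using i k by (auto simp: side_def inner_diff_left)
  have ti: "0 \<le> \<tau> s i" "\<tau> s i \<le> 1" using crossing_iff[of i s] i sli by auto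
  have tk: "0 \<le> \<tau> s k" "\<tau> s k \<le> 1" using crossing_iff[of k s] k slk by auto
  \<comment> \<open>The crossing point belongs to the slice, so it is not below \<open>a\<close>;
    conversely \<open>slice_side\<close> at the point \<open>a\<close> of \<open>T\<close> shows
    that it is not above \<open>a\<close>.\<close>
  have Pi: "on_edge i (\<tau> s i) = frame w (s, a)"
  proof -
    let ?t = "on_edge i (\<tau> s i) \<bullet> w"
    have eq: "on_edge i (\<tau> s i) = frame w (s, ?t)" using on_edge_\<tau> sli by simp
    then have "?t \<in> ?S" using on_edge_in[OF i(1) ti] by simp
    then have "a \<le> ?t" using ab by simp
    moreover have "a \<in> ?S" using ab \<open>a \<le> b\<close> by simp
    then have "?t \<le> a" using slice_side[OF i(1), of s a] sli by (simp add: zero_le_mult_iff)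
    ultimately show ?thesis using eq by simp
  qed
  have Pk: "on_edge k (\<tau> s k) = frame w (s, b)"
  proof -
    let ?t = "on_edge k (\<tau> s k) \<bullet> w"
    have eq: "on_edge k (\<tau> s k) = frame w (s, ?t)" using on_edge_\<tau> slk by simp
    then have "?t \<in> ?S" using on_edge_in[OF k(1) tk] by simp
    then have "?t \<le> b" using ab by simp
    moreover have "b \<in> ?S" using ab \<open>a \<le> b\<close> by simp
    then have "b \<le> ?t" using slice_side[OF k(1), of s b] slk by (simp add: zero_le_mult_iff)
    ultimately show ?thesis using eq by simp
  qed
  have "i \<noteq> k" using sli slk by auto
  \<comment> \<open>A further crossing edge would share the sign of its slope with \<open>i\<close>
    or with \<open>k\<close> and so coincide with it.\<close>
  have other: "edge_slice g j s = 0" if "j \<in> {..<n} - {i, k}" for j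
  proof (rule ccontr)
    assume "edge_slice g j s \<noteq> 0"
    then have j: "slope j \<noteq> 0" "0 \<le> \<tau> s j" "\<tau> s j \<le> 1"
      by (auto simp: edge_slice_def sgn_zero_iff indicator_def split: if_splits)
    then have "0 < slope j * slope i \<or> 0 < slope j * slope k"
      using sli slk by (auto simp: zero_less_mult_iff)
    then show False
      using crossing_unique[of j i s] crossing_unique[of j k s] s i(1) k(1) ti tk j that by auto
  qed
  have "(\<Sum>j<n. edge_slice g j s) = (\<Sum>j\<in>{i, k}. edge_slice g j s)"
    using other i(1) k(1) by (intro sum.mono_neutral_right) auto
  also have "\<dots> = g (frame w (s, b)) - g (frame w (s, a))"
    using \<open>i \<noteq> k\<close> sli slk ti tk Pi Pk by (simp add: edge_slice_def)
  finally show ?thesis using ab \<open>a \<le> b\<close> by blast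
qed

text \<open>Substituting the parameter of the edge for \<open>s\<close> costs the factor
  \<open>\<bar>slope j\<bar>\<close>; together with the sign it becomes \<open>- slope j\<close>,
  which is the edge length times the \<open>w\<close>-component of the normal. For slope zero both
  sides vanish.\<close>

lemma edge_slice_integral:
  assumes j: "j < n" and g: "continuous_on T g"
  shows "integrable lborel (edge_slice g j)"
    and "integral\<^sup>L lborel (edge_slice g j) = (edge_normal n v j \<bullet> w) * edge_integral n v j g"
proof -
  define h where "h t = indicator {0..1} t * g (on_edge j t)" for t :: real
  have cont: "continuous_on {0..1} (\<lambda>t. g (on_edge j t))"
    by (rule continuous_on_compose2[OF g]) (auto simp: on_edge_eq[abs_def] on_edge_in[OF j, unfolded on_edge_eq] intro!: continuous_intros)
  have h: "integrable lborel h"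
    using borel_integrable_compact[OF _ cont] by (simp add: h_def[abs_def])
  have edge: "edge_integral n v j g = edge_length n v j * integral\<^sup>L lborel h"
  proof -
    have "integral\<^sup>L (lebesgue_on {0..1}) (\<lambda>t. g (on_edge j t)) = integral\<^sup>L lebesgue h"
      by (subst integral_restrict_space) (auto simp: h_def[abs_def])
    also have "\<dots> = integral\<^sup>L lborel h" using h by (simp add: integral_completion)
    finally show ?thesis by (simp add: edge_integral_def on_edge_def)
  qed
  have normal: "edge_normal n v j \<bullet> w = - slope j / edge_length n v j"
    by (simp add: edge_normal_eq inner_vec_def sum_2 e_def algebra_simps diff_divide_distrib)
  have eq: "edge_slice g j = (\<lambda>s. - sgn (slope j) * h (- (v j \<bullet> e / slope j) + (1 / slope j) * s))"
    by (auto simp: edge_slice_def h_def \<tau>_def diff_divide_distrib fun_eq_iff)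
  show "integrable lborel (edge_slice g j)"
    unfolding eq
    by (cases "slope j = 0") (simp, intro integrable_mult_right lborel_integrable_real_affine[OF h], simp)
  show "integral\<^sup>L lborel (edge_slice g j) = (edge_normal n v j \<bullet> w) * edge_integral n v j g"
  proof (cases "slope j = 0")
    case True then show ?thesis by (simp add: eq normal)
  next
    case False
    have "integral\<^sup>L lborel h = \<bar>1 / slope j\<bar> * (\<integral>s. h (- (v j \<bullet> e / slope j) + (1 / slope j) * s) \<partial>lborel)"
      using lborel_integral_real_affine[of "1 / slope j" h "- (v j \<bullet> e / slope j)"] False by simp
    then show ?thesis using False edge_length_pos[OF j]
      by (cases "0 < slope j") (simp_all add: eq normal edge sgn_if field_simps)
  qed
qed

text \<open>Fubini in the coordinates of \<open>frame\<close>, the fundamental theorem of calculus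
  on each line, and \<open>sum_edge_slice\<close> to read its two end point values as edge
  contributions.\<close>

lemma slice_gauss:
  fixes g :: "real^2 \<Rightarrow> real" and G :: "real^2 \<Rightarrow> real^2"
  assumes D: "\<And>x. x \<in> T \<Longrightarrow> (g has_derivative (\<lambda>h. G x \<bullet> h)) (at x within T)"
    and G: "continuous_on T G"
  shows "integral\<^sup>L (lebesgue_on T) (\<lambda>x. G x \<bullet> w) =
    (\<Sum>j<n. (edge_normal n v j \<bullet> w) * edge_integral n v j g)"
proof -
  have g: "continuous_on T g"
    using D has_derivative_continuous continuous_on_eq_continuous_within by blast
  define H where "H x = indicator T x *\<^sub>R (G x \<bullet> w)" for x
  have H: "integrable lborel H"
    unfolding H_def by (intro borel_integrable_compact compact continuous_intros G)
  have frame_meas: "frame w \<in> measurable (lborel \<Otimes>\<^sub>M lborel) borel"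
    unfolding frame_def[abs_def] by measurable
  have HF: "integrable (lborel \<Otimes>\<^sub>M lborel) (\<lambda>p. H (frame w p))"
    using H integrable_distr_eq[OF frame_meas, of H] frame_lborel by simp
  have "integral\<^sup>L (lebesgue_on T) (\<lambda>x. G x \<bullet> w) = integral\<^sup>L lebesgue H"
    unfolding H_def using closed by (intro integral_restrict_space) auto
  also have "\<dots> = integral\<^sup>L lborel H" using H by (simp add: integral_completion)
  also have "\<dots> = integral\<^sup>L (distr (lborel \<Otimes>\<^sub>M lborel) borel (frame w)) H"
    by (simp add: frame_lborel)
  also have "\<dots> = (\<integral>p. H (frame w p) \<partial>(lborel \<Otimes>\<^sub>M lborel))"
    using H by (intro integral_distr frame_meas) auto
  also have "\<dots> = (\<integral>s. \<integral>t. H (frame w (s, t)) \<partial>lborel \<partial>lborel)"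
    by (rule lborel_pair.integral_fst'[OF HF, symmetric])
  also have "\<dots> = (\<integral>s. (\<Sum>j<n. edge_slice g j s) \<partial>lborel)"
  proof (rule integral_cong_AE)
    show "(\<lambda>s. \<integral>t. H (frame w (s, t)) \<partial>lborel) \<in> borel_measurable lborel"
      using lborel_pair.integrable_fst'[OF HF] by simp
    show "(\<lambda>s. \<Sum>j<n. edge_slice g j s) \<in> borel_measurable lborel"
      using edge_slice_integral(1)[OF _ g] by auto
    \<comment> \<open>Only the finitely many lines through vertices are excluded.\<close>
    have "AE s in lborel. s \<notin> (\<lambda>k. v k \<bullet> e) ` {..<n}"
      by (rule AE_not_in) (auto intro: finite_imp_null_set_lborel)
    then show "AE s in lborel. (\<integral>t. H (frame w (s, t)) \<partial>lborel) = (\<Sum>j<n. edge_slice g j s)"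
    proof eventually_elim
      case (elim s)
      then have s: "s \<noteq> v k \<bullet> e" if "k < n" for k using that by auto
      show ?case
      proof (cases "{t. frame w (s, t) \<in> T} = {}")
        case True
        then have "(\<lambda>t. H (frame w (s, t))) = (\<lambda>t. 0)" by (auto simp: H_def)
        moreover have "(\<Sum>j<n. edge_slice g j s) = 0"
          using sum_edge_slice[OF s, of g] True by auto
        ultimately show ?thesis by simp
      next
        case False
        then obtain a b where ab: "a \<le> b" "{t. frame w (s, t) \<in> T} = {a..b}"
          and sum: "(\<Sum>j<n. edge_slice g j s) = g (frame w (s, b)) - g (frame w (s, a))"
          using sum_edge_slice[OF s, of g] by auto
        have mem: "frame w (s, t) \<in> T \<longleftrightarrow> t \<in> {a..b}" for t using ab(2) by blast
        have F: "((\<lambda>t. frame w (s, t)) has_derivative (\<lambda>h. h *\<^sub>R w)) (at t within {a..b})" for t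
          unfolding frame_eq by (auto intro!: derivative_eq_intros)
        have "(\<integral>t. H (frame w (s, t)) \<partial>lborel)
            = (\<integral>t. indicator {a..b} t *\<^sub>R (G (frame w (s, t)) \<bullet> w) \<partial>lborel)"
          using mem by (intro Bochner_Integration.integral_cong) (auto simp: H_def indicator_def)
        also have "\<dots> = g (frame w (s, b)) - g (frame w (s, a))"
        proof (rule integral_FTC_Icc[OF ab(1), where F = "\<lambda>t. g (frame w (s, t))"
              and f = "\<lambda>t. G (frame w (s, t)) \<bullet> w"])
          fix t assume t: "a \<le> t" "t \<le> b"
          have img: "(\<lambda>t. frame w (s, t)) ` {a..b} \<subseteq> T"
            by (rule image_subsetI) (simp only: mem)
          have "(g has_derivative (\<lambda>h. G (frame w (s, t)) \<bullet> h)) (at (frame w (s, t)) within (\<lambda>t. frame w (s, t)) ` {a..b})"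
          proof (rule has_derivative_subset[OF D img])
            show "frame w (s, t) \<in> T" using t by (simp only: mem atLeastAtMost_iff)
          qed
          from has_derivative_in_compose[OF F this]
          show "((\<lambda>t. g (frame w (s, t))) has_vector_derivative G (frame w (s, t)) \<bullet> w) (at t within {a..b})"
            by (simp add: has_vector_derivative_def)
        next
          show "continuous_on {a..b} (\<lambda>t. G (frame w (s, t)) \<bullet> w)"
          proof (intro continuous_on_inner continuous_on_const continuous_on_compose2[OF G])
            show "continuous_on {a..b} (\<lambda>t. frame w (s, t))"
              unfolding frame_eq by (intro continuous_intros)
            show "(\<lambda>t. frame w (s, t)) ` {a..b} \<subseteq> T"
              by (rule image_subsetI) (simp only: mem)
          qed
        qed
        finally show ?thesis using sum by simp
      qed
    qed
  qed
  also have "\<dots> = (\<Sum>j<n. integral\<^sup>L lborel (edge_slice g j))"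
    using edge_slice_integral(1)[OF _ g] by (intro Bochner_Integration.integral_sum) auto
  also have "\<dots> = (\<Sum>j<n. (edge_normal n v j \<bullet> w) * edge_integral n v j g)"
    using edge_slice_integral(2)[OF _ g] by simp
  finally show ?thesis .
qed

end

text \<open>For an axis direction the preimage of a box is a product of intervals with the same
  lengths, possibly reflected and exchanged, and boxes determine the Lebesgue measure. The axes are
  the only directions that Gauss' theorem needs.\<close>

lemma frame_axis_lborel:
  "distr (lborel \<Otimes>\<^sub>M lborel) borel (frame (axis i 1)) = lborel"
proof (rule lborel_eqI[symmetric])
  show "sets (distr (lborel \<Otimes>\<^sub>M lborel) borel (frame (axis i 1))) = sets borel" by simp
  fix l u :: "real^2" assume le: "\<And>b. b \<in> Basis \<Longrightarrow> l \<bullet> b \<le> u \<bullet> b"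
  have lu: "l $ k \<le> u $ k" for k using le[of "axis k 1"] by (simp add: inner_axis)
  have meas: "frame (axis i 1) \<in> measurable (lborel \<Otimes>\<^sub>M lborel) borel"
    unfolding frame_def[abs_def] by measurable
  have prod: "(\<Prod>b\<in>Basis. (u - l) \<bullet> b) = (u $ 1 - l $ 1) * (u $ 2 - l $ 2)"
    by (simp add: Basis_vec_def UNIV_2 inner_axis axis_eq_axis)
  have "emeasure (distr (lborel \<Otimes>\<^sub>M lborel) borel (frame (axis i 1))) (box l u)
      = emeasure (lborel \<Otimes>\<^sub>M lborel) (frame (axis i 1) -` box l u)"
    using meas by (subst emeasure_distr) (auto simp: space_pair_measure)
  also have "\<dots> = ennreal ((u $ 1 - l $ 1) * (u $ 2 - l $ 2))"
  proof (cases "i = 1")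
    case True
    have "frame (axis i 1) -` box l u = {- (u $ 2) <..< - (l $ 2)} \<times> {l $ 1 <..< u $ 1}"
      using True by (auto simp: frame_def mem_box_cart forall_2 axis_def)
    then show ?thesis using lu[of 1] lu[of 2]
      by (simp add: lborel.emeasure_pair_measure_Times ennreal_mult' mult.commute)
  next
    case False
    then have "i = 2" using exhaust_2 by auto
    then have "frame (axis i 1) -` box l u = {l $ 1 <..< u $ 1} \<times> {l $ 2 <..< u $ 2}"
      by (auto simp: frame_def mem_box_cart forall_2 axis_def)
    then show ?thesis using lu[of 1] lu[of 2]
      by (simp add: lborel.emeasure_pair_measure_Times ennreal_mult')
  qed
  finally show "emeasure (distr (lborel \<Otimes>\<^sub>M lborel) borel (frame (axis i 1))) (box l u)
      = (\<Prod>b\<in>Basis. (u - l) \<bullet> b)" using prod by simp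
qed

lemma (in polygon) gauss:
  assumes "\<And>x. x \<in> T \<Longrightarrow> (g has_derivative (\<lambda>h. G x \<bullet> h)) (at x within T)" "continuous_on T G"
  shows "integral\<^sup>L (lebesgue_on T) (\<lambda>x. G x $ i) =
    (\<Sum>j<n. edge_normal n v j $ i * edge_integral n v j g)"
proof -
  interpret polygon_slices T n v "axis i 1"
  proof
    show "(axis i 1 $ 1)\<^sup>2 + (axis i 1 $ 2)\<^sup>2 = (1::real)"
      using exhaust_2[of i] by (auto simp: axis_def)
  qed (rule frame_axis_lborel)
  show ?thesis using slice_gauss[OF assms] by (simp add: inner_axis)
qed

section \<open>Smooth functions\<close>

definition gradient :: "(real^2 \<Rightarrow> real) \<Rightarrow> real^2 \<Rightarrow> real^2" where
  "gradient f x = (\<chi> i. partial_deriv i f x)"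

lemma inner_eq_linear:
  fixes D :: "real^2 \<Rightarrow> real"
  assumes "bounded_linear D"
  shows "(\<chi> i. D (axis i 1)) \<bullet> h = D h"
proof -
  interpret bounded_linear D by fact
  have "h = (\<Sum>i\<in>UNIV. (h $ i) *\<^sub>R axis i 1)"
    using basis_expansion[of h] by (simp add: scalar_mult_eq_scaleR)
  then have "D h = D (\<Sum>i\<in>UNIV. (h $ i) *\<^sub>R axis i 1)" by simp
  also have "\<dots> = (\<Sum>i\<in>UNIV. h $ i * D (axis i 1))" by (simp add: sum scaleR)
  finally show ?thesis by (simp add: inner_vec_def mult.commute)
qed

lemma partial_deriv_unique:
  assumes "(f has_derivative D) (at x)" shows "partial_deriv i f x = D (axis i 1)"
  using frechet_derivative_at[OF assms] by (simp add: partial_deriv_def)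

lemma has_derivative_gradient:
  assumes "f differentiable at x" shows "(f has_derivative (\<lambda>h. gradient f x \<bullet> h)) (at x)"
proof -
  from assms obtain D where D: "(f has_derivative D) (at x)" by (auto simp: differentiable_def)
  have "(\<lambda>h. gradient f x \<bullet> h) = D"
    unfolding gradient_def partial_deriv_unique[OF D]
    using inner_eq_linear[OF has_derivative_bounded_linear[OF D]] by blast
  then show ?thesis using D by simp
qed

lemma gradient_unique:
  assumes "(f has_derivative (\<lambda>h. G \<bullet> h)) (at x)" shows "partial_deriv i f x = G $ i"
  using partial_deriv_unique[OF assms] by (simp add: inner_axis)

lemma C_k_SucI:
  assumes "\<And>x. (f has_derivative D x) (at x)" "\<And>i. C_k k (\<lambda>x. D x (axis i 1))"
  shows "C_k (Suc k) f"
proof -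
  have "partial_deriv i f = (\<lambda>x. D x (axis i 1))" for i
    using partial_deriv_unique[OF assms(1)] by blast
  then show ?thesis
    using assms by (auto simp: differentiable_on_def intro: differentiableI differentiable_at_withinI)
qed

lemma C_k_SucD:
  assumes "C_k (Suc k) f"
  shows "f differentiable at x" "C_k k (partial_deriv i f)"
    "(f has_derivative (\<lambda>h. gradient f x \<bullet> h)) (at x)"
  using assms has_derivative_gradient by (auto simp: differentiable_on_def)

lemma C_k_lower: "C_k (Suc k) f \<Longrightarrow> C_k k f"
proof (induction k arbitrary: f)
  case 0
  then show ?case
    by (auto intro: differentiable_imp_continuous_on simp: differentiable_on_def)
next
  case (Suc k)
  then show ?case by (metis C_k.simps(2))
qed

lemma C_k_continuous: "C_k k f \<Longrightarrow> continuous_on UNIV f"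
  by (induction k) (use C_k_lower in auto)

lemma C_k_const: "C_k k (\<lambda>x. c)"
proof (induction k arbitrary: c)
  case (Suc k)
  show ?case by (rule C_k_SucI[where D = "\<lambda>_ _. 0"]) (auto simp: Suc)
qed simp

lemma C_k_add: "C_k k f \<Longrightarrow> C_k k g \<Longrightarrow> C_k k (\<lambda>x. f x + g x)"
proof (induction k arbitrary: f g)
  case 0 then show ?case by (auto intro: continuous_intros)
next
  case (Suc k)
  show ?case
  proof (rule C_k_SucI)
    show "((\<lambda>x. f x + g x) has_derivative (\<lambda>h. gradient f x \<bullet> h + gradient g x \<bullet> h)) (at x)" for x
      using C_k_SucD(3)[OF Suc.prems(1)] C_k_SucD(3)[OF Suc.prems(2)] by (rule has_derivative_add)
    show "C_k k (\<lambda>x. gradient f x \<bullet> axis i 1 + gradient g x \<bullet> axis i 1)" for i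
      using Suc.IH[OF C_k_SucD(2)[OF Suc.prems(1)] C_k_SucD(2)[OF Suc.prems(2)], of i i]
      by (simp add: inner_axis gradient_def)
  qed
qed

lemma C_k_mult: "C_k k f \<Longrightarrow> C_k k g \<Longrightarrow> C_k k (\<lambda>x. f x * g x)"
proof (induction k arbitrary: f g)
  case 0 then show ?case by (auto intro: continuous_intros)
next
  case (Suc k)
  show ?case
  proof (rule C_k_SucI)
    show "((\<lambda>x. f x * g x) has_derivative (\<lambda>h. f x * (gradient g x \<bullet> h) + (gradient f x \<bullet> h) * g x)) (at x)" for x
      using C_k_SucD(3)[OF Suc.prems(1)] C_k_SucD(3)[OF Suc.prems(2)] by (rule has_derivative_mult)
    show "C_k k (\<lambda>x. f x * (gradient g x \<bullet> axis i 1) + (gradient f x \<bullet> axis i 1) * g x)" for i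
      using C_k_add[OF Suc.IH[OF C_k_lower[OF Suc.prems(1)] C_k_SucD(2)[OF Suc.prems(2)]]
          Suc.IH[OF C_k_SucD(2)[OF Suc.prems(1)] C_k_lower[OF Suc.prems(2)]], of i i]
      by (simp add: inner_axis gradient_def)
  qed
qed

lemma C_k_affine: "C_k k f \<Longrightarrow> C_k k (\<lambda>x. f (c *\<^sub>R x + d))"
proof (induction k arbitrary: f)
  case 0 then show ?case by (auto intro!: continuous_intros continuous_on_compose2[of UNIV f])
next
  case (Suc k)
  show ?case
  proof (rule C_k_SucI)
    show "((\<lambda>x. f (c *\<^sub>R x + d)) has_derivative (\<lambda>h. gradient f (c *\<^sub>R x + d) \<bullet> (c *\<^sub>R h))) (at x)" for x
      by (rule has_derivative_compose[of "\<lambda>x. c *\<^sub>R x + d", OF _ C_k_SucD(3)[OF Suc.prems]])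
        (auto intro!: derivative_eq_intros)
    show "C_k k (\<lambda>x. gradient f (c *\<^sub>R x + d) \<bullet> (c *\<^sub>R axis i 1))" for i
      using C_k_mult[OF C_k_const Suc.IH[OF C_k_SucD(2)[OF Suc.prems]], of c i]
      by (simp add: inner_axis gradient_def)
  qed
qed

text \<open>Both mixed partial derivatives are limits of the second difference divided by \<open>h\<^sup>2\<close>.\<close>

lemma second_difference:
  assumes f: "C_k (Suc (Suc k)) f" and h: "0 < h"
  shows "\<exists>y. dist y x \<le> 2 * h \<and>
    f (x + h *\<^sub>R axis i 1 + h *\<^sub>R axis j 1) - f (x + h *\<^sub>R axis i 1) - f (x + h *\<^sub>R axis j 1) + f x
      = h\<^sup>2 * partial_deriv j (partial_deriv i f) y"
proof -
  let ?a = "axis i 1 :: real^2" and ?b = "axis j 1 :: real^2"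
  \<comment> \<open>The increment in direction \<open>j\<close> as a function of the position in
    direction \<open>i\<close>. The mean value theorem applied to it, and then to the partial
    derivative in direction \<open>j\<close>, produces the mixed derivative at a nearby
    point.\<close>
  define \<phi> where "\<phi> t = f (x + t *\<^sub>R ?a + h *\<^sub>R ?b) - f (x + t *\<^sub>R ?a)" for t
  have line: "((\<lambda>t. g (z + t *\<^sub>R axis l 1)) has_real_derivative partial_deriv l g (z + t *\<^sub>R axis l 1)) (at t)"
    if "C_k (Suc m) g" for g z l t m
  proof -
    have "((\<lambda>t. g (z + t *\<^sub>R axis l 1)) has_derivative (\<lambda>s. gradient g (z + t *\<^sub>R axis l 1) \<bullet> (s *\<^sub>R axis l 1))) (at t)"
      by (rule has_derivative_compose[of "\<lambda>t. z + t *\<^sub>R axis l 1", OF _ C_k_SucD(3)[OF that]])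
        (auto intro!: derivative_eq_intros)
    then show ?thesis
      by (simp add: has_field_derivative_def inner_axis gradient_def mult_commute_abs)
  qed
  have d\<phi>: "(\<phi> has_real_derivative
      partial_deriv i f (x + t *\<^sub>R ?a + h *\<^sub>R ?b) - partial_deriv i f (x + t *\<^sub>R ?a)) (at t)" for t
    unfolding \<phi>_def
    using DERIV_diff[OF line[OF f, of "x + h *\<^sub>R ?b" i t] line[OF f, of x i t]]
    by (simp add: algebra_simps)
  obtain \<xi> where \<xi>: "0 < \<xi>" "\<xi> < h"
    and 1: "\<phi> h - \<phi> 0 = (h - 0) * (partial_deriv i f (x + \<xi> *\<^sub>R ?a + h *\<^sub>R ?b) - partial_deriv i f (x + \<xi> *\<^sub>R ?a))"
    using MVT2[OF h, of \<phi>, OF d\<phi>] by blast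
  obtain \<eta> where \<eta>: "0 < \<eta>" "\<eta> < h"
    and 2: "partial_deriv i f (x + \<xi> *\<^sub>R ?a + h *\<^sub>R ?b) - partial_deriv i f (x + \<xi> *\<^sub>R ?a + 0 *\<^sub>R ?b)
      = (h - 0) * partial_deriv j (partial_deriv i f) (x + \<xi> *\<^sub>R ?a + \<eta> *\<^sub>R ?b)"
    using MVT2[OF h, of "\<lambda>t. partial_deriv i f (x + \<xi> *\<^sub>R ?a + t *\<^sub>R ?b)", OF line[OF C_k_SucD(2)[OF f]]] by blast
  have "dist (x + \<xi> *\<^sub>R ?a + \<eta> *\<^sub>R ?b) x \<le> 2 * h"
    using norm_triangle_ineq[of "\<xi> *\<^sub>R ?a" "\<eta> *\<^sub>R ?b"] \<xi> \<eta> by (simp add: dist_norm add.assoc)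
  moreover have "\<phi> h - \<phi> 0 = h\<^sup>2 * partial_deriv j (partial_deriv i f) (x + \<xi> *\<^sub>R ?a + \<eta> *\<^sub>R ?b)"
    using 1 2 by (simp add: power2_eq_square)
  ultimately show ?thesis unfolding \<phi>_def by (intro exI conjI) (auto simp: algebra_simps)
qed

lemma partial_deriv_commute:
  assumes f: "C_k (Suc (Suc 0)) f"
  shows "partial_deriv j (partial_deriv i f) x = partial_deriv i (partial_deriv j f) x"
proof -
  define h where "h m = 1 / real (Suc m)" for m
  have h: "0 < h m" for m by (simp add: h_def)
  have "\<forall>m. \<exists>y. dist y x \<le> 2 * h m \<and>
      f (x + h m *\<^sub>R axis i 1 + h m *\<^sub>R axis j 1) - f (x + h m *\<^sub>R axis i 1) - f (x + h m *\<^sub>R axis j 1) + f x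
      = (h m)\<^sup>2 * partial_deriv j (partial_deriv i f) y" for i j
    using second_difference[OF f h] by blast
  from choice[OF this] obtain y z where y: "dist (y m) x \<le> 2 * h m" and
    y_eq: "f (x + h m *\<^sub>R axis i 1 + h m *\<^sub>R axis j 1) - f (x + h m *\<^sub>R axis i 1) - f (x + h m *\<^sub>R axis j 1) + f x
      = (h m)\<^sup>2 * partial_deriv j (partial_deriv i f) (y m)"
    and z: "dist (z m) x \<le> 2 * h m" and
    z_eq: "f (x + h m *\<^sub>R axis j 1 + h m *\<^sub>R axis i 1) - f (x + h m *\<^sub>R axis j 1) - f (x + h m *\<^sub>R axis i 1) + f x
      = (h m)\<^sup>2 * partial_deriv i (partial_deriv j f) (z m)" for m
    by blast
  \<comment> \<open>The second difference is symmetric in the two directions, so both mixed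
    derivatives take the same value at their respective intermediate points.\<close>
  have eq: "partial_deriv j (partial_deriv i f) (y m) = partial_deriv i (partial_deriv j f) (z m)" for m
  proof -
    have "(h m)\<^sup>2 * partial_deriv j (partial_deriv i f) (y m) = (h m)\<^sup>2 * partial_deriv i (partial_deriv j f) (z m)"
      unfolding y_eq[symmetric] z_eq[symmetric] by (simp add: algebra_simps)
    then show ?thesis using h[of m] by simp
  qed
  have h0: "(\<lambda>m. 2 * h m) \<longlonglongrightarrow> 0"
    unfolding h_def using tendsto_mult_right_zero[OF LIMSEQ_inverse_real_of_nat, of 2] by (simp add: inverse_eq_divide)
  have lim: "(\<lambda>m. partial_deriv l (partial_deriv k f) (u m)) \<longlonglongrightarrow> partial_deriv l (partial_deriv k f) x"
    if u: "\<And>m. dist (u m) x \<le> 2 * h m" for u l k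
  proof -
    have "u \<longlonglongrightarrow> x"
      using tendsto_sandwich[OF _ _ tendsto_const h0, of "\<lambda>m. dist (u m) x"] u
      by (subst tendsto_dist_iff) auto
    moreover have cont: "continuous_on UNIV (partial_deriv l (partial_deriv k f))"
      using f by simp
    ultimately show ?thesis
      by (intro continuous_on_tendsto_compose[OF cont]) simp_all
  qed
  show ?thesis using LIMSEQ_unique[OF lim[OF y] lim[OF z, of i j, folded eq]] .
qed

subsection \<open>Bump functions\<close>

text \<open>The classical flat function exp(-1/t) with a polynomial factor in 1/t; allowing the
  factor makes the family closed under differentiation.\<close>

definition flat :: "real poly \<Rightarrow> real \<Rightarrow> real" where
  "flat P t = (if 0 < t then poly P (1 / t) * exp (- (1 / t)) else 0)"

lemma poly_exp_tendsto_0: "((\<lambda>x. poly P x * exp (- x)) \<longlongrightarrow> (0::real)) at_top"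
proof -
  have "((\<lambda>x. \<Sum>i\<le>degree P. coeff P i * (x ^ i / exp x)) \<longlongrightarrow> (\<Sum>i\<le>degree P. coeff P i * 0)) at_top"
    by (intro tendsto_intros tendsto_power_div_exp_0)
  then show ?thesis by (simp add: poly_altdef exp_minus sum_distrib_right divide_inverse mult.assoc)
qed

lemma flat_tendsto_0: "(flat P \<longlongrightarrow> 0) (at 0)"
proof -
  have "((\<lambda>t. poly P (inverse t) * exp (- inverse t)) \<longlongrightarrow> 0) (at_right 0)"
    using filterlim_compose[OF poly_exp_tendsto_0 filterlim_inverse_at_top_right] .
  then have "(flat P \<longlongrightarrow> 0) (at_right 0)"
    by (rule Lim_transform_eventually)
      (auto simp: flat_def inverse_eq_divide eventually_at_filter)
  moreover have "(flat P \<longlongrightarrow> 0) (at_left 0)"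
    by (rule Lim_transform_eventually[of "\<lambda>_. 0"]) (auto simp: flat_def eventually_at_filter)
  ultimately show ?thesis by (simp add: filterlim_split_at)
qed

text \<open>For positive t the derivative of P(1/t) exp(-1/t) is t^(-2) (P - P')(1/t) exp(-1/t); the
  polynomial \<open>[:0, 0, 1:]\<close> is the square that produces t^(-2). Smoothness of all orders
  then follows by induction with \<open>P\<close> arbitrary.\<close>

lemma flat_has_derivative:
  "(flat P has_real_derivative flat ([:0, 0, 1:] * (P - pderiv P)) t) (at t)"
proof -
  consider "0 < t" | "t < 0" | "t = 0" by linarith
  then show ?thesis
  proof cases
    case 1
    have "((\<lambda>t. poly P (1 / t) * exp (- (1 / t))) has_real_derivative
        flat ([:0, 0, 1:] * (P - pderiv P)) t) (at t)"
      using 1 by (auto intro!: derivative_eq_intros DERIV_chain'[OF _ poly_DERIV] simp: flat_def field_simps power2_eq_square)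
    moreover have "\<forall>\<^sub>F u in nhds t. flat P u = poly P (1 / u) * exp (- (1 / u))"
      using eventually_nhds_in_open[of "{0<..}" t] 1 by (auto simp: flat_def elim!: eventually_mono)
    ultimately show ?thesis by (subst DERIV_cong_ev) auto
  next
    case 2
    have "\<forall>\<^sub>F u in nhds t. flat P u = 0"
      using eventually_nhds_in_open[of "{..<0}" t] 2 by (auto simp: flat_def elim!: eventually_mono)
    then show ?thesis using 2 by (subst DERIV_cong_ev[of t t _ "\<lambda>_. 0"]) (auto simp: flat_def)
  next
    case 3
    \<comment> \<open>The difference quotient at 0 is again a flat function: dividing by
      \<open>h\<close> multiplies the polynomial in 1/h by its variable, that is
      \<open>pCons 0 P\<close>.\<close>
    have "((\<lambda>h. flat P h / h) \<longlongrightarrow> 0) (at 0)"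
      by (rule Lim_transform_eventually[OF flat_tendsto_0[of "pCons 0 P"]])
        (auto simp: flat_def eventually_at_filter)
    then show ?thesis using 3 by (simp add: DERIV_def flat_def)
  qed
qed

lemma C_k_flat: "C_k k (\<lambda>x. flat P (x $ i))"
proof (induction k arbitrary: P)
  case 0
  have "continuous_on UNIV (flat P)"
    using flat_has_derivative DERIV_isCont continuous_at_imp_continuous_on by blast
  then show ?case by (auto intro!: continuous_on_compose2[of UNIV "flat P"] continuous_intros)
next
  case (Suc k)
  let ?Q = "[:0, 0, 1:] * (P - pderiv P)"
  show ?case
  proof (rule C_k_SucI)
    show "((\<lambda>x. flat P (x $ i)) has_derivative (\<lambda>h. flat ?Q (x $ i) * h $ i)) (at x)" for x :: "real^2"
      using has_derivative_compose[OF bounded_linear_imp_has_derivative[OF bounded_linear_vec_nth]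
            flat_has_derivative[unfolded has_field_derivative_def]] .
    show "C_k k (\<lambda>x. flat ?Q (x $ i) * axis j 1 $ i)" for j
      using C_k_mult[OF Suc C_k_const] .
  qed
qed

text \<open>A product of four flat functions, one for each side of the box, is positive exactly on
  the open box. Since that box is not a null set, the integral can be normalized to 1.\<close>

lemma bump_exists:
  fixes a b :: "real^2"
  assumes "box a b \<noteq> {}"
  obtains \<eta> where "\<And>k. C_k k \<eta>" "\<And>x. 0 \<le> \<eta> x" "\<And>x. \<eta> x \<noteq> 0 \<Longrightarrow> x \<in> cbox a b" "integral\<^sup>L lborel \<eta> = 1"
proof -
  define B where "B x = (flat 1 (x $ 1 - a $ 1) * flat 1 (b $ 1 - x $ 1)) *
    (flat 1 (x $ 2 - a $ 2) * flat 1 (b $ 2 - x $ 2))" for x :: "real^2"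
  have aff: "C_k k (\<lambda>x. flat 1 (x $ i - a $ i))" "C_k k (\<lambda>x. flat 1 (b $ i - x $ i))" for k i
    using C_k_affine[OF C_k_flat[of k 1 i], of 1 "- a"] C_k_affine[OF C_k_flat[of k 1 i], of "- 1" b] by simp_all
  have B: "C_k k B" for k unfolding B_def by (intro C_k_mult aff)
  have pos: "0 \<le> B x" for x by (auto simp: B_def flat_def)
  have supp: "B x \<noteq> 0 \<longleftrightarrow> x \<in> box a b" for x
    by (auto simp: B_def flat_def mem_box_cart forall_2)
  have cont: "continuous_on UNIV B" using C_k_continuous[OF B[of 0]] .
  have B_eq: "B = (\<lambda>x. indicator (cbox a b) x *\<^sub>R B x)"
    using supp box_subset_cbox[of a b] by (auto simp: fun_eq_iff indicator_def)
  have int: "integrable lborel B"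
    by (subst B_eq, rule borel_integrable_compact) (auto intro: continuous_on_subset[OF cont])
  have "integral\<^sup>L lborel B \<noteq> 0"
  proof
    assume "integral\<^sup>L lborel B = 0"
    then have "AE x in lborel. B x = 0" using integral_nonneg_eq_0_iff_AE[OF int] pos by simp
    then have "AE x in lborel. x \<notin> box a b" using supp by auto
    then have "box a b \<in> null_sets lborel" by (simp add: AE_iff_null_sets)
    then have "negligible (box a b)" by (simp add: negligible_iff_null_sets null_sets_completionI)
    then show False using assms open_not_negligible[OF open_box] by blast
  qed
  then have c: "0 < integral\<^sup>L lborel B" using Bochner_Integration.integral_nonneg[of lborel B] pos by (simp add: order_less_le)
  show ?thesis
  proof
    show "C_k k (\<lambda>x. 1 / integral\<^sup>L lborel B * B x)" for k by (intro C_k_mult C_k_const B)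
    show "0 \<le> 1 / integral\<^sup>L lborel B * B x" for x using c pos by simp
    show "1 / integral\<^sup>L lborel B * B x \<noteq> 0 \<Longrightarrow> x \<in> cbox a b" for x
      using supp box_subset_cbox[of a b] by auto
    show "(\<integral>x. 1 / integral\<^sup>L lborel B * B x \<partial>lborel) = 1" using c by simp
  qed
qed

section \<open>Square integrable functions\<close>

lemma L2_on_real:
  "L2_on S f \<longleftrightarrow> f \<in> borel_measurable (lebesgue_on S) \<and> integrable (lebesgue_on S) (\<lambda>x. (f x)\<^sup>2)"
  for f :: "'a::euclidean_space \<Rightarrow> real"
  by (simp add: L2_on_def)

lemma L2_norm_nonneg: "0 \<le> L2_norm S f"
  by (simp add: L2_norm_def)

lemma L2_norm_power2: "(L2_norm S f)\<^sup>2 = integral\<^sup>L (lebesgue_on S) (\<lambda>x. (norm (f x))\<^sup>2)"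
  by (simp add: L2_norm_def)

lemma L2_mult_integrable:
  fixes f g :: "'a::euclidean_space \<Rightarrow> real"
  assumes "L2_on S f" "L2_on S g"
  shows "integrable (lebesgue_on S) (\<lambda>x. f x * g x)"
proof (rule Bochner_Integration.integrable_bound)
  show "integrable (lebesgue_on S) (\<lambda>x. (f x)\<^sup>2 + (g x)\<^sup>2)"
    using assms by (auto simp: L2_on_real)
  have "\<bar>a * b\<bar> \<le> a\<^sup>2 + b\<^sup>2" for a b :: real
  proof -
    have "2 * \<bar>a * b\<bar> \<le> a\<^sup>2 + b\<^sup>2"
      using sum_squares_bound[of "\<bar>a\<bar>" "\<bar>b\<bar>"] by (simp add: abs_mult mult.assoc)
    then show ?thesis using abs_ge_zero[of "a * b"] by linarith
  qed
  then show "AE x in lebesgue_on S. norm (f x * g x) \<le> norm ((f x)\<^sup>2 + (g x)\<^sup>2)" by simp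
qed (use assms in \<open>auto simp: L2_on_real\<close>)

lemma L2_add: "L2_on S f \<Longrightarrow> L2_on S g \<Longrightarrow> L2_on S (\<lambda>x. f x + g x)"
  for f g :: "'a::euclidean_space \<Rightarrow> real"
  using L2_mult_integrable[of S f g] by (auto simp: L2_on_real power2_sum mult.assoc)

lemma L2_cmult: "L2_on S f \<Longrightarrow> L2_on S (\<lambda>x. c * f x)"
  for f :: "'a::euclidean_space \<Rightarrow> real"
  by (auto simp: L2_on_real power_mult_distrib)

lemma L2_diff: "L2_on S f \<Longrightarrow> L2_on S g \<Longrightarrow> L2_on S (\<lambda>x. f x - g x)"
  for f g :: "'a::euclidean_space \<Rightarrow> real"
  using L2_add[of S f "\<lambda>x. - 1 * g x"] L2_cmult[of S g "- 1"] by simp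

text \<open>The integral of (f - t g)^2 is a quadratic in \<open>t\<close> without negative values,
  so its discriminant is not positive.\<close>

lemma L2_Cauchy_Schwarz:
  fixes f g :: "'a::euclidean_space \<Rightarrow> real"
  assumes f: "L2_on S f" and g: "L2_on S g"
  shows "\<bar>\<integral>x. f x * g x \<partial>lebesgue_on S\<bar> \<le> L2_norm S f * L2_norm S g"
proof -
  define A B C where "A = (L2_norm S f)\<^sup>2" and "B = (L2_norm S g)\<^sup>2"
    and "C = (\<integral>x. f x * g x \<partial>lebesgue_on S)"
  have q: "0 \<le> A - 2 * t * C + t\<^sup>2 * B" for t
  proof -
    have "0 \<le> (\<integral>x. (f x - t * g x)\<^sup>2 \<partial>lebesgue_on S)" by simp
    also have "\<dots> = (\<integral>x. (f x)\<^sup>2 - 2 * t * (f x * g x) + t\<^sup>2 * (g x)\<^sup>2 \<partial>lebesgue_on S)"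
      by (intro Bochner_Integration.integral_cong refl) (simp add: power2_eq_square algebra_simps)
    also have "\<dots> = A - 2 * t * C + t\<^sup>2 * B"
      using f g L2_mult_integrable[OF f g] by (simp add: A_def B_def C_def L2_norm_power2 L2_on_real)
    finally show ?thesis .
  qed
  have "C\<^sup>2 \<le> A * B"
  proof (cases "B = 0")
    case True
    have "C = 0"
    proof (rule ccontr)
      \<comment> \<open>For \<open>B = 0\<close> the quadratic is affine in \<open>t\<close>; at
        this \<open>t\<close> it would equal -1.\<close>
      assume "C \<noteq> 0" then show False using q[of "(A + 1) / (2 * C)"] True by simp
    qed
    then show ?thesis using True by simp
  next
    case False
    then have "0 < B" by (simp add: B_def)
    then show ?thesis using q[of "C / B"] by (simp add: power2_eq_square field_simps)
  qed
  then have "C\<^sup>2 \<le> (L2_norm S f * L2_norm S g)\<^sup>2" by (simp add: A_def B_def power_mult_distrib)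
  then show ?thesis
    unfolding C_def[symmetric] by (rule power2_le_imp_le[of "\<bar>C\<bar>", simplified]) (simp add: L2_norm_nonneg)
qed

lemma L2_triangle:
  fixes f g :: "'a::euclidean_space \<Rightarrow> real"
  assumes f: "L2_on S f" and g: "L2_on S g"
  shows "L2_norm S (\<lambda>x. f x + g x) \<le> L2_norm S f + L2_norm S g"
proof (rule power2_le_imp_le)
  have "(L2_norm S (\<lambda>x. f x + g x))\<^sup>2
      = (\<integral>x. (f x)\<^sup>2 + 2 * (f x * g x) + (g x)\<^sup>2 \<partial>lebesgue_on S)"
    by (simp add: L2_norm_power2 power2_sum algebra_simps)
  also have "\<dots> = (L2_norm S f)\<^sup>2 + 2 * (\<integral>x. f x * g x \<partial>lebesgue_on S) + (L2_norm S g)\<^sup>2"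
    using f g L2_mult_integrable[OF f g] by (simp add: L2_norm_power2 L2_on_real)
  also have "\<dots> \<le> (L2_norm S f + L2_norm S g)\<^sup>2"
    using L2_Cauchy_Schwarz[OF f g] by (simp add: power2_sum)
  finally show "(L2_norm S (\<lambda>x. f x + g x))\<^sup>2 \<le> (L2_norm S f + L2_norm S g)\<^sup>2" .
qed (simp add: L2_norm_nonneg)

lemma L2_norm_cong_AE:
  fixes f g :: "'a::euclidean_space \<Rightarrow> real"
  assumes "AE x in lebesgue_on S. f x = g x"
    "f \<in> borel_measurable (lebesgue_on S)" "g \<in> borel_measurable (lebesgue_on S)"
  shows "L2_norm S f = L2_norm S g"
  unfolding L2_norm_def
  by (intro arg_cong[of _ _ sqrt] integral_cong_AE) (use assms in auto)

lemma L2_norm_minus_commute: "L2_norm S (\<lambda>x. f x - g x) = L2_norm S (\<lambda>x. g x - f x)"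
  by (simp add: L2_norm_def norm_minus_commute)

lemma L2_bounded:
  fixes f :: "'a::euclidean_space \<Rightarrow> real"
  assumes S: "S \<in> lmeasurable" and f: "f \<in> borel_measurable (lebesgue_on S)"
    and B: "\<And>x. x \<in> S \<Longrightarrow> \<bar>f x\<bar> \<le> B"
  shows "L2_on S f"
proof -
  interpret finite_measure "lebesgue_on S" by (rule finite_measure_lebesgue_on[OF S])
  have "integrable (lebesgue_on S) (\<lambda>x. (f x)\<^sup>2)"
  proof (rule integrable_const_bound)
    show "AE x in lebesgue_on S. norm ((f x)\<^sup>2) \<le> B\<^sup>2"
      using B by (intro AE_I2) (auto simp: abs_le_square_iff[symmetric] intro: order_trans[OF B])
  qed (use f in auto)
  then show ?thesis using f by (simp add: L2_on_real)
qed

lemma L2_continuous: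
  fixes f :: "'a::euclidean_space \<Rightarrow> real"
  assumes S: "compact S" and f: "continuous_on S f"
  shows "L2_on S f"
proof -
  obtain B where "\<And>x. x \<in> S \<Longrightarrow> \<bar>f x\<bar> \<le> B"
    using compact_imp_bounded[OF compact_continuous_image[OF f S]] by (auto simp: bounded_iff)
  then show ?thesis
    using L2_bounded[OF lmeasurable_compact[OF S] continuous_imp_measurable_on_sets_lebesgue[OF f], of B] S
    by (auto simp: borel_compact)
qed

lemma L2_const: "S \<in> lmeasurable \<Longrightarrow> L2_on S (\<lambda>x. c::real)"
  by (rule L2_bounded[where B = "\<bar>c\<bar>"]) auto

lemma L2_integrable: "S \<in> lmeasurable \<Longrightarrow> L2_on S f \<Longrightarrow> integrable (lebesgue_on S) f"
  for f :: "'a::euclidean_space \<Rightarrow> real"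
  using L2_mult_integrable[OF _ L2_const[of S 1]] by simp

lemma L2_mult_bounded:
  fixes f g :: "'a::euclidean_space \<Rightarrow> real"
  assumes f: "L2_on S f" and g: "g \<in> borel_measurable (lebesgue_on S)"
    and B: "\<And>x. x \<in> S \<Longrightarrow> \<bar>g x\<bar> \<le> B"
  shows "L2_on S (\<lambda>x. f x * g x)"
  unfolding L2_on_real
proof
  show "integrable (lebesgue_on S) (\<lambda>x. (f x * g x)\<^sup>2)"
  proof (rule Bochner_Integration.integrable_bound)
    show "integrable (lebesgue_on S) (\<lambda>x. B\<^sup>2 * (f x)\<^sup>2)" using f by (auto simp: L2_on_real)
    have "(g x)\<^sup>2 \<le> B\<^sup>2" if "x \<in> S" for x using B[OF that] by (metis abs_ge_zero power2_abs power_mono)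
    then show "AE x in lebesgue_on S. norm ((f x * g x)\<^sup>2) \<le> norm (B\<^sup>2 * (f x)\<^sup>2)"
      by (intro AE_I2) (simp add: power_mult_distrib, subst mult.commute, rule mult_right_mono, simp_all)
  qed (use f g in \<open>auto simp: L2_on_real\<close>)
qed (use f g in \<open>auto simp: L2_on_real\<close>)

lemma L2_tendsto_dominated:
  fixes f :: "'a::euclidean_space \<Rightarrow> real"
  assumes f: "L2_on S f" and g: "\<And>k. g k \<in> borel_measurable (lebesgue_on S)"
    and W: "integrable (lebesgue_on S) W" and B: "\<And>k x. x \<in> S \<Longrightarrow> (f x - g k x)\<^sup>2 \<le> W x"
    and lim: "AE x in lebesgue_on S. (\<lambda>k. g k x) \<longlonglongrightarrow> f x"
  shows "(\<lambda>k. L2_norm S (\<lambda>x. f x - g k x)) \<longlonglongrightarrow> 0"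
proof -
  have "(\<lambda>k. \<integral>x. (f x - g k x)\<^sup>2 \<partial>lebesgue_on S) \<longlonglongrightarrow> (\<integral>x. 0 \<partial>lebesgue_on S)"
  proof (rule integral_dominated_convergence[OF _ _ W])
    show "AE x in lebesgue_on S. (\<lambda>k. (f x - g k x)\<^sup>2) \<longlonglongrightarrow> 0"
      using lim
    proof eventually_elim
      case (elim x)
      then show ?case using tendsto_power[OF tendsto_diff[OF tendsto_const elim], of "f x" 2] by simp
    qed
  qed (use f g B in \<open>auto simp: L2_on_real\<close>)
  then have "(\<lambda>k. sqrt (\<integral>x. (f x - g k x)\<^sup>2 \<partial>lebesgue_on S)) \<longlonglongrightarrow> sqrt 0"
    by (intro tendsto_real_sqrt) simp
  then show ?thesis by (simp add: L2_norm_def)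
qed

text \<open>Half of the error goes into truncating \<open>f\<close> at a level \<open>M\<close>,
  half into approximating the truncation. Measurability provides continuous functions that converge
  almost everywhere, and dominated convergence upgrades this to \<open>L2_norm\<close>.\<close>

lemma L2_dense_continuous:
  fixes f :: "'a::euclidean_space \<Rightarrow> real"
  assumes S: "S \<in> lmeasurable" and f: "L2_on S f" and e: "0 < e"
  obtains g where "continuous_on UNIV g" "L2_on S g" "L2_norm S (\<lambda>x. f x - g x) < e"
proof -
  have Sm: "S \<in> sets lebesgue" using S by auto
  define cut :: "real \<Rightarrow> real \<Rightarrow> real" where "cut M t = max (- M) (min M t)" for M t
  have cut_bound: "\<bar>cut M t\<bar> \<le> M" if "0 \<le> M" for M t using that by (auto simp: cut_def)
  have cut_meas [measurable]: "cut M \<in> borel_measurable borel" for M unfolding cut_def[abs_def] by measurable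
  have fm: "f \<in> borel_measurable (lebesgue_on S)" using f by (simp add: L2_on_real)
  have "(\<lambda>k. L2_norm S (\<lambda>x. f x - cut (real k) (f x))) \<longlonglongrightarrow> 0"
  proof (rule L2_tendsto_dominated[OF f])
    show "(\<lambda>x. cut (real k) (f x)) \<in> borel_measurable (lebesgue_on S)" for k
      using fm by (rule measurable_compose) (rule cut_meas)
    show "integrable (lebesgue_on S) (\<lambda>x. (f x)\<^sup>2)" using f by (simp add: L2_on_real)
    show "(f x - cut (real k) (f x))\<^sup>2 \<le> (f x)\<^sup>2" for k x
      by (subst abs_le_square_iff[symmetric]) (auto simp: cut_def max_def min_def)
    show "AE x in lebesgue_on S. (\<lambda>k. cut (real k) (f x)) \<longlonglongrightarrow> f x"
    proof (rule AE_I2)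
      fix x
      obtain N where N: "\<bar>f x\<bar> \<le> real N" using real_arch_simple by blast
      show "(\<lambda>k. cut (real k) (f x)) \<longlonglongrightarrow> f x"
        by (rule tendsto_eventually)
          (use N in \<open>auto simp: eventually_sequentially cut_def intro!: exI[of _ N]\<close>)
    qed
  qed
  from order_tendstoD(2)[OF this, of "e / 2"] e have "\<exists>k. L2_norm S (\<lambda>x. f x - cut (real k) (f x)) < e / 2"
    by (auto dest!: eventually_happens'[OF sequentially_bot])
  then obtain M where M: "L2_norm S (\<lambda>x. f x - cut (real M) (f x)) < e / 2" by blast
  let ?c = "cut (real M)"
  let ?h = "\<lambda>x. ?c (f x)"
  have hm: "?h \<in> borel_measurable (lebesgue_on S)" using fm by (rule measurable_compose) (rule cut_meas)
  have h: "L2_on S ?h" by (rule L2_bounded[OF S hm cut_bound]) simp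
  define F where "F x = (if x \<in> S then f x else 0)" for x
  have "F \<in> borel_measurable lebesgue"
    using fm Sm unfolding F_def by (simp add: borel_measurable_if)
  then have "F measurable_on UNIV"
    by (rule lebesgue_measurable_imp_measurable_on) simp
  then obtain N g where N: "negligible N" and g: "\<And>k. continuous_on UNIV (g k)"
    and lim: "\<And>x. x \<notin> N \<Longrightarrow> (\<lambda>k. g k x) \<longlonglongrightarrow> F x"
    unfolding measurable_on_def by auto
  have cut_cont: "continuous_on A ?c" for A unfolding cut_def[abs_def] by (intro continuous_intros)
  \<comment> \<open>Truncating the continuous approximants at the same level preserves continuity
    and supplies the constant majorant.\<close>
  have gc: "continuous_on UNIV (\<lambda>x. ?c (g k x))" for k
    by (rule continuous_on_compose2[OF cut_cont[of UNIV] g]) simp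
  have gm: "(\<lambda>x. ?c (g k x)) \<in> borel_measurable (lebesgue_on S)" for k
    using continuous_imp_measurable_on_sets_lebesgue[OF continuous_on_subset[OF gc] Sm] by simp
  have "(\<lambda>k. L2_norm S (\<lambda>x. ?h x - ?c (g k x))) \<longlonglongrightarrow> 0"
  proof (rule L2_tendsto_dominated[OF h gm])
    interpret finite_measure "lebesgue_on S" by (rule finite_measure_lebesgue_on[OF S])
    show "integrable (lebesgue_on S) (\<lambda>x. (2 * real M)\<^sup>2)" by simp
    show "(?h x - ?c (g k x))\<^sup>2 \<le> (2 * real M)\<^sup>2" for k x
      using cut_bound[of "real M" "f x"] cut_bound[of "real M" "g k x"]
      by (subst abs_le_square_iff[symmetric]) simp
    have "AE x in lebesgue. x \<notin> N"
      using N by (intro AE_not_in) (simp add: negligible_iff_null_sets)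
    then have "AE x in lebesgue. x \<in> S \<longrightarrow> (\<lambda>k. ?c (g k x)) \<longlonglongrightarrow> ?h x"
    proof eventually_elim
      case (elim x)
      show ?case
      proof
        assume "x \<in> S"
        then have "(\<lambda>k. g k x) \<longlonglongrightarrow> f x" using lim[OF elim] by (simp add: F_def)
        then show "(\<lambda>k. ?c (g k x)) \<longlonglongrightarrow> ?h x"
          by (intro continuous_on_tendsto_compose[OF cut_cont[of UNIV]]) simp_all
      qed
    qed
    then show "AE x in lebesgue_on S. (\<lambda>k. ?c (g k x)) \<longlonglongrightarrow> ?h x"
      by (subst AE_restrict_space_iff) (use Sm in simp_all)
  qed
  from order_tendstoD(2)[OF this, of "e / 2"] e have "\<exists>k. L2_norm S (\<lambda>x. ?h x - ?c (g k x)) < e / 2"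
    by (auto dest!: eventually_happens'[OF sequentially_bot])
  then obtain k where k: "L2_norm S (\<lambda>x. ?h x - ?c (g k x)) < e / 2" by blast
  have gL2: "L2_on S (\<lambda>x. ?c (g k x))" by (rule L2_bounded[OF S gm cut_bound]) simp
  have "L2_norm S (\<lambda>x. f x - ?c (g k x)) < e"
    using L2_triangle[OF L2_diff[OF f h] L2_diff[OF h gL2]] M k by simp
  then show ?thesis using that gc gL2 by blast
qed

section \<open>Mollification on a convex polygon\<close>

text \<open>The Jacobian of a dilation of the plane by \<open>c\<close> is \<open>c\<^sup>2\<close>,
  also for negative \<open>c\<close>; the negative case occurs when the averaging kernel is
  integrated over its centre.\<close>

lemma integral_affine_plane:
  fixes f :: "real^2 \<Rightarrow> real"
  assumes f: "integrable lborel f" and c: "c \<noteq> 0"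
  shows "integrable lborel (\<lambda>x. f (c *\<^sub>R x + d))"
    and "(\<integral>x. f (c *\<^sub>R x + d) \<partial>lborel) = integral\<^sup>L lborel f / c\<^sup>2"
proof -
  have fm [measurable]: "f \<in> borel_measurable borel" using f by simp
  let ?D = "distr lborel borel (\<lambda>x. d + c *\<^sub>R x)"
  have eq: "lborel = density ?D (\<lambda>_. ennreal (c\<^sup>2))"
    using lborel_affine[OF c, of d] by simp
  have "integrable (density ?D (\<lambda>_. ennreal (c\<^sup>2))) f" using f eq by simp
  then have "integrable ?D (\<lambda>x. c\<^sup>2 *\<^sub>R f x)" by (subst (asm) integrable_density) auto
  then have "integrable ?D f" using c by simp
  then show "integrable lborel (\<lambda>x. f (c *\<^sub>R x + d))"
    by (subst (asm) integrable_distr_eq) (auto simp: add.commute)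
  have "integral\<^sup>L lborel f = integral\<^sup>L (density ?D (\<lambda>_. ennreal (c\<^sup>2))) f" using eq by simp
  also have "\<dots> = (\<integral>x. c\<^sup>2 *\<^sub>R f x \<partial>?D)" by (subst integral_density) auto
  also have "\<dots> = c\<^sup>2 * (\<integral>x. f (c *\<^sub>R x + d) \<partial>lborel)"
    by (subst integral_distr) (auto simp: add.commute)
  finally show "(\<integral>x. f (c *\<^sub>R x + d) \<partial>lborel) = integral\<^sup>L lborel f / c\<^sup>2" using c by simp
qed

locale mollified_polygon = polygon +
  fixes \<eta> :: "real^2 \<Rightarrow> real" and K :: "(real^2) set"
  assumes smooth: "\<And>k. C_k k \<eta>" and \<eta>_nonneg: "\<And>x. 0 \<le> \<eta> x"
    and \<eta>_support: "\<And>x. \<eta> x \<noteq> 0 \<Longrightarrow> x \<in> K"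
    and K: "compact K" "K \<subseteq> interior T" and \<eta>_integral: "integral\<^sup>L lborel \<eta> = 1"

lemma (in polygon) mollifier_exists: "\<exists>\<eta> K. mollified_polygon T n v \<eta> K"
proof -
  obtain z where "z \<in> interior T" using interior_nonempty by auto
  then obtain a b where ab: "z \<in> box a b" "cbox a b \<subseteq> interior T"
    using open_contains_cbox[OF open_interior] by metis
  then obtain \<eta> where "\<And>k. C_k k \<eta>" "\<And>x. 0 \<le> \<eta> x" "\<And>x. \<eta> x \<noteq> 0 \<Longrightarrow> x \<in> cbox a b" "integral\<^sup>L lborel \<eta> = 1"
    using bump_exists[of a b] by blast
  then have "mollified_polygon T n v \<eta> (cbox a b)" using ab by unfold_locales auto
  then show ?thesis by blast
qed

section \<open>Averages over the polygon: kernel, bounds and convergence\<close>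

context mollified_polygon
begin

lemma T_sets: "T \<in> sets lebesgue" using lmeasurable by auto

sublocale M: finite_measure "lebesgue_on T"
  by (rule finite_measure_lebesgue_on[OF lmeasurable])

sublocale MM: pair_sigma_finite "lebesgue_on T" "lebesgue_on T" ..

lemma \<eta>_continuous: "continuous_on A \<eta>"
  using C_k_continuous[OF smooth[of 0]] continuous_on_subset by blast

lemma \<eta>_integrable: "integrable lborel \<eta>"
  using \<eta>_integral not_integrable_integral_eq[of lborel \<eta>] by fastforce

text \<open>The density at \<open>z\<close> of the point (1 - s) x + s y when y has density
  \<open>\<eta>\<close>.\<close>

definition kern :: "real \<Rightarrow> real^2 \<Rightarrow> real^2 \<Rightarrow> real" where
  "kern s x z = \<eta> ((1 / s) *\<^sub>R z + (- ((1 - s) / s)) *\<^sub>R x) / s\<^sup>2"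

definition avg :: "real \<Rightarrow> (real^2 \<Rightarrow> real) \<Rightarrow> real^2 \<Rightarrow> real" where
  "avg s f x = (\<integral>z. f z * kern s x z \<partial>lebesgue_on T)"

lemma kern_nonneg: "0 \<le> kern s x z"
  by (simp add: kern_def \<eta>_nonneg)

text \<open>Solving for y shows that it lies in \<open>K\<close>, so it is interior to
  \<open>T\<close>; by convexity a point strictly closer to y than x, or y itself, is interior as
  well, even when x is on the boundary.\<close>

lemma kern_support:
  assumes "x \<in> T" "0 < s" "s \<le> 1" "kern s x z \<noteq> 0"
  obtains y where "y \<in> K" "z = (1 - s) *\<^sub>R x + s *\<^sub>R y" "z \<in> interior T"
proof -
  define y where "y = (1 / s) *\<^sub>R z + (- ((1 - s) / s)) *\<^sub>R x"
  have "y \<in> K" using assms \<eta>_support by (auto simp: kern_def y_def)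
  have "s *\<^sub>R y = z - (1 - s) *\<^sub>R x" using assms by (simp add: y_def scaleR_right_diff_distrib)
  then have z: "z = (1 - s) *\<^sub>R x + s *\<^sub>R y" by simp
  have "x - s *\<^sub>R (x - y) \<in> interior T"
    using mem_interior_convex_shrink[OF convex, of y x s] assms K \<open>y \<in> K\<close> by auto
  also have "x - s *\<^sub>R (x - y) = z" using z by (simp add: algebra_simps)
  finally show ?thesis using that \<open>y \<in> K\<close> z by blast
qed

text \<open>The support lies in the affine image of \<open>K\<close> under y to (1 - s) x + s y, a
  compact subset of the interior. This holds for every x in \<open>T\<close>, so weak derivatives
  can be tested against the kernel up to the boundary.\<close>

lemma kern_test_function:
  assumes x: "x \<in> T" and s: "0 < s" "s \<le> 1"
  shows "kern s x \<in> test_functions (interior T)"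
proof -
  have "C_k k (\<lambda>z. (1 / s\<^sup>2) * \<eta> ((1 / s) *\<^sub>R z + (- ((1 - s) / s)) *\<^sub>R x))" for k
    by (intro C_k_mult C_k_const C_k_affine smooth)
  then have C: "C_k k (kern s x)" for k by (simp add: kern_def[abs_def])
  let ?K = "(\<lambda>y. (1 - s) *\<^sub>R x + s *\<^sub>R y) ` K"
  have cK: "compact ?K" using K by (intro compact_continuous_image continuous_intros)
  have sub: "closure {z. kern s x z \<noteq> 0} \<subseteq> ?K"
    by (rule closure_minimal) (use kern_support[OF x s] cK in \<open>auto simp: compact_imp_closed\<close>)
  have "?K \<subseteq> interior T"
  proof clarify
    fix y assume "y \<in> K"
    then have "x - s *\<^sub>R (x - y) \<in> interior T"
      using mem_interior_convex_shrink[OF convex, of y x s] s x K by auto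
    then show "(1 - s) *\<^sub>R x + s *\<^sub>R y \<in> interior T" by (simp add: algebra_simps)
  qed
  moreover have "compact (closure {z. kern s x z \<noteq> 0})"
    using sub cK by (meson bounded_closure bounded_subset closed_closure compact_eq_bounded_closed)
  ultimately show ?thesis using C sub by (auto simp: test_functions_def)
qed

lemma kern_continuous: "continuous_on A (kern s x)"
  unfolding kern_def[abs_def] divide_inverse[of _ "s\<^sup>2"]
  by (intro continuous_intros continuous_on_compose2[OF \<eta>_continuous[of UNIV]]) auto

lemma kern_L2: "L2_on T (kern s x)"
  by (rule L2_continuous[OF compact kern_continuous])

lemma kern_integrable: "integrable (lebesgue_on T) (kern s x)"
  by (rule L2_integrable[OF lmeasurable kern_L2])

lemma avg_integrable: "L2_on T f \<Longrightarrow> integrable (lebesgue_on T) (\<lambda>z. f z * kern s x z)"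
  by (rule L2_mult_integrable[OF _ kern_L2])

lemma kern_plane:
  assumes "0 < s" shows "integrable lborel (kern s x)" "integral\<^sup>L lborel (kern s x) = 1"
  unfolding kern_def[abs_def]
  using integral_affine_plane[OF \<eta>_integrable, of "1 / s" "(- ((1 - s) / s)) *\<^sub>R x"] assms \<eta>_integral
  by (simp_all add: power2_eq_square)

lemma kern_integral:
  assumes "x \<in> T" "0 < s" "s \<le> 1" shows "integral\<^sup>L (lebesgue_on T) (kern s x) = 1"
proof -
  have "kern s x z \<noteq> 0 \<Longrightarrow> z \<in> T" for z
    using kern_support[OF assms, of z] interior_subset by blast
  then have "kern s x = (\<lambda>z. indicator T z *\<^sub>R kern s x z)"
    by (intro ext) (auto simp: indicator_def)
  then have "integral\<^sup>L (lebesgue_on T) (kern s x) = integral\<^sup>L lebesgue (kern s x)"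
    using integral_restrict_space[of T lebesgue "kern s x"] T_sets by simp
  also have "\<dots> = integral\<^sup>L lborel (kern s x)"
    using kern_plane(1)[OF assms(2), of x] by (intro integral_completion) simp
  finally show ?thesis using kern_plane assms by simp
qed

text \<open>As a function of its centre the kernel is \<open>\<eta>\<close> dilated by -(1 - s)/s,
  so its integral over the plane is 1/(1 - s)^2, and \<open>s\<close> is at most 1/2. This is the
  second of the two kernel bounds that make averaging bounded on L2.\<close>

lemma kern_dual_integral:
  assumes s: "0 < s" "s \<le> 1/2"
  shows "(\<integral>\<^sup>+x. ennreal (kern s x z) \<partial>lebesgue_on T) \<le> 4"
proof -
  let ?c = "- ((1 - s) / s)"
  have c: "?c \<noteq> 0" using s by simp
  have eq: "(\<lambda>x. kern s x z) = (\<lambda>x. \<eta> (?c *\<^sub>R x + (1 / s) *\<^sub>R z) / s\<^sup>2)"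
    by (simp add: kern_def add.commute)
  have int: "integrable lborel (\<lambda>x. kern s x z)"
    unfolding eq by (intro integrable_divide integral_affine_plane(1) \<eta>_integrable c)
  have "(\<integral>\<^sup>+x. ennreal (kern s x z) \<partial>lebesgue_on T) = (\<integral>\<^sup>+x. ennreal (kern s x z) * indicator T x \<partial>lebesgue)"
    using T_sets by (simp add: nn_integral_restrict_space)
  also have "\<dots> \<le> (\<integral>\<^sup>+x. ennreal (kern s x z) \<partial>lebesgue)"
    by (intro nn_integral_mono) (auto simp: indicator_def)
  also have "\<dots> = (\<integral>\<^sup>+x. ennreal (kern s x z) \<partial>lborel)"
    using int by (simp add: nn_integral_completion)
  also have "\<dots> = ennreal (\<integral>x. kern s x z \<partial>lborel)"
    by (rule nn_integral_eq_integral[OF int]) (simp add: kern_nonneg)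
  also have "(\<integral>x. kern s x z \<partial>lborel) = 1 / (1 - s)\<^sup>2"
    unfolding eq using integral_affine_plane(2)[OF \<eta>_integrable c, of "(1 / s) *\<^sub>R z"] s \<eta>_integral
    by (simp add: power_divide)
  also have "ennreal (1 / (1 - s)\<^sup>2) \<le> ennreal 4"
  proof (rule ennreal_leI)
    have "(1/2)\<^sup>2 \<le> (1 - s)\<^sup>2" using s by (intro power_mono) auto
    then have "1 \<le> 4 * (1 - s)\<^sup>2" by (simp add: power2_eq_square)
    then show "1 / (1 - s)\<^sup>2 \<le> 4" using s by (simp add: divide_le_eq)
  qed
  finally show ?thesis by simp
qed

lemma borel_measurable_kern:
  "(\<lambda>p. kern s (fst p) (snd p)) \<in> borel_measurable (lebesgue_on T \<Otimes>\<^sub>M lebesgue_on T)"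
proof -
  have id: "(\<lambda>x. x) \<in> measurable (lebesgue_on T) borel"
    using id_borel_measurable_lebesgue_on[of T] by (simp add: id_def)
  have [measurable]: "fst \<in> measurable (lebesgue_on T \<Otimes>\<^sub>M lebesgue_on T) borel"
    "snd \<in> measurable (lebesgue_on T \<Otimes>\<^sub>M lebesgue_on T) borel"
    using measurable_compose[OF measurable_fst id] measurable_compose[OF measurable_snd id] by auto
  have [measurable]: "\<eta> \<in> borel_measurable borel"
    using \<eta>_continuous by (rule borel_measurable_continuous_onI)
  show ?thesis unfolding kern_def by measurable
qed

lemma avg_measurable:
  assumes "f \<in> borel_measurable (lebesgue_on T)"
  shows "avg s f \<in> borel_measurable (lebesgue_on T)"
  unfolding avg_def[abs_def]
proof (rule M.borel_measurable_lebesgue_integral)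
  have "(\<lambda>p. f (snd p) * kern s (fst p) (snd p)) \<in> borel_measurable (lebesgue_on T \<Otimes>\<^sub>M lebesgue_on T)"
    by (intro borel_measurable_times borel_measurable_kern measurable_compose[OF measurable_snd assms])
  then show "(\<lambda>(x, z). f z * kern s x z) \<in> borel_measurable (lebesgue_on T \<Otimes>\<^sub>M lebesgue_on T)"
    by (simp add: case_prod_beta')
qed

lemma L2_mult_kern: "L2_on T f \<Longrightarrow> L2_on T (\<lambda>z. f z * kern s x z)"
proof -
  assume f: "L2_on T f"
  obtain B where "\<And>z. z \<in> T \<Longrightarrow> \<bar>kern s x z\<bar> \<le> B"
    using compact_imp_bounded[OF compact_continuous_image[OF kern_continuous[of T s x] compact]]
    by (auto simp: bounded_iff)
  then show ?thesis
    using L2_mult_bounded[OF f, of "kern s x" B] kern_L2[of s x] by (simp add: L2_on_real)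
qed

lemma avg_power2_integrable:
  assumes f: "L2_on T f" shows "integrable (lebesgue_on T) (\<lambda>z. (f z)\<^sup>2 * kern s x z)"
  using L2_mult_integrable[OF f L2_mult_kern[OF f, of s x]] by (simp add: power2_eq_square mult.assoc)

text \<open>Jensen's inequality for the probability density \<open>kern s x\<close>: the variance of
  \<open>f\<close> is nonnegative.\<close>

lemma avg_power2_le:
  assumes f: "L2_on T f" and x: "x \<in> T" and s: "0 < s" "s \<le> 1"
  shows "(avg s f x)\<^sup>2 \<le> (\<integral>z. (f z)\<^sup>2 * kern s x z \<partial>lebesgue_on T)"
proof -
  let ?A = "avg s f x"
  have "0 \<le> (\<integral>z. (f z - ?A)\<^sup>2 * kern s x z \<partial>lebesgue_on T)"
    by (intro Bochner_Integration.integral_nonneg mult_nonneg_nonneg kern_nonneg) simp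
  also have "\<dots> = (\<integral>z. (f z)\<^sup>2 * kern s x z - 2 * ?A * (f z * kern s x z) + ?A\<^sup>2 * kern s x z \<partial>lebesgue_on T)"
    by (intro Bochner_Integration.integral_cong refl) (simp add: power2_eq_square algebra_simps)
  also have "\<dots> = (\<integral>z. (f z)\<^sup>2 * kern s x z \<partial>lebesgue_on T) - 2 * ?A * ?A + ?A\<^sup>2 * 1"
    using avg_power2_integrable[OF f, of s x] avg_integrable[OF f, of s x] kern_integrable[of s x]
      kern_integral[OF x s] by (simp add: avg_def)
  finally show ?thesis by (simp add: power2_eq_square)
qed

text \<open>After Jensen's inequality at each x, exchanging the integrals leaves the kernel
  integrated over its centre, which is at most 4; the factor 2 is the square root. The bound is
  uniform in \<open>s\<close>.\<close>

lemma avg_L2: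
  assumes f: "L2_on T f" and s: "0 < s" "s \<le> 1/2"
  shows "L2_on T (avg s f)" "L2_norm T (avg s f) \<le> 2 * L2_norm T f"
proof -
  have fm: "f \<in> borel_measurable (lebesgue_on T)" and f2: "integrable (lebesgue_on T) (\<lambda>x. (f x)\<^sup>2)"
    using f by (auto simp: L2_on_real)
  have am: "avg s f \<in> borel_measurable (lebesgue_on T)" using fm by (rule avg_measurable)
  let ?k = "\<lambda>x z. ennreal ((f z)\<^sup>2 * kern s x z)"
  have meas: "(\<lambda>(x, z). ?k x z) \<in> borel_measurable (lebesgue_on T \<Otimes>\<^sub>M lebesgue_on T)"
  proof -
    have "(\<lambda>p. (f (snd p))\<^sup>2 * kern s (fst p) (snd p)) \<in> borel_measurable (lebesgue_on T \<Otimes>\<^sub>M lebesgue_on T)"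
      by (intro borel_measurable_times borel_measurable_power borel_measurable_kern measurable_compose[OF measurable_snd fm])
    then show ?thesis by (simp add: case_prod_beta')
  qed
  have kz: "(\<lambda>x. ennreal (kern s x z)) \<in> borel_measurable (lebesgue_on T)" for z
  proof -
    have "continuous_on T (\<lambda>x. kern s x z)"
      unfolding kern_def divide_inverse[of _ "s\<^sup>2"]
      by (intro continuous_intros continuous_on_compose2[OF \<eta>_continuous[of UNIV]]) auto
    then have "(\<lambda>x. kern s x z) \<in> borel_measurable (lebesgue_on T)"
      by (rule continuous_imp_measurable_on_sets_lebesgue[OF _ T_sets])
    then show ?thesis by measurable
  qed
  have "(\<integral>\<^sup>+x. ennreal ((avg s f x)\<^sup>2) \<partial>lebesgue_on T) \<le> (\<integral>\<^sup>+x. (\<integral>\<^sup>+z. ?k x z \<partial>lebesgue_on T) \<partial>lebesgue_on T)"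
  proof (rule nn_integral_mono)
    fix x assume "x \<in> space (lebesgue_on T)"
    then have "x \<in> T" by simp
    have "(\<integral>\<^sup>+z. ?k x z \<partial>lebesgue_on T) = ennreal (\<integral>z. (f z)\<^sup>2 * kern s x z \<partial>lebesgue_on T)"
      by (rule nn_integral_eq_integral[OF avg_power2_integrable[OF f]]) (simp add: kern_nonneg)
    then show "ennreal ((avg s f x)\<^sup>2) \<le> (\<integral>\<^sup>+z. ?k x z \<partial>lebesgue_on T)"
      using avg_power2_le[OF f \<open>x \<in> T\<close>, of s] s by (simp add: ennreal_leI)
  qed
  also have "\<dots> = (\<integral>\<^sup>+z. (\<integral>\<^sup>+x. ?k x z \<partial>lebesgue_on T) \<partial>lebesgue_on T)"
    using MM.Fubini'[OF meas] by simp
  also have "\<dots> \<le> (\<integral>\<^sup>+z. ennreal ((f z)\<^sup>2) * 4 \<partial>lebesgue_on T)"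
  proof (rule nn_integral_mono)
    fix z
    have "(\<integral>\<^sup>+x. ?k x z \<partial>lebesgue_on T) = (\<integral>\<^sup>+x. ennreal ((f z)\<^sup>2) * ennreal (kern s x z) \<partial>lebesgue_on T)"
      by (simp add: ennreal_mult kern_nonneg)
    also have "\<dots> = ennreal ((f z)\<^sup>2) * (\<integral>\<^sup>+x. ennreal (kern s x z) \<partial>lebesgue_on T)"
      by (rule nn_integral_cmult[OF kz])
    also have "\<dots> \<le> ennreal ((f z)\<^sup>2) * 4"
      by (intro mult_left_mono kern_dual_integral s) simp
    finally show "(\<integral>\<^sup>+x. ?k x z \<partial>lebesgue_on T) \<le> ennreal ((f z)\<^sup>2) * 4" .
  qed
  also have "\<dots> = (\<integral>\<^sup>+z. ennreal (4 * (f z)\<^sup>2) \<partial>lebesgue_on T)"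
    by (simp add: ennreal_mult mult.commute)
  also have "\<dots> = ennreal (\<integral>z. 4 * (f z)\<^sup>2 \<partial>lebesgue_on T)"
    using f2 by (intro nn_integral_eq_integral) auto
  finally have bound: "(\<integral>\<^sup>+x. ennreal ((avg s f x)\<^sup>2) \<partial>lebesgue_on T) \<le> ennreal (4 * (L2_norm T f)\<^sup>2)"
    by (simp add: L2_norm_power2)
  have a2: "integrable (lebesgue_on T) (\<lambda>x. (avg s f x)\<^sup>2)"
    using am bound by (intro integrableI_bounded) (auto simp: top_unique intro: order_le_less_trans)
  then show "L2_on T (avg s f)" using am by (simp add: L2_on_real)
  have "ennreal ((L2_norm T (avg s f))\<^sup>2) \<le> ennreal (4 * (L2_norm T f)\<^sup>2)"
    using nn_integral_eq_integral[OF a2] bound by (simp add: L2_norm_power2)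
  then have "(L2_norm T (avg s f))\<^sup>2 \<le> (2 * L2_norm T f)\<^sup>2"
    by (simp add: ennreal_le_iff power_mult_distrib)
  then show "L2_norm T (avg s f) \<le> 2 * L2_norm T f"
    by (rule power2_le_imp_le) (simp add: L2_norm_nonneg)
qed

lemma avg_diff:
  assumes "L2_on T f" "L2_on T g" shows "avg s (\<lambda>x. f x - g x) x = avg s f x - avg s g x"
  using avg_integrable[OF assms(1), of s x] avg_integrable[OF assms(2), of s x]
  by (simp add: avg_def left_diff_distrib)

text \<open>All sample points are within \<open>s * diameter T\<close> of x, so uniform continuity
  of \<open>g\<close> on the compact set \<open>T\<close> gives a \<open>d\<close> that does not
  depend on x.\<close>

lemma avg_continuous_close:
  assumes g: "continuous_on T g" and e: "0 < e"
  shows "\<exists>d>0. \<forall>s x. 0 < s \<and> s < d \<and> s \<le> 1 \<and> x \<in> T \<longrightarrow> \<bar>avg s g x - g x\<bar> \<le> e"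
proof -
  obtain d where d: "0 < d" "\<And>x y. x \<in> T \<Longrightarrow> y \<in> T \<Longrightarrow> dist x y < d \<Longrightarrow> dist (g x) (g y) < e"
    using compact_uniformly_continuous[OF g compact] e unfolding uniformly_continuous_on_def by metis
  have gL2: "L2_on T g" by (rule L2_continuous[OF compact g])
  have "\<bar>avg s g x - g x\<bar> \<le> e" if s: "0 < s" "s < d / diameter T" "s \<le> 1" and x: "x \<in> T" for s x
  proof -
    have "avg s g x - g x = (\<integral>z. g z * kern s x z - g x * kern s x z \<partial>lebesgue_on T)"
      using avg_integrable[OF gL2, of s x] kern_integrable[of s x] kern_integral[OF x s(1,3)]
      by (simp add: avg_def)
    also have "\<bar>\<dots>\<bar> \<le> (\<integral>z. e * kern s x z \<partial>lebesgue_on T)"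
    proof (rule order_trans[OF integral_abs_bound Bochner_Integration.integral_mono])
      show "integrable (lebesgue_on T) (\<lambda>z. \<bar>g z * kern s x z - g x * kern s x z\<bar>)"
        using avg_integrable[OF gL2, of s x] kern_integrable[of s x] by simp
      show "integrable (lebesgue_on T) (\<lambda>z. e * kern s x z)" using kern_integrable[of s x] by simp
      fix z assume "z \<in> space (lebesgue_on T)"
      then have z: "z \<in> T" by simp
      show "\<bar>g z * kern s x z - g x * kern s x z\<bar> \<le> e * kern s x z"
      proof (cases "kern s x z = 0")
        case False
        then obtain y where y: "y \<in> K" "z = (1 - s) *\<^sub>R x + s *\<^sub>R y"
          using kern_support[OF x s(1,3)] by blast
        have "z - x = s *\<^sub>R (y - x)" using y by (simp add: algebra_simps)
        moreover have "norm (y - x) \<le> diameter T"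
          using norm_diff_le_diameter y(1) x K(2) interior_subset by blast
        ultimately have "dist z x \<le> s * diameter T"
          using s(1) by (simp add: dist_norm mult_left_mono)
        also have "\<dots> < d" using s diameter_pos by (simp add: pos_less_divide_eq)
        finally have "\<bar>g z - g x\<bar> \<le> e" using d(2)[OF z x] by (simp add: dist_real_def)
        then have "\<bar>g z - g x\<bar> * kern s x z \<le> e * kern s x z"
          by (rule mult_right_mono) (rule kern_nonneg)
        then show ?thesis
          by (simp add: left_diff_distrib[symmetric] abs_mult kern_nonneg)
      qed simp
    qed
    also have "\<dots> = e" using kern_integral[OF x s(1,3)] by simp
    finally show ?thesis .
  qed
  then show ?thesis using d(1) diameter_pos by (intro exI[of _ "d / diameter T"]) auto
qed

text \<open>The offset 2 keeps every scale at most 1/2, as \<open>avg_L2\<close> requires.\<close>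

definition scale :: "nat \<Rightarrow> real" where "scale m = 1 / real (m + 2)"

lemma scale: "0 < scale m" "scale m \<le> 1/2" "scale m < 1" "scale m \<le> 1"
  by (auto simp: scale_def divide_simps)

lemma scale_tendsto: "scale \<longlonglongrightarrow> 0"
  using LIMSEQ_ignore_initial_segment[OF lim_1_over_n, of 2] by (simp add: scale_def[abs_def])

text \<open>Convergence holds uniformly for continuous \<open>g\<close> and extends to
  \<open>f\<close> because averaging is bounded by 2: with \<open>f - g\<close> below e/6, the terms
  \<open>avg (f - g)\<close> and \<open>g - f\<close> together cost at most 2 e/6 + e/6, and
  \<open>avg g - g\<close> costs less than e/2.\<close>

lemma avg_tendsto:
  assumes f: "L2_on T f"
  shows "(\<lambda>m. L2_norm T (\<lambda>x. avg (scale m) f x - f x)) \<longlonglongrightarrow> 0"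
proof (rule LIMSEQ_I)
  fix e :: real assume e: "0 < e"
  obtain g where g: "continuous_on UNIV g" and gL2: "L2_on T g"
    and fg: "L2_norm T (\<lambda>x. f x - g x) < e / 6"
    using L2_dense_continuous[OF lmeasurable f, of "e / 6"] e by auto
  define V where "V = L2_norm T (\<lambda>x. 1 :: real)"
  have V: "0 \<le> V" by (simp add: V_def L2_norm_nonneg)
  define r where "r = e / (2 * (V + 1))"
  have r: "0 < r" "r * V < e / 2" using e V by (auto simp: r_def divide_simps)
  obtain d where d: "0 < d" "\<And>s x. 0 < s \<Longrightarrow> s < d \<Longrightarrow> s \<le> 1 \<Longrightarrow> x \<in> T \<Longrightarrow> \<bar>avg s g x - g x\<bar> \<le> r"
    using avg_continuous_close[OF continuous_on_subset[OF g] r(1)] by blast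
  obtain N where N: "\<And>m. m \<ge> N \<Longrightarrow> scale m < d"
    using order_tendstoD(2)[OF scale_tendsto d(1)] by (auto simp: eventually_sequentially)
  have "norm (L2_norm T (\<lambda>x. avg (scale m) f x - f x) - 0) < e" if m: "m \<ge> N" for m
  proof -
    let ?A = "avg (scale m)"
    have fgL2: "L2_on T (\<lambda>x. f x - g x)" by (rule L2_diff[OF f gL2])
    have AgL2: "L2_on T (?A g)" by (rule avg_L2(1)[OF gL2 scale(1,2)])
    have AdL2: "L2_on T (?A (\<lambda>x. f x - g x))" by (rule avg_L2(1)[OF fgL2 scale(1,2)])
    have "L2_norm T (\<lambda>x. ?A g x - g x) \<le> r * V"
    proof -
      have "(\<integral>x. (?A g x - g x)\<^sup>2 \<partial>lebesgue_on T) \<le> (\<integral>x. r\<^sup>2 * 1\<^sup>2 \<partial>lebesgue_on T)"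
      proof (rule Bochner_Integration.integral_mono)
        show "integrable (lebesgue_on T) (\<lambda>x. (?A g x - g x)\<^sup>2)"
          using L2_diff[OF AgL2 gL2] by (simp add: L2_on_real)
        show "(?A g x - g x)\<^sup>2 \<le> r\<^sup>2 * 1\<^sup>2" if "x \<in> space (lebesgue_on T)" for x
          using d(2)[OF scale(1) N[OF m] scale(4), of x] that r(1)
          by (simp add: abs_le_square_iff[symmetric])
      qed simp
      also have "\<dots> = (r * V)\<^sup>2" by (simp add: V_def L2_norm_power2 power_mult_distrib)
      finally have "(L2_norm T (\<lambda>x. ?A g x - g x))\<^sup>2 \<le> (r * V)\<^sup>2" by (simp add: L2_norm_power2)
      then show ?thesis by (rule power2_le_imp_le) (use r V in simp)
    qed
    moreover have "L2_norm T (?A (\<lambda>x. f x - g x)) \<le> 2 * L2_norm T (\<lambda>x. f x - g x)"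
      by (rule avg_L2(2)[OF fgL2 scale(1,2)])
    moreover have "L2_norm T (\<lambda>x. ?A f x - f x)
        \<le> L2_norm T (?A (\<lambda>x. f x - g x)) + (L2_norm T (\<lambda>x. ?A g x - g x) + L2_norm T (\<lambda>x. g x - f x))"
    proof -
      have "(\<lambda>x. ?A f x - f x) = (\<lambda>x. ?A (\<lambda>x. f x - g x) x + ((?A g x - g x) + (g x - f x)))"
        by (simp add: avg_diff[OF f gL2])
      then show ?thesis
        using L2_triangle[OF AdL2 L2_add[OF L2_diff[OF AgL2 gL2] L2_diff[OF gL2 f]]]
          L2_triangle[OF L2_diff[OF AgL2 gL2] L2_diff[OF gL2 f]] by simp
    qed
    ultimately show ?thesis
      using fg r(2) L2_norm_minus_commute[of T f g] L2_norm_nonneg[of T "\<lambda>x. ?A f x - f x"] by simp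
  qed
  then show "\<exists>N. \<forall>m\<ge>N. norm (L2_norm T (\<lambda>x. avg (scale m) f x - f x) - 0) < e" by blast
qed

end

text \<open>All averages of a function annihilating the test functions vanish, since the averaging kernels are
  test functions; but the averages converge to the function.\<close>

lemma (in polygon) test_functions_separate:
  assumes f: "L2_on T f"
    and 0: "\<And>\<psi>. \<psi> \<in> test_functions (interior T) \<Longrightarrow> (\<integral>x. f x * \<psi> x \<partial>lebesgue_on T) = 0"
  shows "AE x in lebesgue_on T. f x = 0"
proof -
  obtain \<eta> K where "mollified_polygon T n v \<eta> K" using mollifier_exists by blast
  then interpret mollified_polygon T n v \<eta> K .
  have "L2_norm T (\<lambda>x. avg (scale m) f x - f x) = L2_norm T f" for m
  proof -
    have "avg (scale m) f x = 0" if "x \<in> T" for x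
      unfolding avg_def using 0[OF kern_test_function[OF that scale(1,4)]] .
    then show ?thesis unfolding L2_norm_def
      by (intro arg_cong[of _ _ sqrt] Bochner_Integration.integral_cong) auto
  qed
  then have "L2_norm T f = 0" using avg_tendsto[OF f] LIMSEQ_unique[OF tendsto_const] by simp
  then have "(\<integral>x. (f x)\<^sup>2 \<partial>lebesgue_on T) = 0" using L2_norm_power2[of T f] by simp
  then have "AE x in lebesgue_on T. (f x)\<^sup>2 = 0"
    using f integral_nonneg_eq_0_iff_AE[of "lebesgue_on T" "\<lambda>x. (f x)\<^sup>2"] by (simp add: L2_on_real)
  then show ?thesis by simp
qed

section \<open>Weak derivatives on a convex polygon\<close>

lemma norm_power2_vec2: "(norm (x :: real^2))\<^sup>2 = (\<Sum>i\<in>UNIV. (x $ i)\<^sup>2)"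
  by (simp add: norm_vec_def L2_set_def sum_nonneg)

lemma L2_vec_component:
  fixes G :: "real^2 \<Rightarrow> real^2"
  assumes "L2_on S G" shows "L2_on S (\<lambda>x. G x $ i)"
  unfolding L2_on_real
proof
  have G: "G \<in> borel_measurable (lebesgue_on S)" "integrable (lebesgue_on S) (\<lambda>x. (norm (G x))\<^sup>2)"
    using assms by (auto simp: L2_on_def)
  show m: "(\<lambda>x. G x $ i) \<in> borel_measurable (lebesgue_on S)"
    using borel_measurable_inner[OF G(1) borel_measurable_const[of "axis i 1"]] by (simp add: inner_axis)
  show "integrable (lebesgue_on S) (\<lambda>x. (G x $ i)\<^sup>2)"
  proof (rule Bochner_Integration.integrable_bound[OF G(2)])
    show "AE x in lebesgue_on S. norm ((G x $ i)\<^sup>2) \<le> norm ((norm (G x))\<^sup>2)"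
      using component_le_norm_cart[of _ i] by (intro AE_I2) (auto simp: abs_le_square_iff[symmetric])
  qed (use m in simp)
qed

lemma L2_vecI:
  fixes G :: "real^2 \<Rightarrow> real^2"
  assumes "\<And>i. L2_on S (\<lambda>x. G x $ i)" shows "L2_on S G"
proof -
  have "(\<lambda>x. G x \<bullet> b) \<in> borel_measurable (lebesgue_on S)" if "b \<in> Basis" for b
    using assms that by (auto simp: Basis_vec_def inner_axis L2_on_real)
  then have "G \<in> borel_measurable (lebesgue_on S)"
    by (subst borel_measurable_euclidean_space) blast
  then show ?thesis
    using assms by (simp add: L2_on_def norm_power2_vec2)
qed

lemma L2_vec_norm:
  fixes G :: "real^2 \<Rightarrow> real^2"
  assumes "L2_on S G" shows "(L2_norm S G)\<^sup>2 = (\<Sum>i\<in>UNIV. (L2_norm S (\<lambda>x. G x $ i))\<^sup>2)"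
  using L2_vec_component[OF assms] by (simp add: L2_norm_power2 norm_power2_vec2 L2_on_real)

lemma test_function_continuous:
  assumes "\<psi> \<in> test_functions U"
  shows "continuous_on A \<psi>" "continuous_on A (partial_deriv i \<psi>)"
    "\<psi> differentiable at x" "C_k k \<psi>"
proof -
  have C: "C_k k \<psi>" for k using assms by (simp add: test_functions_def)
  then show "C_k k \<psi>" .
  show "continuous_on A \<psi>" using C_k_continuous[OF C[of 0]] continuous_on_subset by blast
  show "continuous_on A (partial_deriv i \<psi>)"
    using C_k_continuous[OF C_k_SucD(2)[OF C[of "Suc 0"]]] continuous_on_subset by blast
  show "\<psi> differentiable at x" using C_k_SucD(1)[OF C[of "Suc 0"]] .
qed

text \<open>Off its support a test function vanishes in a neighbourhood, so differentiation does not
  enlarge the support.\<close>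

lemma partial_deriv_test_function:
  assumes \<psi>: "\<psi> \<in> test_functions U"
  shows "partial_deriv i \<psi> \<in> test_functions U"
proof -
  let ?S = "closure {x. \<psi> x \<noteq> 0}"
  have "C_k k (partial_deriv i \<psi>)" for k
    using test_function_continuous(4)[OF \<psi>, of "Suc k"] C_k_SucD(2) by blast
  moreover have "partial_deriv i \<psi> x = 0" if "x \<notin> ?S" for x
  proof -
    have ev: "\<forall>\<^sub>F y in nhds x. \<psi> y = 0"
    proof (rule eventually_mono)
      show "\<forall>\<^sub>F y in nhds x. y \<in> - ?S" using that by (intro eventually_nhds_in_open) auto
      show "\<psi> y = 0" if "y \<in> - ?S" for y
        using that closure_subset[of "{x. \<psi> x \<noteq> 0}"] by auto
    qed
    have "(\<psi> has_derivative (\<lambda>h. 0)) (at x)"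
    proof (rule has_derivative_transform_eventually[OF has_derivative_const[of 0]])
      show "\<forall>\<^sub>F y in at x. 0 = \<psi> y" using ev by (auto simp: eventually_at_filter elim!: eventually_mono)
      show "0 = \<psi> x" using eventually_nhds_x_imp_x[OF ev] by simp
    qed simp
    then show ?thesis by (simp add: partial_deriv_unique)
  qed
  then have "closure {x. partial_deriv i \<psi> x \<noteq> 0} \<subseteq> ?S"
    by (intro closure_minimal) auto
  moreover have "compact ?S" "?S \<subseteq> U" using \<psi> by (auto simp: test_functions_def)
  ultimately show ?thesis
    by (auto simp: test_functions_def compact_eq_bounded_closed intro: bounded_subset)
qed

section \<open>Weak gradients: linearity, uniqueness and norms\<close>

context polygon
begin

lemma L2_test_function:
  assumes "\<psi> \<in> test_functions (interior T)"
  shows "L2_on T \<psi>" "L2_on T (partial_deriv i \<psi>)"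
  using test_function_continuous[OF assms] by (auto intro: L2_continuous[OF compact])

lemma weak_grad_L2: "is_weak_grad T f G \<Longrightarrow> L2_on T (\<lambda>x. G x $ i)"
  by (rule L2_vec_component) (simp add: is_weak_grad_def)

lemma weak_grad_eq:
  "is_weak_grad T f G \<Longrightarrow> \<psi> \<in> test_functions (interior T) \<Longrightarrow>
   (\<integral>x. f x * partial_deriv i \<psi> x \<partial>lebesgue_on T) = - (\<integral>x. G x $ i * \<psi> x \<partial>lebesgue_on T)"
  by (simp add: is_weak_grad_def)

lemma weak_grad_lincomb:
  assumes f: "is_weak_grad T f F" "L2_on T f" and g: "is_weak_grad T g G" "L2_on T g"
  shows "is_weak_grad T (\<lambda>x. f x + c * g x) (\<lambda>x. F x + c *\<^sub>R G x)"
  unfolding is_weak_grad_def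
proof (intro conjI ballI allI)
  show "L2_on T (\<lambda>x. F x + c *\<^sub>R G x)"
    using L2_add[OF weak_grad_L2[OF f(1)] L2_cmult[OF weak_grad_L2[OF g(1)], of c]]
    by (intro L2_vecI) simp
  fix \<psi> i assume \<psi>: "\<psi> \<in> test_functions (interior T)"
  note t = L2_test_function[OF \<psi>]
  have "(\<integral>x. (f x + c * g x) * partial_deriv i \<psi> x \<partial>lebesgue_on T)
      = (\<integral>x. f x * partial_deriv i \<psi> x + c * (g x * partial_deriv i \<psi> x) \<partial>lebesgue_on T)"
    by (simp add: algebra_simps)
  also have "\<dots> = - (\<integral>x. F x $ i * \<psi> x \<partial>lebesgue_on T) + c * - (\<integral>x. G x $ i * \<psi> x \<partial>lebesgue_on T)"
    using L2_mult_integrable[OF f(2) t(2), of i] L2_mult_integrable[OF g(2) t(2), of i]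
      weak_grad_eq[OF f(1) \<psi>, of i] weak_grad_eq[OF g(1) \<psi>, of i] by simp
  also have "\<dots> = - (\<integral>x. F x $ i * \<psi> x + c * (G x $ i * \<psi> x) \<partial>lebesgue_on T)"
    using L2_mult_integrable[OF weak_grad_L2[OF f(1)] t(1)] L2_mult_integrable[OF weak_grad_L2[OF g(1)] t(1)]
    by simp
  also have "\<dots> = - (\<integral>x. (F x + c *\<^sub>R G x) $ i * \<psi> x \<partial>lebesgue_on T)"
    by (simp add: algebra_simps)
  finally show "(\<integral>x. (f x + c * g x) * partial_deriv i \<psi> x \<partial>lebesgue_on T)
      = - (\<integral>x. (F x + c *\<^sub>R G x) $ i * \<psi> x \<partial>lebesgue_on T)" .
qed

text \<open>The common source of uniqueness for weak gradients and weak divergences: the difference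
  annihilates all test functions.\<close>

lemma annihilator_unique:
  assumes "L2_on T f" "L2_on T g"
    and eq: "\<And>\<psi>. \<psi> \<in> test_functions (interior T) \<Longrightarrow>
      (\<integral>x. f x * \<psi> x \<partial>lebesgue_on T) = (\<integral>x. g x * \<psi> x \<partial>lebesgue_on T)"
  shows "AE x in lebesgue_on T. f x = g x"
proof -
  have "AE x in lebesgue_on T. f x - g x = 0"
  proof (rule test_functions_separate[OF L2_diff[OF assms(1,2)]])
    fix \<psi> assume \<psi>: "\<psi> \<in> test_functions (interior T)"
    then show "(\<integral>x. (f x - g x) * \<psi> x \<partial>lebesgue_on T) = 0"
      using L2_mult_integrable[OF assms(1) L2_test_function(1)[OF \<psi>]]
        L2_mult_integrable[OF assms(2) L2_test_function(1)[OF \<psi>]] eq[OF \<psi>]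
      by (simp add: left_diff_distrib)
  qed
  then show ?thesis by simp
qed

text \<open>Allows the gradient chosen in \<open>weak_grad\<close> to be replaced by any explicit
  one in norms and integrals, for instance by a classical gradient.\<close>

lemma weak_grad_unique:
  assumes F: "is_weak_grad T f F" and G: "is_weak_grad T f G"
  shows "L2_norm T (\<lambda>x. F x $ i) = L2_norm T (\<lambda>x. G x $ i)"
    "(\<integral>x. F x $ i \<partial>lebesgue_on T) = (\<integral>x. G x $ i \<partial>lebesgue_on T)"
proof -
  have ae: "AE x in lebesgue_on T. F x $ i = G x $ i"
    by (rule annihilator_unique[OF weak_grad_L2[OF F] weak_grad_L2[OF G]])
      (use weak_grad_eq[OF F, of _ i] weak_grad_eq[OF G, of _ i] in force)
  show "L2_norm T (\<lambda>x. F x $ i) = L2_norm T (\<lambda>x. G x $ i)"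
    using ae weak_grad_L2[OF F, of i] weak_grad_L2[OF G, of i]
    by (intro L2_norm_cong_AE) (auto simp: L2_on_real)
  show "(\<integral>x. F x $ i \<partial>lebesgue_on T) = (\<integral>x. G x $ i \<partial>lebesgue_on T)"
    using ae weak_grad_L2[OF F, of i] weak_grad_L2[OF G, of i]
    by (intro integral_cong_AE) (auto simp: L2_on_real)
qed

lemma weak_grad: "H1_on T f \<Longrightarrow> is_weak_grad T f (weak_grad T f)"
  unfolding H1_on_def weak_grad_def using someI_ex[of "is_weak_grad T f"] by blast

lemma H1_L2: "H1_on T f \<Longrightarrow> L2_on T f" by (simp add: H1_on_def)

lemma H1_onI: "L2_on T f \<Longrightarrow> is_weak_grad T f G \<Longrightarrow> H1_on T f" by (auto simp: H1_on_def)

lemma weak_grad_norm: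
  assumes "is_weak_grad T f G"
  shows "(L2_norm T (weak_grad T f))\<^sup>2 = (\<Sum>i\<in>UNIV. (L2_norm T (\<lambda>x. G x $ i))\<^sup>2)"
proof -
  have "is_weak_grad T f (weak_grad T f)"
    unfolding weak_grad_def using someI[of "is_weak_grad T f", OF assms] .
  then show ?thesis
    using L2_vec_norm[of T "weak_grad T f"] weak_grad_unique(1)[OF _ assms] by (simp add: is_weak_grad_def)
qed

lemma H1_norm_power2:
  assumes "is_weak_grad T f G"
  shows "(H1_norm T f)\<^sup>2 = (L2_norm T f)\<^sup>2 + (\<Sum>i\<in>UNIV. (L2_norm T (\<lambda>x. G x $ i))\<^sup>2)"
  unfolding H1_norm_def using weak_grad_norm[OF assms] by (simp add: sum_nonneg)

subsection \<open>Continuously differentiable functions\<close>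

text \<open>\<open>grad_within\<close> refers to a chosen derivative within \<open>T\<close>;
  \<open>derivative_unique\<close> identifies it with \<open>G\<close> at boundary points
  too.\<close>

lemma C1_onI:
  assumes D: "\<And>x. x \<in> T \<Longrightarrow> (u has_derivative (\<lambda>h. G x \<bullet> h)) (at x within T)" and G: "continuous_on T G"
  shows "C1_on T u" "\<And>x. x \<in> T \<Longrightarrow> grad_within T u x = G x"
proof -
  show eq: "grad_within T u x = G x" if x: "x \<in> T" for x
  proof -
    have "u differentiable (at x within T)" using D[OF x] by (auto simp: differentiable_def)
    then have "(u has_derivative frechet_derivative u (at x within T)) (at x within T)"
      by (simp add: frechet_derivative_works)
    then have "frechet_derivative u (at x within T) = (\<lambda>h. G x \<bullet> h)"
      using derivative_unique[OF x _ D[OF x]] by blast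
    then show ?thesis by (simp add: grad_within_def vec_eq_iff inner_axis)
  qed
  show "C1_on T u" unfolding C1_on_def
  proof
    show "u differentiable_on T" using D by (auto simp: differentiable_on_def differentiable_def)
    show "continuous_on T (grad_within T u)"
      using G by (subst continuous_on_cong[OF refl eq]) auto
  qed
qed

lemma C1_has_derivative:
  assumes "C1_on T u" "x \<in> T"
  shows "(u has_derivative (\<lambda>h. grad_within T u x \<bullet> h)) (at x within T)"
proof -
  let ?D = "frechet_derivative u (at x within T)"
  have D: "(u has_derivative ?D) (at x within T)"
    using assms by (simp add: C1_on_def differentiable_on_def frechet_derivative_works)
  have "(\<lambda>h. grad_within T u x \<bullet> h) = ?D"
    unfolding grad_within_def using inner_eq_linear[OF has_derivative_bounded_linear[OF D]] by blast
  then show ?thesis using D by simp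
qed

lemma C1_continuous: "C1_on T u \<Longrightarrow> continuous_on T u"
  by (simp add: C1_on_def differentiable_imp_continuous_on)

lemma C1_continuous_grad: "C1_on T u \<Longrightarrow> continuous_on T (grad_within T u)"
  by (simp add: C1_on_def)

text \<open>The cross product with side \<open>j\<close> vanishes on that edge but is positive in
  the interior, so edge points lie outside the support.\<close>

lemma test_function_edge:
  assumes "\<psi> \<in> test_functions (interior T)" "j < n" "x \<in> edge n v j"
  shows "\<psi> x = 0"
proof (rule ccontr)
  assume "\<psi> x \<noteq> 0"
  then have "x \<in> interior T"
    using assms(1) closure_subset[of "{x. \<psi> x \<noteq> 0}"] by (auto simp: test_functions_def)
  then have "0 < cross2 (side j) (x - v j)" using cross2_side_pos assms(2) by blast
  moreover obtain t where "x = on_edge j t" using edge_onE assms(3) by metis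
  ultimately show False by (simp add: on_edge_eq cross2_def)
qed

text \<open>Gauss' theorem for the product of \<open>u\<close> and \<open>\<psi>\<close>; the edge
  terms vanish with \<open>\<psi>\<close>.\<close>

lemma integration_by_parts:
  assumes u: "C1_on T u" and \<psi>: "\<psi> \<in> test_functions (interior T)"
  shows "(\<integral>x. u x * partial_deriv i \<psi> x \<partial>lebesgue_on T) = - (\<integral>x. grad_within T u x $ i * \<psi> x \<partial>lebesgue_on T)"
proof -
  note t = test_function_continuous[OF \<psi>]
  define G where "G x = u x *\<^sub>R gradient \<psi> x + \<psi> x *\<^sub>R grad_within T u x" for x
  have Gi: "G x $ i = u x * partial_deriv i \<psi> x + grad_within T u x $ i * \<psi> x" for x
    by (simp add: G_def gradient_def)
  have "(\<integral>x. G x $ i \<partial>lebesgue_on T) = (\<Sum>j<n. edge_normal n v j $ i * edge_integral n v j (\<lambda>x. u x * \<psi> x))"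
  proof (rule gauss)
    show "continuous_on T G"
      unfolding G_def gradient_def using t(1,2) C1_continuous[OF u] C1_continuous_grad[OF u]
      by (auto intro!: continuous_intros)
    fix x assume x: "x \<in> T"
    have "(\<psi> has_derivative (\<lambda>h. gradient \<psi> x \<bullet> h)) (at x within T)"
      by (rule has_derivative_at_withinI[OF has_derivative_gradient[OF t(3)]])
    from has_derivative_mult[OF C1_has_derivative[OF u x] this]
    show "((\<lambda>x. u x * \<psi> x) has_derivative (\<lambda>h. G x \<bullet> h)) (at x within T)"
      by (simp add: G_def inner_add_left mult.commute)
  qed
  also have "\<dots> = 0"
  proof -
    have "edge_integral n v j (\<lambda>x. u x * \<psi> x) = 0" if "j < n" for j
    proof -
      have "\<psi> (linepath (v j) (next_vertex n v j) t) = 0" if "t \<in> {0..1}" for t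
        using test_function_edge[OF \<psi> \<open>j < n\<close>] that by (simp add: edge_def linepath_in_path)
      then have "(\<integral>t. u (linepath (v j) (next_vertex n v j) t) * \<psi> (linepath (v j) (next_vertex n v j) t)
          \<partial>lebesgue_on {0..1}) = (\<integral>t. 0 \<partial>lebesgue_on {0..1::real})"
        by (intro Bochner_Integration.integral_cong refl) simp
      then show ?thesis by (simp add: edge_integral_def)
    qed
    then show ?thesis by simp
  qed
  finally have "(\<integral>x. u x * partial_deriv i \<psi> x + grad_within T u x $ i * \<psi> x \<partial>lebesgue_on T) = 0"
    by (simp add: Gi)
  moreover have "integrable (lebesgue_on T) (\<lambda>x. u x * partial_deriv i \<psi> x)"
    "integrable (lebesgue_on T) (\<lambda>x. grad_within T u x $ i * \<psi> x)"
    using t(1,2) C1_continuous[OF u] C1_continuous_grad[OF u]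
    by (auto intro!: L2_mult_integrable L2_continuous[OF compact] continuous_intros)
  ultimately show ?thesis by simp
qed

lemma C1_weak_grad: "C1_on T u \<Longrightarrow> is_weak_grad T u (grad_within T u)"
  unfolding is_weak_grad_def using integration_by_parts C1_continuous_grad
  by (auto intro!: L2_vecI L2_continuous[OF compact] continuous_intros)

lemma C1_L2: "C1_on T u \<Longrightarrow> L2_on T u"
  by (rule L2_continuous[OF compact C1_continuous])

end

section \<open>Density of continuously differentiable functions\<close>

context mollified_polygon
begin

text \<open>The gradient of the kernel with respect to its centre \<open>x\<close>, not to
  \<open>z\<close>; hence the chain rule factor -(1 - s)/s.\<close>

definition kern_grad :: "real \<Rightarrow> real^2 \<Rightarrow> real^2 \<Rightarrow> real^2" where
  "kern_grad s x z = (- ((1 - s) / s) / s\<^sup>2) *\<^sub>R gradient \<eta> ((1 / s) *\<^sub>R z + (- ((1 - s) / s)) *\<^sub>R x)"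

lemma gradient_\<eta>_continuous: "continuous_on A (gradient \<eta>)"
proof -
  have "continuous_on UNIV (partial_deriv i \<eta>)" for i
    using smooth[of "Suc 0"] by simp
  then show ?thesis
    unfolding gradient_def[abs_def] by (intro continuous_on_vec_lambda) (rule continuous_on_subset, auto)
qed

lemma kern_pair_continuous: "continuous_on A (\<lambda>p. kern s (fst p) (snd p))"
  unfolding kern_def divide_inverse[of _ "s\<^sup>2"]
  by (intro continuous_intros continuous_on_compose2[OF \<eta>_continuous[of UNIV]]) auto

lemma kern_grad_pair_continuous: "continuous_on A (\<lambda>p. kern_grad s (fst p) (snd p))"
  unfolding kern_grad_def
  by (intro continuous_intros continuous_on_compose2[OF gradient_\<eta>_continuous[of UNIV]]) auto

lemma kern_grad_continuous: "continuous_on A (\<lambda>z. kern_grad s x z $ i)"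
  unfolding kern_grad_def
  by (intro continuous_intros continuous_on_compose2[OF gradient_\<eta>_continuous[of UNIV]]) auto

text \<open>Compactness of \<open>T \<times> T\<close> makes the modulus of continuity in the centre
  independent of \<open>z\<close>, so that estimates of kernels can be integrated over
  \<open>z\<close> against an arbitrary L2 function.\<close>

lemma uniform_in_parameter:
  fixes k :: "real^2 \<Rightarrow> real^2 \<Rightarrow> 'a::metric_space"
  assumes "continuous_on (T \<times> T) (\<lambda>p. k (fst p) (snd p))" "0 < e"
  obtains d where "0 < d" "\<And>x y z. x \<in> T \<Longrightarrow> y \<in> T \<Longrightarrow> z \<in> T \<Longrightarrow> dist x y < d \<Longrightarrow> dist (k x z) (k y z) < e"
proof -
  obtain d where d: "0 < d" "\<And>p q. p \<in> T \<times> T \<Longrightarrow> q \<in> T \<times> T \<Longrightarrow> dist q p < d \<Longrightarrow>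
      dist (k (fst q) (snd q)) (k (fst p) (snd p)) < e"
    using compact_uniformly_continuous[OF assms(1) compact_Times[OF compact compact]] assms(2)
    unfolding uniformly_continuous_on_def by metis
  have "dist (k x z) (k y z) < e" if "x \<in> T" "y \<in> T" "z \<in> T" "dist x y < d" for x y z
    using d(2)[of "(y, z)" "(x, z)"] that by (simp add: dist_Pair_Pair)
  then show ?thesis using that d(1) by blast
qed

lemma avg_continuous:
  assumes f: "L2_on T f" shows "continuous_on T (avg s f)"
  unfolding continuous_on_iff
proof (intro ballI allI impI)
  fix x e assume x: "x \<in> T" and e: "(0::real) < e"
  have fi: "integrable (lebesgue_on T) (\<lambda>z. \<bar>f z\<bar>)" using L2_integrable[OF lmeasurable f] by simp
  define F where "F = (\<integral>z. \<bar>f z\<bar> \<partial>lebesgue_on T)"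
  have F: "0 \<le> F" by (simp add: F_def)
  \<comment> \<open>The summand 1 covers the case that the integral of
    \<open>\<bar>f z\<bar>\<close> is zero.\<close>
  have e': "0 < e / (F + 1)" using e F by simp
  obtain d where d: "0 < d" "\<And>x y z. x \<in> T \<Longrightarrow> y \<in> T \<Longrightarrow> z \<in> T \<Longrightarrow> dist x y < d \<Longrightarrow>
      dist (kern s x z) (kern s y z) < e / (F + 1)"
    using uniform_in_parameter[OF kern_pair_continuous[of _ s] e'] by blast
  have "dist (avg s f y) (avg s f x) < e" if y: "y \<in> T" "dist y x < d" for y
  proof -
    have "avg s f y - avg s f x = (\<integral>z. f z * (kern s y z - kern s x z) \<partial>lebesgue_on T)"
      using avg_integrable[OF f, of s x] avg_integrable[OF f, of s y] by (simp add: avg_def right_diff_distrib)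
    also have "\<bar>\<dots>\<bar> \<le> (\<integral>z. \<bar>f z\<bar> * (e / (F + 1)) \<partial>lebesgue_on T)"
    proof (rule order_trans[OF integral_abs_bound Bochner_Integration.integral_mono])
      show "integrable (lebesgue_on T) (\<lambda>z. \<bar>f z * (kern s y z - kern s x z)\<bar>)"
        using avg_integrable[OF f, of s x] avg_integrable[OF f, of s y] by (simp add: right_diff_distrib)
      show "integrable (lebesgue_on T) (\<lambda>z. \<bar>f z\<bar> * (e / (F + 1)))" using fi by simp
      fix z assume "z \<in> space (lebesgue_on T)"
      then have "\<bar>kern s y z - kern s x z\<bar> \<le> e / (F + 1)"
        using d(2)[OF y(1) x _ y(2), of z] by (simp add: dist_real_def)
      then show "\<bar>f z * (kern s y z - kern s x z)\<bar> \<le> \<bar>f z\<bar> * (e / (F + 1))"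
        unfolding abs_mult by (rule mult_left_mono) simp
    qed
    also have "\<dots> = F * (e / (F + 1))" by (simp add: F_def)
    also have "\<dots> < e" using e F by (simp add: field_simps)
    finally show ?thesis by (simp add: dist_real_def)
  qed
  then show "\<exists>d>0. \<forall>y\<in>T. dist y x < d \<longrightarrow> dist (avg s f y) (avg s f x) < e" using d(1) by blast
qed

lemma \<eta>_differentiable: "\<eta> differentiable at x"
  using C_k_SucD(1)[OF smooth[of "Suc 0"]] .

lemma kern_has_derivative:
  "((\<lambda>x. kern s x z) has_derivative (\<lambda>h. kern_grad s x z \<bullet> h)) (at x within A)"
proof -
  let ?c = "- ((1 - s) / s)" and ?d = "(1 / s) *\<^sub>R z"
  have "((\<lambda>x. \<eta> (?c *\<^sub>R x + ?d)) has_derivative (\<lambda>h. gradient \<eta> (?c *\<^sub>R x + ?d) \<bullet> (?c *\<^sub>R h))) (at x)"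
    by (rule has_derivative_compose[of "\<lambda>x. ?c *\<^sub>R x + ?d", OF _ has_derivative_gradient[OF \<eta>_differentiable]])
      (auto intro!: derivative_eq_intros)
  from has_derivative_mult_right[OF this, of "1 / s\<^sup>2"]
  have "((\<lambda>x. kern s x z) has_derivative (\<lambda>h. kern_grad s x z \<bullet> h)) (at x)"
    by (simp add: kern_def kern_grad_def add.commute mult.commute[of s])
  then show ?thesis by (rule has_derivative_at_withinI)
qed

text \<open>The kernel depends on z/s - ((1 - s)/s) x only, so derivatives in x and in z are
  proportional. This lets a derivative of the average be moved onto the test function
  \<open>kern s x\<close>.\<close>

lemma kern_grad_dual: "kern_grad s x z $ i = - (1 - s) * partial_deriv i (kern s x) z"
proof -
  let ?c = "1 / s" and ?d = "(- ((1 - s) / s)) *\<^sub>R x"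
  have "((\<lambda>z. \<eta> (?c *\<^sub>R z + ?d)) has_derivative (\<lambda>h. gradient \<eta> (?c *\<^sub>R z + ?d) \<bullet> (?c *\<^sub>R h))) (at z)"
    by (rule has_derivative_compose[of "\<lambda>x. ?c *\<^sub>R x + ?d", OF _ has_derivative_gradient[OF \<eta>_differentiable]])
      (auto intro!: derivative_eq_intros)
  from has_derivative_mult_right[OF this, of "1 / s\<^sup>2"]
  have "(kern s x has_derivative (\<lambda>h. ((1 / s / s\<^sup>2) *\<^sub>R gradient \<eta> (?c *\<^sub>R z + ?d)) \<bullet> h)) (at z)"
    by (simp add: kern_def[abs_def] mult.commute[of s])
  from gradient_unique[OF this, of i] show ?thesis
    by (simp add: kern_grad_def divide_inverse mult.assoc mult.left_commute mult.commute del: minus_diff_eq)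
qed

text \<open>The mean value inequality on the segment from x to y, with the gradient varying by less
  than \<open>e\<close> there, uniformly in \<open>z\<close>.\<close>

lemma kern_linearization:
  assumes "0 < e"
  obtains d where "0 < d" "\<And>x y z. x \<in> T \<Longrightarrow> y \<in> T \<Longrightarrow> z \<in> T \<Longrightarrow> norm (y - x) < d \<Longrightarrow>
    \<bar>kern s y z - kern s x z - kern_grad s x z \<bullet> (y - x)\<bar> \<le> e * norm (y - x)"
proof -
  obtain d where d: "0 < d" "\<And>x y z. x \<in> T \<Longrightarrow> y \<in> T \<Longrightarrow> z \<in> T \<Longrightarrow> dist x y < d \<Longrightarrow>
      dist (kern_grad s x z) (kern_grad s y z) < e"
    using uniform_in_parameter[OF kern_grad_pair_continuous[of _ s] assms] by blast
  have "\<bar>kern s y z - kern s x z - kern_grad s x z \<bullet> (y - x)\<bar> \<le> e * norm (y - x)"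
    if x: "x \<in> T" and y: "y \<in> T" and z: "z \<in> T" and xy: "norm (y - x) < d" for x y z
  proof -
    have "norm (kern s y z - kern s x z - kern_grad s x z \<bullet> (y - x)) \<le> norm (y - x) * e"
    proof (rule differentiable_bound_linearization[where S = "closed_segment x y" and f = "\<lambda>x. kern s x z"
          and f' = "\<lambda>x h. kern_grad s x z \<bullet> h"])
      show "x + t *\<^sub>R (y - x) \<in> closed_segment x y" if "t \<in> {0..1}" for t
        using that by (auto simp: in_segment algebra_simps)
      show "((\<lambda>x. kern s x z) has_derivative (\<lambda>h. kern_grad s w z \<bullet> h)) (at w within closed_segment x y)" for w
        by (rule kern_has_derivative)
      show "onorm ((\<lambda>h. kern_grad s w z \<bullet> h) - (\<lambda>h. kern_grad s x z \<bullet> h)) \<le> e" if w: "w \<in> closed_segment x y" for w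
      proof (rule onorm_bound)
        have "w \<in> T" using w x y convex closed_segment_subset by blast
        moreover have "dist w x < d"
          using w xy by (metis dist_in_closed_segment dist_commute dist_norm le_less_trans)
        ultimately have "norm (kern_grad s w z - kern_grad s x z) \<le> e"
          using d(2)[of w x z] x z by (simp add: dist_norm)
        then show "norm (((\<lambda>h. kern_grad s w z \<bullet> h) - (\<lambda>h. kern_grad s x z \<bullet> h)) h) \<le> e * norm h" for h
          using Cauchy_Schwarz_ineq2[of "kern_grad s w z - kern_grad s x z" h]
          by (simp add: inner_diff_left) (meson mult_right_mono norm_ge_zero order_trans)
      qed (use assms in simp)
    qed simp
    then show ?thesis by (simp add: mult.commute)
  qed
  then show ?thesis using that d(1) by blast
qed

text \<open>Moving the centre x moves each sample point (1 - s) x + s y only by the fraction 1 - s,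
  hence the factor.\<close>

definition avg_grad :: "real \<Rightarrow> (real^2 \<Rightarrow> real^2) \<Rightarrow> real^2 \<Rightarrow> real^2" where
  "avg_grad s G x = (1 - s) *\<^sub>R (\<chi> i. avg s (\<lambda>z. G z $ i) x)"

text \<open>The uniform linearization of the kernel permits differentiation under the integral. By
  \<open>kern_grad_dual\<close> the result is an integral of \<open>f\<close> against a derivative
  of a test function, where the weak gradient \<open>G\<close> takes over.\<close>

lemma avg_has_derivative:
  assumes f: "L2_on T f" and G: "is_weak_grad T f G" and s: "0 < s" "s \<le> 1" and x: "x \<in> T"
  shows "(avg s f has_derivative (\<lambda>h. avg_grad s G x \<bullet> h)) (at x within T)"
  unfolding has_derivative_within_alt
proof (intro conjI allI impI)
  show "bounded_linear (\<lambda>h. avg_grad s G x \<bullet> h)" by (rule bounded_linear_inner_right)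
  have kg: "integrable (lebesgue_on T) (\<lambda>z. f z * kern_grad s x z $ i)" for i
    by (rule L2_mult_integrable[OF f L2_continuous[OF compact kern_grad_continuous]])
  have comp: "avg_grad s G x $ i = (\<integral>z. f z * kern_grad s x z $ i \<partial>lebesgue_on T)" for i
  proof -
    have "(\<integral>z. f z * kern_grad s x z $ i \<partial>lebesgue_on T)
        = (\<integral>z. - (1 - s) * (f z * partial_deriv i (kern s x) z) \<partial>lebesgue_on T)"
      by (simp add: kern_grad_dual mult_ac)
    also have "\<dots> = - (1 - s) * (\<integral>z. f z * partial_deriv i (kern s x) z \<partial>lebesgue_on T)"
      by (rule integral_mult_right_zero)
    also have "\<dots> = (1 - s) * (\<integral>z. G z $ i * kern s x z \<partial>lebesgue_on T)"
      unfolding weak_grad_eq[OF G kern_test_function[OF x s], of i] by (simp add: algebra_simps)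
    finally show ?thesis by (simp add: avg_grad_def avg_def)
  qed
  have lin: "avg_grad s G x \<bullet> h = (\<integral>z. f z * (kern_grad s x z \<bullet> h) \<partial>lebesgue_on T)"
    and lin_int: "integrable (lebesgue_on T) (\<lambda>z. f z * (kern_grad s x z \<bullet> h))" for h
  proof -
    have eq: "f z * (kern_grad s x z \<bullet> h) = (\<Sum>i\<in>UNIV. h $ i * (f z * kern_grad s x z $ i))" for z
      by (simp add: inner_vec_def sum_distrib_left mult_ac)
    show "integrable (lebesgue_on T) (\<lambda>z. f z * (kern_grad s x z \<bullet> h))"
      unfolding eq using kg by simp
    show "avg_grad s G x \<bullet> h = (\<integral>z. f z * (kern_grad s x z \<bullet> h) \<partial>lebesgue_on T)"
      unfolding eq using kg by (simp add: inner_vec_def comp mult.commute)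
  qed
  fix e :: real assume e: "0 < e"
  have fi: "integrable (lebesgue_on T) (\<lambda>z. \<bar>f z\<bar>)" using L2_integrable[OF lmeasurable f] by simp
  define F where "F = (\<integral>z. \<bar>f z\<bar> \<partial>lebesgue_on T)"
  have F: "0 \<le> F" by (simp add: F_def)
  have e': "0 < e / (F + 1)" using e F by simp
  obtain d where d: "0 < d" "\<And>x y z. x \<in> T \<Longrightarrow> y \<in> T \<Longrightarrow> z \<in> T \<Longrightarrow> norm (y - x) < d \<Longrightarrow>
    \<bar>kern s y z - kern s x z - kern_grad s x z \<bullet> (y - x)\<bar> \<le> e / (F + 1) * norm (y - x)"
    using kern_linearization[OF e', of s] by blast
  have "norm (avg s f y - avg s f x - avg_grad s G x \<bullet> (y - x)) \<le> e * norm (y - x)"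
    if y: "y \<in> T" "norm (y - x) < d" for y
  proof -
    let ?R = "\<lambda>z. kern s y z - kern s x z - kern_grad s x z \<bullet> (y - x)"
    have R: "integrable (lebesgue_on T) (\<lambda>z. f z * ?R z)"
      using avg_integrable[OF f, of s x] avg_integrable[OF f, of s y] lin_int[of "y - x"]
      by (simp add: right_diff_distrib)
    have "avg s f y - avg s f x - avg_grad s G x \<bullet> (y - x) = (\<integral>z. f z * ?R z \<partial>lebesgue_on T)"
      using avg_integrable[OF f, of s x] avg_integrable[OF f, of s y] lin_int[of "y - x"]
      by (simp add: avg_def lin right_diff_distrib)
    also have "\<bar>\<dots>\<bar> \<le> (\<integral>z. \<bar>f z\<bar> * (e / (F + 1) * norm (y - x)) \<partial>lebesgue_on T)"
    proof (rule order_trans[OF integral_abs_bound Bochner_Integration.integral_mono])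
      show "integrable (lebesgue_on T) (\<lambda>z. \<bar>f z * ?R z\<bar>)" using R by (rule integrable_abs)
      show "integrable (lebesgue_on T) (\<lambda>z. \<bar>f z\<bar> * (e / (F + 1) * norm (y - x)))" using fi by simp
      fix z assume "z \<in> space (lebesgue_on T)"
      then have "\<bar>?R z\<bar> \<le> e / (F + 1) * norm (y - x)" using d(2)[OF x y(1) _ y(2), of z] by simp
      then show "\<bar>f z * ?R z\<bar> \<le> \<bar>f z\<bar> * (e / (F + 1) * norm (y - x))"
        unfolding abs_mult by (rule mult_left_mono) simp
    qed
    also have "\<dots> = (F / (F + 1)) * (e * norm (y - x))" by (simp add: F_def)
    also have "\<dots> \<le> 1 * (e * norm (y - x))" using e F by (intro mult_right_mono) auto
    finally show ?thesis by simp
  qed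
  then show "\<exists>d>0. \<forall>y\<in>T. norm (y - x) < d \<longrightarrow>
      norm (avg s f y - avg s f x - avg_grad s G x \<bullet> (y - x)) \<le> e * norm (y - x)"
    using d(1) by blast
qed

lemma avg_C1:
  assumes f: "L2_on T f" and G: "is_weak_grad T f G" and s: "0 < s" "s \<le> 1"
  shows "C1_on T (avg s f)" "\<And>x. x \<in> T \<Longrightarrow> grad_within T (avg s f) x = avg_grad s G x"
proof -
  have cont: "continuous_on T (avg_grad s G)"
    unfolding avg_grad_def using avg_continuous[OF weak_grad_L2[OF G]]
    by (intro continuous_intros continuous_on_vec_lambda)
  show "C1_on T (avg s f)" "\<And>x. x \<in> T \<Longrightarrow> grad_within T (avg s f) x = avg_grad s G x"
    using C1_onI[of "avg s f" "avg_grad s G"] avg_has_derivative[OF f G s] cont by auto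
qed

end

context polygon
begin

lemma weak_grad_diff:
  assumes "is_weak_grad T f F" "L2_on T f" "is_weak_grad T g G" "L2_on T g"
  shows "is_weak_grad T (\<lambda>x. f x - g x) (\<lambda>x. F x - G x)"
  using weak_grad_lincomb[OF assms, of "- 1"] by simp

text \<open>The gradient of the average is 1 - s times the average of \<open>G\<close>. Its distance
  to \<open>G\<close> is at most the averaging error of \<open>G\<close> plus s times the norm of
  the average, and both tend to 0.\<close>

lemma H1_dense_C1:
  assumes f: "H1_on T f"
  obtains u where "\<And>k. C1_on T (u k)" "(\<lambda>k. H1_norm T (\<lambda>x. u k x - f x)) \<longlonglongrightarrow> 0"
proof -
  obtain \<eta> K where "mollified_polygon T n v \<eta> K" using mollifier_exists by blast
  then interpret mollified_polygon T n v \<eta> K .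
  obtain G where fL2: "L2_on T f" and G: "is_weak_grad T f G" using f by (auto simp: H1_on_def)
  define u where "u m = avg (scale m) f" for m
  have u: "C1_on T (u m)" for m unfolding u_def by (rule avg_C1(1)[OF fL2 G scale(1,4)])
  have du: "grad_within T (u m) x = avg_grad (scale m) G x" if "x \<in> T" for m x
    unfolding u_def by (rule avg_C1(2)[OF fL2 G scale(1,4) that])
  have diff: "is_weak_grad T (\<lambda>x. u m x - f x) (\<lambda>x. grad_within T (u m) x - G x)" for m
    by (rule weak_grad_diff[OF C1_weak_grad[OF u] C1_L2[OF u] G fL2])
  have grad_lim: "(\<lambda>m. L2_norm T (\<lambda>x. (grad_within T (u m) x - G x) $ i)) \<longlonglongrightarrow> 0" for i
  proof (rule tendsto_sandwich[OF _ _ tendsto_const])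
    let ?g = "\<lambda>z. G z $ i"
    have g: "L2_on T ?g" by (rule weak_grad_L2[OF G])
    let ?B = "\<lambda>m. L2_norm T (\<lambda>x. avg (scale m) ?g x - ?g x) + scale m * (2 * L2_norm T ?g)"
    show "?B \<longlonglongrightarrow> 0"
      using tendsto_add[OF avg_tendsto[OF g] tendsto_mult_left_zero[OF scale_tendsto]] by simp
    have "L2_norm T (\<lambda>x. (grad_within T (u m) x - G x) $ i) \<le> ?B m" for m
    proof -
      note A = avg_L2[OF g scale(1,2)]
      have "L2_norm T (\<lambda>x. (grad_within T (u m) x - G x) $ i)
          = L2_norm T (\<lambda>x. (avg (scale m) ?g x - ?g x) + (- scale m) * avg (scale m) ?g x)"
        unfolding L2_norm_def
        by (intro arg_cong[of _ _ sqrt] Bochner_Integration.integral_cong refl)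
          (simp add: du avg_grad_def algebra_simps)
      also have "\<dots> \<le> L2_norm T (\<lambda>x. avg (scale m) ?g x - ?g x) + L2_norm T (\<lambda>x. (- scale m) * avg (scale m) ?g x)"
        by (rule L2_triangle[OF L2_diff[OF A(1) g] L2_cmult[OF A(1)]])
      also have "L2_norm T (\<lambda>x. (- scale m) * avg (scale m) ?g x) = scale m * L2_norm T (avg (scale m) ?g)"
        using scale(1)[of m] by (simp add: L2_norm_def power_mult_distrib real_sqrt_mult)
      also have "\<dots> \<le> scale m * (2 * L2_norm T ?g)"
        using A(2)[of m] scale(1)[of m] by (intro mult_left_mono) auto
      finally show ?thesis by simp
    qed
    then show "\<forall>\<^sub>F m in sequentially. L2_norm T (\<lambda>x. (grad_within T (u m) x - G x) $ i) \<le> ?B m" by simp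
  qed (simp add: L2_norm_nonneg)
  have "(\<lambda>m. sqrt ((L2_norm T (\<lambda>x. u m x - f x))\<^sup>2 +
      (\<Sum>i\<in>UNIV. (L2_norm T (\<lambda>x. (grad_within T (u m) x - G x) $ i))\<^sup>2))) \<longlonglongrightarrow> sqrt (0\<^sup>2 + (\<Sum>i\<in>(UNIV::2 set). 0\<^sup>2))"
    using avg_tendsto[OF fL2] grad_lim unfolding u_def by (intro tendsto_intros)
  moreover have "H1_norm T (\<lambda>x. u m x - f x) = sqrt ((L2_norm T (\<lambda>x. u m x - f x))\<^sup>2 +
      (\<Sum>i\<in>UNIV. (L2_norm T (\<lambda>x. (grad_within T (u m) x - G x) $ i))\<^sup>2))" for m
    unfolding H1_norm_power2[OF diff, symmetric] by (simp add: H1_norm_def)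
  ultimately have "(\<lambda>m. H1_norm T (\<lambda>x. u m x - f x)) \<longlonglongrightarrow> 0" by simp
  then show ?thesis using that u by blast
qed

end

section \<open>Traces\<close>

text \<open>A rapidly convergent sequence converges almost everywhere, so its limit in \<open>L\<^sup>2\<close> can be taken
  pointwise.\<close>

lemma L2_complete_pointwise:
  fixes w :: "nat \<Rightarrow> 'a::euclidean_space \<Rightarrow> real"
  assumes S: "S \<in> lmeasurable" and w: "\<And>m. L2_on S (w m)"
    and C: "\<And>m. L2_norm S (\<lambda>x. w (Suc m) x - w m x) \<le> C * (1/2) ^ m"
  defines "h \<equiv> \<lambda>x. lim (\<lambda>m. w m x)"
  shows "L2_on S h" "(\<lambda>m. L2_norm S (\<lambda>x. w m x - h x)) \<longlonglongrightarrow> 0"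
proof -
  let ?M = "lebesgue_on S"
  interpret finite_measure ?M by (rule finite_measure_lebesgue_on[OF S])
  have wm [measurable]: "w m \<in> borel_measurable ?M" for m using w by (simp add: L2_on_real)
  have hm [measurable]: "h \<in> borel_measurable ?M" unfolding h_def by (rule borel_measurable_lim_metric) (rule wm)
  have d: "L2_on S (\<lambda>x. w (Suc m) x - w m x)" for m by (rule L2_diff[OF w w])
  have C0: "0 \<le> C" using order_trans[OF L2_norm_nonneg C[of 0]] by simp
  define V where "V = L2_norm S (\<lambda>x. 1 :: real)"
  \<comment> \<open>Cauchy-Schwarz against 1 turns the bounds on the increments into summable L1
    bounds, so almost everywhere the increments form an absolutely convergent telescoping
    series.\<close>
  have ae: "AE x in ?M. (\<lambda>m. w m x) \<longlonglongrightarrow> h x"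
  proof -
    let ?d = "\<lambda>m x. \<bar>w (Suc m) x - w m x\<bar>"
    have di: "integrable ?M (?d m)" for m using L2_integrable[OF S d[of m]] by simp
    have dn: "(\<integral>x. ?d m x \<partial>?M) \<le> C * V * (1/2) ^ m" for m
    proof -
      have "L2_on S (?d m)" using d[of m] by (simp add: L2_on_real)
      from L2_Cauchy_Schwarz[OF this L2_const[OF S, of 1]]
      have "(\<integral>x. ?d m x \<partial>?M) \<le> L2_norm S (?d m) * V" by (simp add: V_def)
      also have "L2_norm S (?d m) = L2_norm S (\<lambda>x. w (Suc m) x - w m x)" by (simp add: L2_norm_def)
      also have "\<dots> * V \<le> (C * (1/2) ^ m) * V"
        using C[of m] by (intro mult_right_mono) (auto simp: V_def L2_norm_nonneg)
      finally show ?thesis by (simp add: mult_ac)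
    qed
    have "(\<integral>\<^sup>+x. (\<Sum>m. ennreal (?d m x)) \<partial>?M) = (\<Sum>m. \<integral>\<^sup>+x. ennreal (?d m x) \<partial>?M)"
      by (rule nn_integral_suminf) measurable
    also have "\<dots> \<le> (\<Sum>m. ennreal (C * V * (1/2) ^ m))"
    proof (rule suminf_le)
      show "(\<integral>\<^sup>+x. ennreal (?d m x) \<partial>?M) \<le> ennreal (C * V * (1/2) ^ m)" for m
        using nn_integral_eq_integral[OF di[of m]] dn[of m] by (simp add: ennreal_leI)
    qed auto
    also have "\<dots> = ennreal (\<Sum>m. C * V * (1/2) ^ m)"
      using C0 by (intro suminf_ennreal2 summable_mult summable_geometric)
        (auto simp: V_def L2_norm_nonneg)
    also have "\<dots> < \<infinity>" by simp
    finally have "AE x in ?M. (\<Sum>m. ennreal (?d m x)) \<noteq> \<infinity>"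
      by (intro nn_integral_PInf_AE) auto
    then show ?thesis
    proof eventually_elim
      case (elim x)
      then have "summable (\<lambda>m. ?d m x)"
        by (intro summable_suminf_not_top) auto
      then have "summable (\<lambda>m. w (Suc m) x - w m x)" by (rule summable_rabs_cancel)
      then have "convergent (\<lambda>N. w N x - w 0 x)"
        by (simp add: summable_iff_convergent sum_lessThan_telescope[of "\<lambda>m. w m x"])
      then have "convergent (\<lambda>N. (w N x - w 0 x) + w 0 x)"
        by (intro convergent_add convergent_const)
      then show ?case by (simp add: h_def convergent_LIMSEQ_iff)
    qed
  qed
  have tail: "L2_norm S (\<lambda>x. w m x - w (m + l) x) \<le> 2 * C * (1/2) ^ m" for m l
  proof -
    \<comment> \<open>Subtracting the geometric remainder strengthens the bound enough for the
      induction on \<open>l\<close>.\<close>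
    have "L2_norm S (\<lambda>x. w m x - w (m + l) x) \<le> 2 * C * (1/2) ^ m - 2 * C * (1/2) ^ (m + l)"
    proof (induction l)
      case 0 then show ?case by (simp add: L2_norm_def)
    next
      case (Suc l)
      have "L2_norm S (\<lambda>x. (w m x - w (m + l) x) + (w (m + l) x - w (Suc (m + l)) x))
          \<le> L2_norm S (\<lambda>x. w m x - w (m + l) x) + L2_norm S (\<lambda>x. w (m + l) x - w (Suc (m + l)) x)"
        by (rule L2_triangle[OF L2_diff[OF w w] L2_diff[OF w w]])
      also have "L2_norm S (\<lambda>x. w (m + l) x - w (Suc (m + l)) x) \<le> C * (1/2) ^ (m + l)"
        using C[of "m + l"] L2_norm_minus_commute[of S "w (m + l)"] by simp
      finally show ?case using Suc.IH by (simp add: power_add)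
    qed
    moreover have "0 \<le> 2 * C * (1/2) ^ (m + l)" using C0 by simp
    ultimately show ?thesis by linarith
  qed
  \<comment> \<open>Fatou's lemma transfers the tail bound to the limit \<open>l\<close> to
    infinity, which yields square integrability and the rate of convergence at once.\<close>
  have fatou: "(\<integral>\<^sup>+x. ennreal ((w m x - h x)\<^sup>2) \<partial>?M) \<le> ennreal ((2 * C * (1/2) ^ m)\<^sup>2)" for m
  proof -
    have "(\<integral>\<^sup>+x. ennreal ((w m x - h x)\<^sup>2) \<partial>?M) = (\<integral>\<^sup>+x. liminf (\<lambda>l. ennreal ((w m x - w (m + l) x)\<^sup>2)) \<partial>?M)"
    proof (rule nn_integral_cong_AE)
      show "AE x in ?M. ennreal ((w m x - h x)\<^sup>2) = liminf (\<lambda>l. ennreal ((w m x - w (m + l) x)\<^sup>2))"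
        using ae
      proof eventually_elim
        case (elim x)
        have "(\<lambda>l. w (m + l) x) \<longlonglongrightarrow> h x"
          using LIMSEQ_ignore_initial_segment[OF elim, of m] by (simp add: add.commute)
        then have "(\<lambda>l. ennreal ((w m x - w (m + l) x)\<^sup>2)) \<longlonglongrightarrow> ennreal ((w m x - h x)\<^sup>2)"
          by (intro tendsto_intros)
        then show ?case by (rule lim_imp_Liminf[OF sequentially_bot, symmetric])
      qed
    qed
    also have "\<dots> \<le> liminf (\<lambda>l. \<integral>\<^sup>+x. ennreal ((w m x - w (m + l) x)\<^sup>2) \<partial>?M)"
      by (rule nn_integral_liminf) measurable
    also have "\<dots> \<le> ennreal ((2 * C * (1/2) ^ m)\<^sup>2)"
    proof (rule Liminf_le)
      have "(\<integral>\<^sup>+x. ennreal ((w m x - w (m + l) x)\<^sup>2) \<partial>?M) \<le> ennreal ((2 * C * (1/2) ^ m)\<^sup>2)" for l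
      proof -
        have "(\<integral>\<^sup>+x. ennreal ((w m x - w (m + l) x)\<^sup>2) \<partial>?M) = ennreal ((L2_norm S (\<lambda>x. w m x - w (m + l) x))\<^sup>2)"
          using L2_diff[OF w[of m] w[of "m + l"]]
          by (subst nn_integral_eq_integral) (auto simp: L2_norm_power2 L2_on_real)
        also have "\<dots> \<le> ennreal ((2 * C * (1/2) ^ m)\<^sup>2)"
          by (intro ennreal_leI power_mono tail L2_norm_nonneg)
        finally show ?thesis .
      qed
      then show "\<forall>\<^sub>F l in sequentially. (\<integral>\<^sup>+x. ennreal ((w m x - w (m + l) x)\<^sup>2) \<partial>?M) \<le> ennreal ((2 * C * (1/2) ^ m)\<^sup>2)"
        by simp
    qed simp
    finally show ?thesis .
  qed
  have int: "integrable ?M (\<lambda>x. (w m x - h x)\<^sup>2)" for m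
    using fatou[of m] by (intro integrableI_bounded) (auto intro: le_less_trans)
  then have wh: "L2_on S (\<lambda>x. w m x - h x)" for m by (simp add: L2_on_real)
  show "L2_on S h" using L2_diff[OF w[of 0] wh[of 0]] by simp
  have bound: "L2_norm S (\<lambda>x. w m x - h x) \<le> 2 * C * (1/2) ^ m" for m
  proof (rule power2_le_imp_le)
    show "(L2_norm S (\<lambda>x. w m x - h x))\<^sup>2 \<le> (2 * C * (1/2) ^ m)\<^sup>2"
      using fatou[of m] nn_integral_eq_integral[OF int[of m]] by (simp add: L2_norm_power2 ennreal_le_iff)
  qed (use C0 in simp)
  show "(\<lambda>m. L2_norm S (\<lambda>x. w m x - h x)) \<longlonglongrightarrow> 0"
  proof (rule tendsto_sandwich[OF _ _ tendsto_const])
    show "(\<lambda>m. 2 * C * (1/2) ^ m) \<longlonglongrightarrow> 0"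
      by (intro tendsto_mult_right_zero LIMSEQ_power_zero) simp
    show "\<forall>\<^sub>F m in sequentially. L2_norm S (\<lambda>x. w m x - h x) \<le> 2 * C * (1/2) ^ m" using bound by simp
  qed (simp add: L2_norm_nonneg)
qed

section \<open>Norms on edges and the trace inequality for C^1 functions\<close>

context polygon
begin

definition edge_norm :: "nat \<Rightarrow> (real^2 \<Rightarrow> real) \<Rightarrow> real" where
  "edge_norm j g = L2_norm {0..1} (\<lambda>t. g (on_edge j t))"

lemma bd_L2_iff: "bd_L2 n v g \<longleftrightarrow> (\<forall>j<n. L2_on {0..1} (\<lambda>t. g (on_edge j t)))"
  by (simp add: bd_L2_def on_edge_def)

lemma edge_integral_eq: "edge_integral n v j g = edge_length n v j * (\<integral>t. g (on_edge j t) \<partial>lebesgue_on {0..1})"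
  by (simp add: edge_integral_def on_edge_def)

lemma bd_L2_norm_eq: "bd_L2_norm n v g = sqrt (\<Sum>j<n. edge_length n v j * (edge_norm j g)\<^sup>2)"
  by (simp add: bd_L2_norm_def edge_integral_eq edge_norm_def L2_norm_power2)

lemma bd_L2_norm_power2: "(bd_L2_norm n v g)\<^sup>2 = (\<Sum>j<n. edge_length n v j * (edge_norm j g)\<^sup>2)"
  unfolding bd_L2_norm_eq
  by (intro real_sqrt_pow2 sum_nonneg mult_nonneg_nonneg) (simp_all add: edge_length_def)

lemma edge_norm_le: "j < n \<Longrightarrow> edge_norm j g \<le> bd_L2_norm n v g / sqrt (edge_length n v j)"
proof -
  assume j: "j < n"
  have "edge_length n v j * (edge_norm j g)\<^sup>2 \<le> (bd_L2_norm n v g)\<^sup>2"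
    unfolding bd_L2_norm_power2 using j
    by (intro member_le_sum[of j "{..<n}" "\<lambda>j. edge_length n v j * (edge_norm j g)\<^sup>2"])
      (auto simp: edge_length_def)
  then have "(sqrt (edge_length n v j) * edge_norm j g)\<^sup>2 \<le> (bd_L2_norm n v g)\<^sup>2"
    by (simp add: power_mult_distrib edge_length_def)
  then have "sqrt (edge_length n v j) * edge_norm j g \<le> bd_L2_norm n v g"
    by (rule power2_le_imp_le) (auto simp: bd_L2_norm_eq intro!: sum_nonneg simp: edge_length_def)
  then show ?thesis using edge_length_pos[OF j] by (simp add: pos_le_divide_eq mult.commute)
qed

lemma edge_continuous: "j < n \<Longrightarrow> continuous_on T g \<Longrightarrow> continuous_on {0..1} (\<lambda>t. g (on_edge j t))"
  by (rule continuous_on_compose2[of T g])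
    (auto simp: on_edge_eq[abs_def] on_edge_in[unfolded on_edge_eq] intro!: continuous_intros)

lemma edge_L2: "j < n \<Longrightarrow> continuous_on T g \<Longrightarrow> L2_on {0..1} (\<lambda>t. g (on_edge j t))"
  for g :: "real^2 \<Rightarrow> real"
  using L2_continuous[OF compact_Icc edge_continuous] .

text \<open>The trace inequality comes from the divergence theorem for the field \<open>u\<^sup>2 (x - z)\<close> with \<open>z\<close> in the
  interior, whose normal component on an edge is \<open>u\<^sup>2\<close> times a positive constant.\<close>

lemma C1_edge_identity:
  assumes u: "C1_on T u"
  shows "(\<Sum>j<n. cross2 (side j) (z - v j) * (edge_norm j u)\<^sup>2) =
    (\<integral>x. 2 * (u x)\<^sup>2 + 2 * (u x * (grad_within T u x \<bullet> (x - z))) \<partial>lebesgue_on T)"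
proof -
  let ?D = "grad_within T u"
  note uc = C1_continuous[OF u] C1_continuous_grad[OF u]
  \<comment> \<open>The gradient of \<open>(u x)\<^sup>2 * (x - z) $ i\<close>; the sum over
    \<open>i\<close> of its \<open>i\<close>-th components is the divergence of the field.\<close>
  define G where "G i x = (2 * u x * (x - z) $ i) *\<^sub>R ?D x + (u x)\<^sup>2 *\<^sub>R axis i 1" for i :: 2 and x
  have Gc: "continuous_on T (G i)" for i
    unfolding G_def using uc by (intro continuous_intros)
  have Gi: "(\<integral>x. G i x $ i \<partial>lebesgue_on T) =
      (\<Sum>j<n. edge_normal n v j $ i * edge_integral n v j (\<lambda>x. (u x)\<^sup>2 * (x - z) $ i))" for i
  proof (rule gauss[OF _ Gc])
    fix x assume x: "x \<in> T"
    have 1: "((\<lambda>x. (u x)\<^sup>2) has_derivative (\<lambda>h. 2 * (?D x \<bullet> h) * u x)) (at x within T)"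
      using has_derivative_power[OF C1_has_derivative[OF u x], of 2] by (simp add: mult_ac)
    have 2: "((\<lambda>x. (x - z) $ i) has_derivative (\<lambda>h. h $ i)) (at x within T)"
      using has_derivative_diff[OF bounded_linear_imp_has_derivative[OF bounded_linear_vec_nth[of i]] has_derivative_const[of "z $ i"]]
      by simp
    show "((\<lambda>x. (u x)\<^sup>2 * (x - z) $ i) has_derivative (\<lambda>h. G i x \<bullet> h)) (at x within T)"
      using has_derivative_mult[OF 1 2]
      by (simp add: G_def inner_add_left inner_commute[of "axis i 1"] inner_axis algebra_simps)
  qed
  have "(\<integral>x. 2 * (u x)\<^sup>2 + 2 * (u x * (?D x \<bullet> (x - z))) \<partial>lebesgue_on T) = (\<integral>x. (\<Sum>i\<in>UNIV. G i x $ i) \<partial>lebesgue_on T)"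
    by (intro Bochner_Integration.integral_cong refl)
      (simp add: G_def inner_vec_def sum_2 axis_def algebra_simps)
  also have "\<dots> = (\<Sum>i\<in>UNIV. \<integral>x. G i x $ i \<partial>lebesgue_on T)"
    using Gc by (intro Bochner_Integration.integral_sum L2_integrable[OF lmeasurable] L2_continuous[OF compact] continuous_intros)
  also have "\<dots> = (\<Sum>j<n. \<Sum>i\<in>UNIV. edge_normal n v j $ i * edge_integral n v j (\<lambda>x. (u x)\<^sup>2 * (x - z) $ i))"
    unfolding Gi by (rule sum.swap)
  also have "\<dots> = (\<Sum>j<n. cross2 (side j) (z - v j) * (edge_norm j u)\<^sup>2)"
  proof (rule sum.cong[OF refl])
    fix j assume "j \<in> {..<n}"
    then have j: "j < n" by simp
    let ?I = "lebesgue_on {0..1::real}"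
    have L: "L2_on {0..1} (\<lambda>t. u (on_edge j t))" by (rule edge_L2[OF j uc(1)])
    have int: "integrable ?I (\<lambda>t. edge_normal n v j $ i * ((u (on_edge j t))\<^sup>2 * (on_edge j t - z) $ i))" for i
    proof -
      have "continuous_on T (\<lambda>x. (u x)\<^sup>2 * (x - z) $ i)" using uc(1) by (intro continuous_intros)
      then show ?thesis
        by (intro integrable_mult_right L2_integrable[OF lmeasurable_compact[OF compact_Icc] edge_L2[OF j]])
    qed
    have "(\<Sum>i\<in>UNIV. edge_normal n v j $ i * edge_integral n v j (\<lambda>x. (u x)\<^sup>2 * (x - z) $ i))
        = edge_length n v j * (\<integral>t. (\<Sum>i\<in>UNIV. edge_normal n v j $ i * ((u (on_edge j t))\<^sup>2 * (on_edge j t - z) $ i)) \<partial>?I)"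
      using int by (simp add: edge_integral_eq sum_distrib_left mult_ac)
    also have "\<dots> = edge_length n v j * (\<integral>t. (u (on_edge j t))\<^sup>2 * ((on_edge j t - z) \<bullet> edge_normal n v j) \<partial>?I)"
      by (simp add: inner_vec_def sum_distrib_left mult_ac)
    also have "\<dots> = (\<integral>t. (u (on_edge j t))\<^sup>2 * (edge_length n v j * ((on_edge j t - z) \<bullet> edge_normal n v j)) \<partial>?I)"
      by (simp add: mult.left_commute flip: integral_mult_right_zero)
    also have "\<dots> = (\<integral>t. (u (on_edge j t))\<^sup>2 * cross2 (side j) (z - v j) \<partial>?I)"
      unfolding inner_edge_normal[OF j] by (simp add: on_edge_eq cross2_def algebra_simps)
    also have "\<dots> = cross2 (side j) (z - v j) * (edge_norm j u)\<^sup>2"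
      by (simp add: edge_norm_def L2_norm_power2)
    finally show "(\<Sum>i\<in>UNIV. edge_normal n v j $ i * edge_integral n v j (\<lambda>x. (u x)\<^sup>2 * (x - z) $ i))
        = cross2 (side j) (z - v j) * (edge_norm j u)\<^sup>2" .
  qed
  finally show ?thesis by simp
qed

text \<open>In \<open>C1_edge_identity\<close> every edge weight is positive for an interior
  \<open>z\<close>, so each edge term is bounded by the right-hand side. There the mixed product is
  at most u^2 plus the square of the diameter times the squared gradient, which explains
  \<open>3 + D\<^sup>2\<close>.\<close>

lemma C1_trace_bound:
  obtains K where "0 \<le> K" "\<And>u j. C1_on T u \<Longrightarrow> j < n \<Longrightarrow> edge_norm j u \<le> K * H1_norm T u"
proof -
  obtain z where z: "z \<in> interior T" using interior_nonempty by auto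
  then have zT: "z \<in> T" using interior_subset by blast
  define \<delta> where "\<delta> j = cross2 (side j) (z - v j)" for j
  have \<delta>: "0 < \<delta> j" if "j < n" for j unfolding \<delta>_def using cross2_side_pos[OF that z] .
  define D where "D = diameter T"
  \<comment> \<open>Summing over the edges gives one constant for all of them.\<close>
  define K where "K = sqrt (\<Sum>j<n. (3 + D\<^sup>2) / \<delta> j)"
  have frac: "0 \<le> (3 + D\<^sup>2) / \<delta> j" if "j < n" for j using \<delta>[OF that] by simp
  have K: "0 \<le> K" unfolding K_def by (rule real_sqrt_ge_zero, rule sum_nonneg) (use frac in simp)
  have "edge_norm j u \<le> K * H1_norm T u" if u: "C1_on T u" and j: "j < n" for u j
  proof -
    let ?D = "grad_within T u"
    note uc = C1_continuous[OF u] C1_continuous_grad[OF u]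
    have "\<delta> j * (edge_norm j u)\<^sup>2 \<le> (\<Sum>j<n. \<delta> j * (edge_norm j u)\<^sup>2)"
      using j \<delta> by (intro member_le_sum) (auto simp: less_imp_le)
    also have "\<dots> = (\<integral>x. 2 * (u x)\<^sup>2 + 2 * (u x * (?D x \<bullet> (x - z))) \<partial>lebesgue_on T)"
      unfolding \<delta>_def by (rule C1_edge_identity[OF u])
    also have "\<dots> \<le> (\<integral>x. 3 * (u x)\<^sup>2 + D\<^sup>2 * (norm (?D x))\<^sup>2 \<partial>lebesgue_on T)"
    proof (rule Bochner_Integration.integral_mono)
      show "integrable (lebesgue_on T) (\<lambda>x. 2 * (u x)\<^sup>2 + 2 * (u x * (?D x \<bullet> (x - z))))"
        "integrable (lebesgue_on T) (\<lambda>x. 3 * (u x)\<^sup>2 + D\<^sup>2 * (norm (?D x))\<^sup>2)"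
        using uc by (auto intro!: L2_integrable[OF lmeasurable] L2_continuous[OF compact] continuous_intros)
      fix x assume "x \<in> space (lebesgue_on T)"
      then have "norm (x - z) \<le> D" using norm_diff_le_diameter zT by (simp add: D_def)
      then have "\<bar>?D x \<bullet> (x - z)\<bar> \<le> norm (?D x) * D"
        using Cauchy_Schwarz_ineq2[of "?D x" "x - z"] by (meson mult_left_mono norm_ge_zero order_trans)
      then have "(?D x \<bullet> (x - z))\<^sup>2 \<le> (norm (?D x) * D)\<^sup>2" by (metis abs_ge_zero power2_abs power_mono)
      moreover have "2 * u x * (?D x \<bullet> (x - z)) \<le> (u x)\<^sup>2 + (?D x \<bullet> (x - z))\<^sup>2" by (rule sum_squares_bound)
      ultimately show "2 * (u x)\<^sup>2 + 2 * (u x * (?D x \<bullet> (x - z))) \<le> 3 * (u x)\<^sup>2 + D\<^sup>2 * (norm (?D x))\<^sup>2"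
        by (simp add: power_mult_distrib mult.commute)
    qed
    also have "\<dots> = 3 * (L2_norm T u)\<^sup>2 + D\<^sup>2 * (L2_norm T ?D)\<^sup>2"
      using uc by (simp add: L2_norm_power2 L2_integrable[OF lmeasurable] L2_continuous[OF compact] continuous_intros)
    also have "\<dots> \<le> (3 + D\<^sup>2) * (H1_norm T u)\<^sup>2"
    proof -
      have "(H1_norm T u)\<^sup>2 = (L2_norm T u)\<^sup>2 + (L2_norm T ?D)\<^sup>2"
        using H1_norm_power2[OF C1_weak_grad[OF u]] L2_vec_norm[of T ?D] C1_weak_grad[OF u]
        by (simp add: is_weak_grad_def)
      then show ?thesis by (simp add: distrib_left distrib_right)
    qed
    finally have "(edge_norm j u)\<^sup>2 \<le> (3 + D\<^sup>2) / \<delta> j * (H1_norm T u)\<^sup>2"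
      using \<delta>[OF j] by (simp add: field_simps)
    also have "(3 + D\<^sup>2) / \<delta> j \<le> (\<Sum>j<n. (3 + D\<^sup>2) / \<delta> j)"
      using j frac by (intro member_le_sum) auto
    also have "\<dots> = K\<^sup>2"
      unfolding K_def by (rule real_sqrt_pow2[symmetric], rule sum_nonneg) (use frac in simp)
    finally have "(edge_norm j u)\<^sup>2 \<le> (K * H1_norm T u)\<^sup>2"
      by (simp add: power_mult_distrib mult_right_mono)
    then show ?thesis
      by (rule power2_le_imp_le) (use K in \<open>simp add: H1_norm_def\<close>)
  qed
  then show ?thesis using that K by blast
qed

end

section \<open>Uniqueness and existence of traces, and Gauss' theorem for them\<close>

context polygon
begin

lemma L2_norm_diff_le:
  fixes f g :: "real^2 \<Rightarrow> real"
  assumes "L2_on T f" "L2_on T g"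
  shows "(L2_norm T (\<lambda>x. f x - g x))\<^sup>2 \<le> 2 * (L2_norm T f)\<^sup>2 + 2 * (L2_norm T g)\<^sup>2"
proof -
  have "L2_norm T (\<lambda>x. f x + - 1 * g x) \<le> L2_norm T f + L2_norm T (\<lambda>x. - 1 * g x)"
    by (rule L2_triangle[OF assms(1) L2_cmult[OF assms(2)]])
  also have "L2_norm T (\<lambda>x. - 1 * g x) = L2_norm T g" by (simp add: L2_norm_def)
  finally have "L2_norm T (\<lambda>x. f x - g x) \<le> L2_norm T f + L2_norm T g" by simp
  then have "(L2_norm T (\<lambda>x. f x - g x))\<^sup>2 \<le> (L2_norm T f + L2_norm T g)\<^sup>2"
    by (rule power_mono) (rule L2_norm_nonneg)
  also have "\<dots> \<le> 2 * (L2_norm T f)\<^sup>2 + 2 * (L2_norm T g)\<^sup>2"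
    using sum_squares_bound[of "L2_norm T f" "L2_norm T g"] by (simp add: power2_sum)
  finally show ?thesis .
qed

lemma H1_norm_nonneg: "0 \<le> H1_norm T f"
  by (simp add: H1_norm_def)

text \<open>A substitute for the triangle inequality, obtained from (x - y)^2 at most 2 x^2 + 2 y^2
  in each component; it is only used for limits, where the factor does no harm.\<close>

lemma H1_norm_diff_le:
  assumes f: "is_weak_grad T f F" "L2_on T f" and g: "is_weak_grad T g G" "L2_on T g"
  shows "H1_norm T (\<lambda>x. f x - g x) \<le> 2 * (H1_norm T f + H1_norm T g)"
proof (rule power2_le_imp_le)
  have "(H1_norm T (\<lambda>x. f x - g x))\<^sup>2 = (L2_norm T (\<lambda>x. f x - g x))\<^sup>2
      + (\<Sum>i\<in>UNIV. (L2_norm T (\<lambda>x. F x $ i - G x $ i))\<^sup>2)"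
    using H1_norm_power2[OF weak_grad_diff[OF f g]] by simp
  also have "\<dots> \<le> (2 * (L2_norm T f)\<^sup>2 + 2 * (L2_norm T g)\<^sup>2)
      + (\<Sum>i\<in>UNIV. 2 * (L2_norm T (\<lambda>x. F x $ i))\<^sup>2 + 2 * (L2_norm T (\<lambda>x. G x $ i))\<^sup>2)"
    by (intro add_mono sum_mono L2_norm_diff_le f(2) g(2) weak_grad_L2[OF f(1)] weak_grad_L2[OF g(1)])
  also have "\<dots> = 2 * (H1_norm T f)\<^sup>2 + 2 * (H1_norm T g)\<^sup>2"
    by (simp add: H1_norm_power2[OF f(1)] H1_norm_power2[OF g(1)] sum.distrib sum_distrib_left)
  also have "\<dots> \<le> (2 * (H1_norm T f + H1_norm T g))\<^sup>2"
    using H1_norm_nonneg[of f] H1_norm_nonneg[of g] by (simp add: power_mult_distrib power2_sum)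
  finally show "(H1_norm T (\<lambda>x. f x - g x))\<^sup>2 \<le> (2 * (H1_norm T f + H1_norm T g))\<^sup>2" .
qed (simp add: H1_norm_nonneg)

lemma C1_diff: "C1_on T u \<Longrightarrow> C1_on T w \<Longrightarrow> C1_on T (\<lambda>x. u x - w x)"
  using C1_has_derivative C1_continuous_grad
  by (intro C1_onI[of _ "\<lambda>x. grad_within T u x - grad_within T w x"])
    (auto simp: inner_diff_left intro!: has_derivative_diff continuous_on_diff)

lemma C1_const: "C1_on T (\<lambda>x. c)" "x \<in> T \<Longrightarrow> grad_within T (\<lambda>x. c) x = 0"
  using C1_onI[of "\<lambda>x. c" "\<lambda>x. 0"] by auto

lemma C1_affine:
  "C1_on T (\<lambda>x. a \<bullet> x + b)" "x \<in> T \<Longrightarrow> grad_within T (\<lambda>x. a \<bullet> x + b) x = a"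
proof -
  have D: "((\<lambda>x. a \<bullet> x + b) has_derivative (\<lambda>h. a \<bullet> h)) (at x within T)" for x
    by (auto intro!: derivative_eq_intros)
  show "C1_on T (\<lambda>x. a \<bullet> x + b)" by (rule C1_onI(1)[OF D continuous_on_const])
  show "x \<in> T \<Longrightarrow> grad_within T (\<lambda>x. a \<bullet> x + b) x = a" by (rule C1_onI(2)[OF D continuous_on_const])
qed

lemma H1_shift:
  assumes f: "H1_on T f"
  shows "H1_on T (\<lambda>x. f x - c)" "L2_norm T (weak_grad T (\<lambda>x. f x - c)) = L2_norm T (weak_grad T f)"
proof -
  have wg: "is_weak_grad T (\<lambda>x. f x - c) (\<lambda>x. weak_grad T f x - grad_within T (\<lambda>x. c) x)"
    by (rule weak_grad_diff[OF weak_grad[OF f] H1_L2[OF f] C1_weak_grad[OF C1_const(1)] C1_L2[OF C1_const(1)]])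
  show "H1_on T (\<lambda>x. f x - c)"
    by (rule H1_onI[OF L2_diff[OF H1_L2[OF f] C1_L2[OF C1_const(1)]] wg])
  have "L2_norm T (\<lambda>x. (weak_grad T f x - grad_within T (\<lambda>x. c) x) $ i) = L2_norm T (\<lambda>x. weak_grad T f x $ i)" for i
    unfolding L2_norm_def by (intro arg_cong[of _ _ sqrt] Bochner_Integration.integral_cong refl) (simp add: C1_const)
  then have "(L2_norm T (weak_grad T (\<lambda>x. f x - c)))\<^sup>2 = (L2_norm T (weak_grad T f))\<^sup>2"
    using weak_grad_norm[OF wg] weak_grad_norm[OF weak_grad[OF f]] by simp
  then show "L2_norm T (weak_grad T (\<lambda>x. f x - c)) = L2_norm T (weak_grad T f)"
    by (rule power2_eq_imp_eq) (rule L2_norm_nonneg)+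
qed

lemma trace_edge_tendsto:
  assumes "j < n" "(\<lambda>k. bd_L2_norm n v (g k)) \<longlonglongrightarrow> 0"
  shows "(\<lambda>k. edge_norm j (g k)) \<longlonglongrightarrow> 0"
proof (rule tendsto_sandwich[OF _ _ tendsto_const])
  show "(\<lambda>k. bd_L2_norm n v (g k) / sqrt (edge_length n v j)) \<longlonglongrightarrow> 0"
    by (rule tendsto_divide_zero[OF assms(2)])
  show "\<forall>\<^sub>F k in sequentially. edge_norm j (g k) \<le> bd_L2_norm n v (g k) / sqrt (edge_length n v j)"
    using edge_norm_le[OF assms(1)] by simp
qed (simp add: edge_norm_def L2_norm_nonneg)

lemma edge_norm_triangle:
  assumes "L2_on {0..1} (\<lambda>t. f (on_edge j t))" "L2_on {0..1} (\<lambda>t. g (on_edge j t))"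
  shows "edge_norm j (\<lambda>x. f x + g x) \<le> edge_norm j f + edge_norm j g"
  unfolding edge_norm_def by (rule L2_triangle[OF assms])

text \<open>Two approximating sequences of the same \<open>f\<close> differ by C^1 functions that
  tend to 0 in the H1 norm, so by \<open>C1_trace_bound\<close> their difference tends to 0 on each
  edge.\<close>

lemma trace_unique:
  assumes f: "H1_on T f" and g: "is_trace T n v f g" and g': "is_trace T n v f g'" and j: "j < n"
  shows "edge_norm j (\<lambda>x. g x - g' x) = 0"
proof -
  obtain u where u: "\<And>k. C1_on T (u k)" "(\<lambda>k. H1_norm T (\<lambda>x. u k x - f x)) \<longlonglongrightarrow> 0"
      "(\<lambda>k. bd_L2_norm n v (\<lambda>x. u k x - g x)) \<longlonglongrightarrow> 0"
    using g unfolding is_trace_def by blast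
  obtain w where w: "\<And>k. C1_on T (w k)" "(\<lambda>k. H1_norm T (\<lambda>x. w k x - f x)) \<longlonglongrightarrow> 0"
      "(\<lambda>k. bd_L2_norm n v (\<lambda>x. w k x - g' x)) \<longlonglongrightarrow> 0"
    using g' unfolding is_trace_def by blast
  obtain K where K: "0 \<le> K" "\<And>u j. C1_on T u \<Longrightarrow> j < n \<Longrightarrow> edge_norm j u \<le> K * H1_norm T u"
    using C1_trace_bound by blast
  have gL: "L2_on {0..1} (\<lambda>t. g (on_edge j t))" "L2_on {0..1} (\<lambda>t. g' (on_edge j t))"
    using g g' j by (auto simp: is_trace_def bd_L2_iff)
  have uL: "L2_on {0..1} (\<lambda>t. u k (on_edge j t))" "L2_on {0..1} (\<lambda>t. w k (on_edge j t))" for k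
    using edge_L2[OF j C1_continuous] u(1) w(1) by auto
  have bound: "edge_norm j (\<lambda>x. g x - g' x) \<le> edge_norm j (\<lambda>x. u k x - g x) + edge_norm j (\<lambda>x. w k x - g' x)
      + K * (2 * (H1_norm T (\<lambda>x. u k x - f x) + H1_norm T (\<lambda>x. w k x - f x)))" for k
  proof -
    note D = weak_grad_diff[OF C1_weak_grad C1_L2 weak_grad[OF f] H1_L2[OF f]]
    note L = L2_diff[OF C1_L2 H1_L2[OF f]]
    have "edge_norm j (\<lambda>x. u k x - w k x) \<le> K * H1_norm T (\<lambda>x. u k x - w k x)"
      by (rule K(2)[OF C1_diff[OF u(1) w(1)] j])
    also have "H1_norm T (\<lambda>x. u k x - w k x) = H1_norm T (\<lambda>x. (u k x - f x) - (w k x - f x))" by simp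
    also have "K * \<dots> \<le> K * (2 * (H1_norm T (\<lambda>x. u k x - f x) + H1_norm T (\<lambda>x. w k x - f x)))"
      by (intro mult_left_mono H1_norm_diff_le[OF D[OF u(1) u(1)] L[OF u(1)] D[OF w(1) w(1)] L[OF w(1)]] K(1))
    finally have uw: "edge_norm j (\<lambda>x. u k x - w k x)
        \<le> K * (2 * (H1_norm T (\<lambda>x. u k x - f x) + H1_norm T (\<lambda>x. w k x - f x)))" .
    have "edge_norm j (\<lambda>x. g x - g' x) = edge_norm j (\<lambda>x. (g x - u k x) + ((u k x - w k x) + (w k x - g' x)))"
      by simp
    also have "\<dots> \<le> edge_norm j (\<lambda>x. g x - u k x) + (edge_norm j (\<lambda>x. u k x - w k x) + edge_norm j (\<lambda>x. w k x - g' x))"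
      by (intro order_trans[OF edge_norm_triangle] add_left_mono edge_norm_triangle L2_diff L2_add gL uL)
    also have "edge_norm j (\<lambda>x. g x - u k x) = edge_norm j (\<lambda>x. u k x - g x)"
      unfolding edge_norm_def by (rule L2_norm_minus_commute)
    finally show ?thesis using uw by simp
  qed
  have lim: "(\<lambda>k. edge_norm j (\<lambda>x. u k x - g x) + edge_norm j (\<lambda>x. w k x - g' x)
      + K * (2 * (H1_norm T (\<lambda>x. u k x - f x) + H1_norm T (\<lambda>x. w k x - f x)))) \<longlonglongrightarrow> 0 + 0 + K * (2 * (0 + 0))"
    by (intro tendsto_intros trace_edge_tendsto[OF j] u w)
  have "edge_norm j (\<lambda>x. g x - g' x) \<le> 0"
    using LIMSEQ_le_const[OF lim] bound by simp
  then show ?thesis using L2_norm_nonneg by (metis edge_norm_def order_antisym)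
qed

text \<open>A subsequence with errors below (1/2)^m has boundary values whose increments decay
  geometrically, as \<open>L2_complete_pointwise\<close> requires.\<close>

lemma trace_exists:
  assumes f: "H1_on T f" shows "\<exists>g. is_trace T n v f g"
proof -
  obtain u where u: "\<And>k. C1_on T (u k)" "(\<lambda>k. H1_norm T (\<lambda>x. u k x - f x)) \<longlonglongrightarrow> 0"
    using H1_dense_C1[OF f] by blast
  have "\<exists>k. H1_norm T (\<lambda>x. u k x - f x) < (1/2) ^ m" for m
    using order_tendstoD(2)[OF u(2), of "(1/2) ^ m"] by (auto dest!: eventually_happens'[OF sequentially_bot])
  then obtain r where r: "\<And>m. H1_norm T (\<lambda>x. u (r m) x - f x) < (1/2) ^ m" by metis
  define w where "w m = u (r m)" for m
  have w: "C1_on T (w m)" for m by (simp add: w_def u)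
  have wf: "H1_norm T (\<lambda>x. w m x - f x) \<le> (1/2) ^ m" for m using r[of m] by (simp add: w_def)
  obtain K where K: "0 \<le> K" "\<And>u j. C1_on T u \<Longrightarrow> j < n \<Longrightarrow> edge_norm j u \<le> K * H1_norm T u"
    using C1_trace_bound by blast
  \<comment> \<open>A pointwise limit is one function on the plane and thus serves all edges
    simultaneously.\<close>
  define g where "g x = lim (\<lambda>m. w m x)" for x
  have edge: "L2_on {0..1} (\<lambda>t. g (on_edge j t)) \<and> (\<lambda>m. edge_norm j (\<lambda>x. w m x - g x)) \<longlonglongrightarrow> 0" if j: "j < n" for j
  proof -
    have step: "L2_norm {0..1} (\<lambda>t. w (Suc m) (on_edge j t) - w m (on_edge j t)) \<le> 4 * K * (1/2) ^ m" for m
    proof -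
      note D = weak_grad_diff[OF C1_weak_grad[OF w] C1_L2[OF w] weak_grad[OF f] H1_L2[OF f]]
      note L = L2_diff[OF C1_L2[OF w] H1_L2[OF f]]
      have 1: "L2_norm {0..1} (\<lambda>t. w (Suc m) (on_edge j t) - w m (on_edge j t)) \<le> K * H1_norm T (\<lambda>x. w (Suc m) x - w m x)"
        using K(2)[OF C1_diff[OF w w] j, of "Suc m" m] by (simp add: edge_norm_def)
      have "H1_norm T (\<lambda>x. w (Suc m) x - w m x) = H1_norm T (\<lambda>x. (w (Suc m) x - f x) - (w m x - f x))" by simp
      also have "\<dots> \<le> 2 * (H1_norm T (\<lambda>x. w (Suc m) x - f x) + H1_norm T (\<lambda>x. w m x - f x))"
        by (rule H1_norm_diff_le[OF D L D L])
      also have "\<dots> \<le> 4 * (1/2) ^ m"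
      proof -
        have "2 * (x + y) \<le> 4 * p" if "x \<le> p" "y \<le> p" for x y p :: real using that by simp
        moreover have "H1_norm T (\<lambda>x. w (Suc m) x - f x) \<le> (1/2) ^ m"
          by (rule order_trans[OF wf power_decreasing]) simp_all
        ultimately show ?thesis using wf by blast
      qed
      finally have "H1_norm T (\<lambda>x. w (Suc m) x - w m x) \<le> 4 * (1/2) ^ m" .
      from order_trans[OF 1 mult_left_mono[OF this K(1)]] show ?thesis by (simp add: mult_ac)
    qed
    show ?thesis
      using L2_complete_pointwise[OF lmeasurable_compact[OF compact_Icc] edge_L2[OF j C1_continuous[OF w]] step]
      by (simp add: g_def edge_norm_def)
  qed
  have "is_trace T n v f g"
    unfolding is_trace_def
  proof (intro conjI exI[of _ w] allI w)
    show "bd_L2 n v g" using edge by (simp add: bd_L2_iff)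
    show "(\<lambda>k. H1_norm T (\<lambda>x. w k x - f x)) \<longlonglongrightarrow> 0"
    proof (rule tendsto_sandwich[OF _ _ tendsto_const LIMSEQ_power_zero[of "1/2 :: real"]])
      show "\<forall>\<^sub>F k in sequentially. H1_norm T (\<lambda>x. w k x - f x) \<le> (1/2) ^ k" using wf by simp
    qed (simp_all add: H1_norm_nonneg)
    have "(\<lambda>k. sqrt (\<Sum>j<n. edge_length n v j * (edge_norm j (\<lambda>x. w k x - g x))\<^sup>2))
        \<longlonglongrightarrow> sqrt (\<Sum>j<n. edge_length n v j * 0\<^sup>2)"
      using edge by (intro tendsto_intros) auto
    then show "(\<lambda>k. bd_L2_norm n v (\<lambda>x. w k x - g x)) \<longlonglongrightarrow> 0" by (simp add: bd_L2_norm_eq)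
  qed
  then show ?thesis by blast
qed

lemma trace: "H1_on T f \<Longrightarrow> is_trace T n v f (trace_op T n v f)"
  unfolding trace_op_def using someI_ex[OF trace_exists] by blast

lemma trace_L2: "H1_on T f \<Longrightarrow> j < n \<Longrightarrow> L2_on {0..1} (\<lambda>t. trace_op T n v f (on_edge j t))"
  using trace by (simp add: is_trace_def bd_L2_iff)

text \<open>The traces of \<open>f\<close> and of \<open>f - c\<close> are chosen independently, so
  they can only be compared through uniqueness. The trace inequality speaks about the trace of
  \<open>f - c\<close>, the fluxes about the trace of \<open>f\<close> minus
  \<open>c\<close>.\<close>

lemma trace_shift:
  assumes f: "H1_on T f" and j: "j < n"
  shows "edge_norm j (\<lambda>x. trace_op T n v f x - c) = edge_norm j (trace_op T n v (\<lambda>x. f x - c))"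
proof -
  let ?g = "trace_op T n v f" and ?h = "trace_op T n v (\<lambda>x. f x - c)"
  obtain u where u: "\<And>k. C1_on T (u k)" "(\<lambda>k. H1_norm T (\<lambda>x. u k x - f x)) \<longlonglongrightarrow> 0"
      "(\<lambda>k. bd_L2_norm n v (\<lambda>x. u k x - ?g x)) \<longlonglongrightarrow> 0"
    using trace[OF f] unfolding is_trace_def by blast
  have gc: "L2_on {0..1} (\<lambda>t. ?g (on_edge j t) - c)" if "j < n" for j
    by (rule L2_diff[OF trace_L2[OF f that] L2_const[OF lmeasurable_compact[OF compact_Icc]]])
  have "is_trace T n v (\<lambda>x. f x - c) (\<lambda>x. ?g x - c)"
    unfolding is_trace_def
  proof (intro conjI exI[of _ "\<lambda>k x. u k x - c"] allI)
    show "bd_L2 n v (\<lambda>x. ?g x - c)" using gc by (simp add: bd_L2_iff)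
    show "C1_on T (\<lambda>x. u k x - c)" for k by (rule C1_diff[OF u(1) C1_const(1)])
  qed (use u in simp_all)
  then have z0: "edge_norm j (\<lambda>x. (?g x - c) - ?h x) = 0"
    by (rule trace_unique[OF H1_shift(1)[OF f] _ trace[OF H1_shift(1)[OF f]] j])
  then have z1: "edge_norm j (\<lambda>x. ?h x - (?g x - c)) = 0"
    unfolding edge_norm_def by (subst L2_norm_minus_commute)
  have hL: "L2_on {0..1} (\<lambda>t. ?h (on_edge j t))" by (rule trace_L2[OF H1_shift(1)[OF f] j])
  have "edge_norm j (\<lambda>x. ?g x - c) \<le> edge_norm j ?h"
    using edge_norm_triangle[of "\<lambda>x. (?g x - c) - ?h x" j ?h] L2_diff[OF gc[OF j] hL] hL z0 by simp
  moreover have "edge_norm j ?h \<le> edge_norm j (\<lambda>x. ?g x - c)"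
    using edge_norm_triangle[of "\<lambda>x. ?h x - (?g x - c)" j "\<lambda>x. ?g x - c"] L2_diff[OF hL gc[OF j]] gc[OF j] z1 by simp
  ultimately show ?thesis by simp
qed

lemma edge_integral_le:
  assumes "L2_on {0..1} (\<lambda>t. g (on_edge j t))"
  shows "\<bar>edge_integral n v j g\<bar> \<le> edge_length n v j * edge_norm j g"
proof -
  have 1: "L2_norm {0..1::real} (\<lambda>x. 1 :: real) = 1"
    by (simp add: L2_norm_def measure_restrict_space)
  have "\<bar>\<integral>t. g (on_edge j t) * 1 \<partial>lebesgue_on {0..1}\<bar> \<le> edge_norm j g * 1"
    using L2_Cauchy_Schwarz[OF assms L2_const[OF lmeasurable_compact[OF compact_Icc], where c = 1]]
    unfolding edge_norm_def 1 .
  then show ?thesis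
    by (simp add: edge_integral_eq abs_mult edge_length_def mult_left_mono)
qed

lemma edge_integral_diff:
  assumes "L2_on {0..1} (\<lambda>t. f (on_edge j t))" "L2_on {0..1} (\<lambda>t. g (on_edge j t))"
  shows "edge_integral n v j (\<lambda>x. f x - g x) = edge_integral n v j f - edge_integral n v j g"
  using assms L2_integrable[OF lmeasurable_compact[OF compact_Icc]]
  by (simp add: edge_integral_eq right_diff_distrib)

text \<open>Limit of Gauss' theorem along the approximating sequence: Cauchy-Schwarz controls the
  integrals over \<open>T\<close> by the H1 error and those over the edges by the boundary
  error.\<close>

lemma trace_gauss:
  assumes f: "H1_on T f" and G: "is_weak_grad T f G"
  shows "(\<integral>x. G x $ i \<partial>lebesgue_on T) = (\<Sum>j<n. edge_normal n v j $ i * edge_integral n v j (trace_op T n v f))"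
proof -
  let ?g = "trace_op T n v f"
  obtain u where u: "\<And>k. C1_on T (u k)" "(\<lambda>k. H1_norm T (\<lambda>x. u k x - f x)) \<longlonglongrightarrow> 0"
      "(\<lambda>k. bd_L2_norm n v (\<lambda>x. u k x - ?g x)) \<longlonglongrightarrow> 0"
    using trace[OF f] unfolding is_trace_def by blast
  have uT: "(\<integral>x. grad_within T (u k) x $ i \<partial>lebesgue_on T) = (\<Sum>j<n. edge_normal n v j $ i * edge_integral n v j (u k))" for k
    by (rule gauss[OF C1_has_derivative[OF u(1)] C1_continuous_grad[OF u(1)]])
  have L: "(\<lambda>k. \<integral>x. grad_within T (u k) x $ i \<partial>lebesgue_on T) \<longlonglongrightarrow> (\<integral>x. G x $ i \<partial>lebesgue_on T)"
  proof (rule LIM_zero_cancel, rule tendsto_rabs_zero_cancel, rule tendsto_sandwich[OF _ _ tendsto_const])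
    let ?V = "L2_norm T (\<lambda>x. 1 :: real)"
    show "(\<lambda>k. H1_norm T (\<lambda>x. u k x - f x) * ?V) \<longlonglongrightarrow> 0" by (rule tendsto_mult_left_zero[OF u(2)])
    have "\<bar>(\<integral>x. grad_within T (u k) x $ i \<partial>lebesgue_on T) - (\<integral>x. G x $ i \<partial>lebesgue_on T)\<bar> \<le> H1_norm T (\<lambda>x. u k x - f x) * ?V" for k
    proof -
      let ?d = "\<lambda>x. grad_within T (u k) x $ i - G x $ i"
      have gu: "L2_on T (\<lambda>x. grad_within T (u k) x $ i)" by (rule weak_grad_L2[OF C1_weak_grad[OF u(1)]])
      have gG: "L2_on T (\<lambda>x. G x $ i)" by (rule weak_grad_L2[OF G])
      have "(\<integral>x. grad_within T (u k) x $ i \<partial>lebesgue_on T) - (\<integral>x. G x $ i \<partial>lebesgue_on T) = (\<integral>x. ?d x * 1 \<partial>lebesgue_on T)"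
        using L2_integrable[OF lmeasurable gu] L2_integrable[OF lmeasurable gG] by simp
      also have "\<bar>\<dots>\<bar> \<le> L2_norm T ?d * ?V"
        by (rule L2_Cauchy_Schwarz[OF L2_diff[OF gu gG] L2_const[OF lmeasurable]])
      also have "\<dots> \<le> H1_norm T (\<lambda>x. u k x - f x) * ?V"
      proof (rule mult_right_mono[OF _ L2_norm_nonneg], rule power2_le_imp_le)
        have "(L2_norm T ?d)\<^sup>2 \<le> (\<Sum>i\<in>UNIV. (L2_norm T (\<lambda>x. (grad_within T (u k) x - G x) $ i))\<^sup>2)"
          using member_le_sum[of i UNIV "\<lambda>i. (L2_norm T (\<lambda>x. (grad_within T (u k) x - G x) $ i))\<^sup>2"] by simp
        also have "\<dots> \<le> (H1_norm T (\<lambda>x. u k x - f x))\<^sup>2"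
          using H1_norm_power2[OF weak_grad_diff[OF C1_weak_grad[OF u(1)] C1_L2[OF u(1)] G H1_L2[OF f]], of k] by simp
        finally show "(L2_norm T ?d)\<^sup>2 \<le> (H1_norm T (\<lambda>x. u k x - f x))\<^sup>2" .
      qed (rule H1_norm_nonneg)
      finally show ?thesis .
    qed
    then show "\<forall>\<^sub>F k in sequentially. \<bar>(\<integral>x. grad_within T (u k) x $ i \<partial>lebesgue_on T) - (\<integral>x. G x $ i \<partial>lebesgue_on T)\<bar> \<le> H1_norm T (\<lambda>x. u k x - f x) * ?V"
      by simp
  qed simp
  have R: "(\<lambda>k. edge_integral n v j (u k)) \<longlonglongrightarrow> edge_integral n v j ?g" if j: "j < n" for j
  proof (rule LIM_zero_cancel, rule tendsto_rabs_zero_cancel, rule tendsto_sandwich[OF _ _ tendsto_const])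
    show "(\<lambda>k. edge_length n v j * edge_norm j (\<lambda>x. u k x - ?g x)) \<longlonglongrightarrow> 0"
      by (rule tendsto_mult_right_zero[OF trace_edge_tendsto[OF j u(3)]])
    have "\<bar>edge_integral n v j (u k) - edge_integral n v j ?g\<bar> \<le> edge_length n v j * edge_norm j (\<lambda>x. u k x - ?g x)" for k
      using edge_integral_le[OF L2_diff[OF edge_L2[OF j C1_continuous[OF u(1)]] trace_L2[OF f j]]]
        edge_integral_diff[OF edge_L2[OF j C1_continuous[OF u(1)]] trace_L2[OF f j]] by simp
    then show "\<forall>\<^sub>F k in sequentially. \<bar>edge_integral n v j (u k) - edge_integral n v j ?g\<bar> \<le> edge_length n v j * edge_norm j (\<lambda>x. u k x - ?g x)"
      by simp
  qed simp
  have "(\<lambda>k. \<Sum>j<n. edge_normal n v j $ i * edge_integral n v j (u k))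
      \<longlonglongrightarrow> (\<Sum>j<n. edge_normal n v j $ i * edge_integral n v j ?g)"
    using R by (intro tendsto_intros) auto
  then show ?thesis using L LIMSEQ_unique unfolding uT by blast
qed

end

section \<open>The interpolation operator\<close>

locale barycentric_polygon = polygon +
  fixes lam :: "nat \<Rightarrow> real^2 \<Rightarrow> real" and xs :: "real^2"
  assumes barycentric: "barycentric_coords T n v lam" and center: "xs \<in> interior T"
begin

lemma lam_C1: "i < n \<Longrightarrow> C1_on T (lam i)"
  and lam_vertex: "i < n \<Longrightarrow> j < n \<Longrightarrow> lam i (v j) = (if i = j then 1 else 0)"
  and lam_edge: "i < n \<Longrightarrow> j < n \<Longrightarrow> \<exists>a b. \<forall>x\<in>edge n v j. lam i x = a \<bullet> x + b"
  and lam_affine: "x \<in> T \<Longrightarrow> (\<Sum>i<n. (a \<bullet> v i + b) * lam i x) = a \<bullet> x + b"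
  using barycentric by (auto simp: barycentric_coords_def)

abbreviation nxt :: "nat \<Rightarrow> nat" where "nxt j \<equiv> Suc j mod n"

lemma nxt: "nxt j < n" using n_pos by simp

text \<open>The length of edge \<open>j\<close> times the distance from \<open>xs\<close> to its
  line, that is, twice the area of the triangle spanned by the edge and \<open>xs\<close>.\<close>

definition height :: "nat \<Rightarrow> real" where "height j = cross2 (side j) (xs - v j)"

lemma height_pos: "j < n \<Longrightarrow> 0 < height j"
  unfolding height_def using cross2_side_pos center by blast

text \<open>Differentiation of the identity by which the coordinates reproduce affine functions;
  \<open>derivative_unique\<close> covers boundary points.\<close>

lemma sum_grad_affine:
  assumes x: "x \<in> T"
  shows "(\<Sum>i<n. (a \<bullet> v i + b) *\<^sub>R grad_within T (lam i) x) = a"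
proof -
  let ?G = "\<Sum>i<n. (a \<bullet> v i + b) *\<^sub>R grad_within T (lam i) x"
  have "((\<lambda>y. \<Sum>i<n. (a \<bullet> v i + b) * lam i y) has_derivative
      (\<lambda>h. \<Sum>i<n. (a \<bullet> v i + b) * (grad_within T (lam i) x \<bullet> h))) (at x within T)"
    by (intro has_derivative_sum has_derivative_mult_right C1_has_derivative lam_C1 x) simp
  then have "((\<lambda>y. \<Sum>i<n. (a \<bullet> v i + b) * lam i y) has_derivative (\<lambda>h. ?G \<bullet> h)) (at x within T)"
    by (simp add: inner_sum_left)
  then have 1: "((\<lambda>y. a \<bullet> y + b) has_derivative (\<lambda>h. ?G \<bullet> h)) (at x within T)"
    by (rule has_derivative_transform[OF x, rotated]) (simp add: lam_affine)
  have 2: "((\<lambda>y. a \<bullet> y + b) has_derivative (\<lambda>h. a \<bullet> h)) (at x within T)"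
    by (auto intro!: derivative_eq_intros)
  have "?G \<bullet> h = a \<bullet> h" for h by (rule fun_cong[OF derivative_unique[OF x 1 2]])
  then show ?thesis using vector_eq_rdot[of ?G a] by blast
qed

lemma curl_eq: "curl_within T f x = vector [- (grad_within T f x $ 2), grad_within T f x $ 1]"
  by (simp add: curl_within_def)

text \<open>Used in two ways: affine functions yield all constant fields, and the constant function
  1 yields the only linear relation among the curls that matters.\<close>

lemma sum_curl_affine:
  assumes "x \<in> T"
  shows "(\<Sum>i<n. (a \<bullet> v i + b) *\<^sub>R curl_within T (lam i) x) = vector [- (a $ 2), a $ 1]"
proof -
  have "(\<Sum>i<n. (a \<bullet> v i + b) *\<^sub>R grad_within T (lam i) x) $ k = a $ k" for k
    using sum_grad_affine[OF assms, of a b] by simp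
  from this[of 1] this[of 2] show ?thesis
    by (simp add: vec_eq_iff forall_2 curl_eq sum_negf)
qed

text \<open>Along the edge \<open>lam i\<close> is affine, so its tangential derivative is the
  difference of its values at the two ends. The one-dimensional derivative on [0, 1] is unique at
  the end points too, so the vertices are included.\<close>

lemma grad_lam_side:
  assumes i: "i < n" and j: "j < n" and x: "x \<in> edge n v j"
  shows "grad_within T (lam i) x \<bullet> side j = (if i = nxt j then 1 else 0) - (if i = j then 1 else 0)"
proof -
  obtain a b where ab: "\<And>y. y \<in> edge n v j \<Longrightarrow> lam i y = a \<bullet> y + b" using lam_edge[OF i j] by blast
  obtain t where t: "0 \<le> t" "t \<le> 1" "x = on_edge j t" using edge_onE[OF x] by blast
  have xT: "x \<in> T" using x edge_subset[OF j] by blast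
  have sub: "on_edge j ` {0..1} \<subseteq> T" using on_edge_in[OF j] by auto
  have e: "(on_edge j has_derivative (\<lambda>s. s *\<^sub>R side j)) (at t within {0..1})"
    unfolding on_edge_eq[abs_def] by (auto intro!: derivative_eq_intros)
  have "((\<lambda>s. lam i (on_edge j s)) has_derivative (\<lambda>s. grad_within T (lam i) x \<bullet> (s *\<^sub>R side j))) (at t within {0..1})"
    using has_derivative_in_compose[OF e has_derivative_subset[OF C1_has_derivative[OF lam_C1[OF i] xT] sub, unfolded t(3)]]
    by (simp add: t(3))
  moreover have "((\<lambda>s. lam i (on_edge j s)) has_derivative (\<lambda>s. s * (a \<bullet> side j))) (at t within {0..1})"
  proof (rule has_derivative_transform)
    show "lam i (on_edge j s) = a \<bullet> (v j + s *\<^sub>R side j) + b" if "s \<in> {0..1}" for s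
      using ab[OF on_edge_edge] that by (simp add: on_edge_eq)
    show "((\<lambda>s. a \<bullet> (v j + s *\<^sub>R side j) + b) has_derivative (\<lambda>s. s * (a \<bullet> side j))) (at t within {0..1})"
      by (auto intro!: derivative_eq_intros)
  qed (use t in simp)
  ultimately have "(\<lambda>s. grad_within T (lam i) x \<bullet> (s *\<^sub>R side j)) = (\<lambda>s. s * (a \<bullet> side j))"
    using frechet_derivative_unique_within_closed_interval[of 0 "1::real" t "\<lambda>s. lam i (on_edge j s)"] t
    by (simp add: cbox_interval)
  from fun_cong[OF this, of 1] have "grad_within T (lam i) x \<bullet> side j = a \<bullet> side j" by simp
  also have "\<dots> = lam i (next_vertex n v j) - lam i (v j)"
    using ab[of "next_vertex n v j"] ab[of "v j"] by (simp add: edge_def side_def inner_diff_right)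
  finally show ?thesis
    using lam_vertex[OF i nxt] lam_vertex[OF i j] by (simp add: next_vertex_def)
qed

section \<open>Normal components, unisolvence and the coefficients of the interpolant\<close>

definition field :: "(nat \<Rightarrow> real) \<Rightarrow> real \<Rightarrow> real^2 \<Rightarrow> real^2" where
  "field a b x = (\<Sum>i<n. a i *\<^sub>R curl_within T (lam i) x) + b *\<^sub>R (x - xs)"

lemma chi_space_eq: "chi_space T n lam xs = {p. \<exists>a b. p = restrict (field a b) T}"
  by (simp add: chi_space_def field_def[abs_def])

text \<open>The normal component of a curl is minus the tangential derivative, given by
  \<open>grad_lam_side\<close>; that of \<open>x - xs\<close> is constant along the edge since
  moving along the edge does not change the cross product with its side.\<close>

lemma field_normal:
  assumes j: "j < n" and x: "x \<in> edge n v j"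
  shows "edge_length n v j * (field a b x \<bullet> edge_normal n v j) = a j - a (nxt j) + b * height j"
proof -
  have curl: "cross2 (curl_within T (lam i) x) (side j) = - (grad_within T (lam i) x \<bullet> side j)" for i
    by (simp add: cross2_def curl_eq inner_vec_def sum_2)
  have x_side: "cross2 (x - xs) (side j) = height j"
  proof -
    obtain t where "x = on_edge j t" using edge_onE[OF x] by blast
    then show ?thesis by (simp add: height_def on_edge_eq cross2_def algebra_simps)
  qed
  have "edge_length n v j * (field a b x \<bullet> edge_normal n v j) = cross2 (field a b x) (side j)"
    by (rule inner_edge_normal[OF j])
  also have "\<dots> = cross2 (\<Sum>i<n. a i *\<^sub>R curl_within T (lam i) x) (side j) + b * cross2 (x - xs) (side j)"
    by (simp add: field_def cross2_def algebra_simps)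
  also have "cross2 (\<Sum>i<n. a i *\<^sub>R curl_within T (lam i) x) (side j)
      = (\<Sum>i<n. a i * cross2 (curl_within T (lam i) x) (side j))"
    by (simp add: cross2_def sum_distrib_right right_diff_distrib sum_subtractf mult.assoc)
  also have "(\<Sum>i<n. a i * cross2 (curl_within T (lam i) x) (side j))
      = (\<Sum>i<n. (if i = j then a i else 0) - (if i = nxt j then a i else 0))"
    by (intro sum.cong refl) (use grad_lam_side[OF _ j x] in \<open>simp add: curl right_diff_distrib\<close>)
  also have "\<dots> = a j - a (nxt j)"
    using j nxt by (simp add: sum_subtractf)
  finally show ?thesis using x_side by simp
qed

lemma sum_nxt: "(\<Sum>j<n. a (nxt j)) = (\<Sum>j<n. a j)" for a :: "nat \<Rightarrow> real"
proof -
  obtain m where m: "n = Suc m" using n_pos gr0_implies_Suc by blast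
  have "(\<Sum>j<n. a (nxt j)) = (\<Sum>j<m. a (nxt j)) + a (nxt m)" by (simp add: m)
  also have "(\<Sum>j<m. a (nxt j)) = (\<Sum>j<m. a (Suc j))" by (intro sum.cong) (auto simp: m)
  also have "\<dots> + a (nxt m) = (\<Sum>j<n. a j)" by (simp add: m sum.lessThan_Suc_shift del: sum.lessThan_Suc)
  finally show ?thesis .
qed

lemma sum_height_pos: "0 < (\<Sum>j<n. height j)"
  using height_pos n_pos by (intro sum_pos) auto

text \<open>\<open>C1_edge_identity\<close> for the function 1: its right-hand side is the integral
  of the divergence 2 of \<open>x - xs\<close>.\<close>

lemma sum_height: "(\<Sum>j<n. height j) = 2 * measure lebesgue T"
proof -
  have e: "edge_norm j (\<lambda>x. 1) = 1" for j
    by (simp add: edge_norm_def L2_norm_def measure_restrict_space)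
  have "(\<Sum>j<n. height j) = (\<integral>x. 2 * (1::real)\<^sup>2 + 2 * (1 * (grad_within T (\<lambda>x. 1) x \<bullet> (x - xs))) \<partial>lebesgue_on T)"
    using C1_edge_identity[OF C1_const(1)[of 1], of xs] by (simp add: height_def e)
  also have "\<dots> = (\<integral>x. 2 \<partial>lebesgue_on T)"
    by (intro Bochner_Integration.integral_cong refl) (simp add: C1_const)
  also have "\<dots> = 2 * measure lebesgue T"
    using lmeasurable by (simp add: measure_restrict_space)
  finally show ?thesis .
qed

text \<open>In the sum over all edges the cyclic differences cancel, which fixes \<open>b\<close>
  because the total height is positive. Then the difference of the \<open>a\<close>-coefficients is
  the same at all vertices.\<close>

lemma field_unique:
  assumes eq: "\<And>j x. j < n \<Longrightarrow> x \<in> edge n v j \<Longrightarrow> field a b x \<bullet> edge_normal n v j = field a' b' x \<bullet> edge_normal n v j"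
    and x: "x \<in> T"
  shows "field a b x = field a' b' x"
proof -
  define d where "d j = a j - a' j" for j
  have step: "d j - d (nxt j) + (b - b') * height j = 0" if j: "j < n" for j
  proof -
    have v: "v j \<in> edge n v j" by (simp add: edge_def)
    show ?thesis
      using field_normal[OF j v, of a b] field_normal[OF j v, of a' b'] eq[OF j v]
      by (simp add: d_def algebra_simps)
  qed
  have "(\<Sum>j<n. d j - d (nxt j) + (b - b') * height j) = 0" using step by simp
  then have "(b - b') * (\<Sum>j<n. height j) = 0"
    using sum_nxt[of d] by (simp add: sum.distrib sum_subtractf sum_distrib_left)
  then have b: "b = b'" using sum_height_pos by simp
  have d0: "d j = d 0" if "j < n" for j
    using that
  proof (induction j)
    case (Suc j)
    then show ?case using step[of j] b by simp
  qed simp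
  have a_eq: "a i *\<^sub>R curl_within T (lam i) x = a' i *\<^sub>R curl_within T (lam i) x + d 0 *\<^sub>R ((0 \<bullet> v i + 1) *\<^sub>R curl_within T (lam i) x)"
    if "i < n" for i
    unfolding d0[OF that, symmetric] by (simp add: d_def scaleR_add_left[symmetric])
  have "(\<Sum>i<n. a i *\<^sub>R curl_within T (lam i) x) = (\<Sum>i<n. a' i *\<^sub>R curl_within T (lam i) x)
      + d 0 *\<^sub>R (\<Sum>i<n. (0 \<bullet> v i + 1) *\<^sub>R curl_within T (lam i) x)"
    unfolding scaleR_sum_right sum.distrib[symmetric] by (rule sum.cong[OF refl a_eq]) simp
  \<comment> \<open>The coefficients are the vertex values of the constant function 1, whose curl
    vanishes.\<close>
  also have "(\<Sum>i<n. (0 \<bullet> v i + 1) *\<^sub>R curl_within T (lam i) x) = 0"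
    unfolding sum_curl_affine[OF x] by (simp add: vec_eq_iff forall_2)
  finally show ?thesis using b by (simp add: field_def)
qed

text \<open>Each \<open>a j\<close> is minus a partial sum of the recursion, starting from 0. The
  value of \<open>b\<close> is chosen so that the full sum vanishes; hence \<open>a n = a 0\<close>
  and the recursion closes up at the last edge. In the bound, the sum of the
  \<open>\<bar>\<gamma> j\<bar>\<close> occurs once directly and once through
  \<open>\<bar>b * H\<bar>\<close>.\<close>

lemma field_solve:
  fixes \<gamma> :: "nat \<Rightarrow> real"
  obtains a b where "\<And>j. j < n \<Longrightarrow> a j - a (nxt j) + b * height j = \<gamma> j"
    "b * (2 * measure lebesgue T) = (\<Sum>j<n. \<gamma> j)" "\<And>i. i < n \<Longrightarrow> \<bar>a i\<bar> \<le> 2 * (\<Sum>j<n. \<bar>\<gamma> j\<bar>)"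
proof -
  define H where "H = (\<Sum>j<n. height j)"
  define b where "b = (\<Sum>j<n. \<gamma> j) / H"
  define a where "a j = - (\<Sum>k<j. \<gamma> k - b * height k)" for j
  have H: "0 < H" unfolding H_def by (rule sum_height_pos)
  have bH: "b * H = (\<Sum>j<n. \<gamma> j)" using H by (simp add: b_def)
  have an: "a n = 0"
    using bH by (simp add: a_def H_def sum_subtractf sum_distrib_left)
  have an': "a (nxt j) = a (Suc j)" if "j < n" for j
    using that an by (cases "Suc j = n") (auto simp: a_def)
  have "a j - a (nxt j) + b * height j = \<gamma> j" if "j < n" for j
    unfolding an'[OF that] by (simp add: a_def)
  moreover have "b * (2 * measure lebesgue T) = (\<Sum>j<n. \<gamma> j)"
    using bH sum_height by (simp add: H_def)
  moreover have "\<bar>a i\<bar> \<le> 2 * (\<Sum>j<n. \<bar>\<gamma> j\<bar>)" if i: "i < n" for i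
  proof -
    have "\<bar>a i\<bar> \<le> (\<Sum>k<i. \<bar>\<gamma> k - b * height k\<bar>)" by (simp add: a_def sum_abs)
    also have "\<dots> \<le> (\<Sum>k<n. \<bar>\<gamma> k - b * height k\<bar>)" using i by (intro sum_mono2) auto
    also have "\<dots> \<le> (\<Sum>k<n. \<bar>\<gamma> k\<bar> + \<bar>b\<bar> * height k)"
    proof (rule sum_mono)
      fix k assume "k \<in> {..<n}"
      then have "\<bar>b * height k\<bar> = \<bar>b\<bar> * height k" using height_pos[of k] by (simp add: abs_mult)
      then show "\<bar>\<gamma> k - b * height k\<bar> \<le> \<bar>\<gamma> k\<bar> + \<bar>b\<bar> * height k" by linarith
    qed
    also have "\<dots> = (\<Sum>k<n. \<bar>\<gamma> k\<bar>) + \<bar>b * H\<bar>"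
      unfolding sum.distrib sum_distrib_left[symmetric] H_def[symmetric] using H by (simp add: abs_mult)
    also have "\<bar>b * H\<bar> \<le> (\<Sum>k<n. \<bar>\<gamma> k\<bar>)" unfolding bH by (rule sum_abs)
    finally show ?thesis by simp
  qed
  ultimately show ?thesis using that by blast
qed

text \<open>The flux of q - c through edge \<open>j\<close>, with \<open>c\<close> subtracted from
  the chosen trace of q, because the interpolant is defined by the latter.\<close>

definition flux :: "(real^2 \<Rightarrow> real^2) \<Rightarrow> real^2 \<Rightarrow> nat \<Rightarrow> real" where
  "flux q c j = (\<Sum>i\<in>UNIV. edge_normal n v j $ i * edge_integral n v j (\<lambda>x. trace_op T n v (\<lambda>y. q y $ i) x - c $ i))"

lemma trace_vec_flux:
  assumes q: "H1_vec_on T q" and j: "j < n"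
  shows "edge_integral n v j (\<lambda>y. trace_vec T n v q y \<bullet> edge_normal n v j)
    = flux q c j + edge_length n v j * (c \<bullet> edge_normal n v j)"
proof -
  let ?t = "\<lambda>i. trace_op T n v (\<lambda>y. q y $ i)"
  have tL: "L2_on {0..1} (\<lambda>t. ?t i (on_edge j t))" for i
    using trace_L2[OF _ j] q by (simp add: H1_vec_on_def)
  have ti: "integrable (lebesgue_on {0..1}) (\<lambda>t. ?t i (on_edge j t))" for i
    by (rule L2_integrable[OF lmeasurable_compact[OF compact_Icc] tL])
  have one: "measure (lebesgue_on {0..1}) {0..1::real} = 1" by (simp add: measure_restrict_space)
  have shift: "edge_integral n v j (\<lambda>x. ?t i x - c $ i) = edge_integral n v j (?t i) - edge_length n v j * c $ i" for i
    using ti[of i] by (simp add: edge_integral_eq right_diff_distrib one)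
  have "edge_integral n v j (\<lambda>y. trace_vec T n v q y \<bullet> edge_normal n v j)
      = (\<Sum>i\<in>UNIV. edge_normal n v j $ i * edge_integral n v j (?t i))"
    using ti by (simp add: edge_integral_eq trace_vec_def inner_vec_def sum_distrib_left mult_ac)
  then show ?thesis
    unfolding flux_def shift by (simp add: inner_vec_def sum_distrib_left right_diff_distrib sum_subtractf mult_ac)
qed

text \<open>The coefficients are solved for the fluxes of q - c, and the constant \<open>c\<close>
  is put back as the curl of an affine function, so they are bounded by fluxes that a good choice of
  \<open>c\<close> makes small. \<open>field_unique\<close> justifies the definite
  description.\<close>

lemma interp_eq:
  assumes q: "H1_vec_on T q"
  obtains a b where "\<And>x. x \<in> T \<Longrightarrow> interp T n v lam xs q x = c + field a b x"
    "b * (2 * measure lebesgue T) = (\<Sum>j<n. flux q c j)" "\<And>i. i < n \<Longrightarrow> \<bar>a i\<bar> \<le> 2 * (\<Sum>j<n. \<bar>flux q c j\<bar>)"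
proof -
  obtain a b where ab: "\<And>j. j < n \<Longrightarrow> a j - a (nxt j) + b * height j = flux q c j"
    "b * (2 * measure lebesgue T) = (\<Sum>j<n. flux q c j)" "\<And>i. i < n \<Longrightarrow> \<bar>a i\<bar> \<le> 2 * (\<Sum>j<n. \<bar>flux q c j\<bar>)"
    using field_solve by blast
  \<comment> \<open>The gradient of an affine function whose curl is \<open>c\<close>.\<close>
  define l :: "real^2" where "l = vector [c $ 2, - (c $ 1)]"
  define a' where "a' i = a i + (l \<bullet> v i + 0)" for i
  have field': "field a' b x = c + field a b x" if "x \<in> T" for x
  proof -
    have "(\<Sum>i<n. a' i *\<^sub>R curl_within T (lam i) x)
        = (\<Sum>i<n. a i *\<^sub>R curl_within T (lam i) x) + (\<Sum>i<n. (l \<bullet> v i + 0) *\<^sub>R curl_within T (lam i) x)"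
      by (simp add: a'_def scaleR_add_left sum.distrib)
    also have "(\<Sum>i<n. (l \<bullet> v i + 0) *\<^sub>R curl_within T (lam i) x) = c"
      unfolding sum_curl_affine[OF that] by (simp add: l_def vec_eq_iff forall_2)
    finally show ?thesis by (simp add: field_def)
  qed
  have normal: "field a' b x \<bullet> edge_normal n v j = 1 / edge_length n v j *
      edge_integral n v j (\<lambda>y. trace_vec T n v q y \<bullet> edge_normal n v j)"
    if j: "j < n" and x: "x \<in> edge n v j" for j x
  proof -
    have xT: "x \<in> T" using x edge_subset[OF j] by blast
    have "edge_length n v j * (field a' b x \<bullet> edge_normal n v j)
        = edge_integral n v j (\<lambda>y. trace_vec T n v q y \<bullet> edge_normal n v j)"
      unfolding trace_vec_flux[OF q j, of c] field'[OF xT] inner_add_left distrib_left field_normal[OF j x] ab(1)[OF j]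
      by simp
    then show ?thesis using edge_length_pos[OF j] by (simp add: field_simps)
  qed
  have "interp T n v lam xs q = restrict (field a' b) T"
    unfolding interp_def
  proof (rule the_equality)
    show "restrict (field a' b) T \<in> chi_space T n lam xs \<and> (\<forall>j<n. \<forall>x\<in>edge n v j.
        restrict (field a' b) T x \<bullet> edge_normal n v j = 1 / edge_length n v j *
        edge_integral n v j (\<lambda>y. trace_vec T n v q y \<bullet> edge_normal n v j))"
      using normal edge_subset by (auto simp: chi_space_eq subset_eq)
    fix p assume p: "p \<in> chi_space T n lam xs \<and> (\<forall>j<n. \<forall>x\<in>edge n v j.
        p x \<bullet> edge_normal n v j = 1 / edge_length n v j *
        edge_integral n v j (\<lambda>y. trace_vec T n v q y \<bullet> edge_normal n v j))"
    then obtain a2 b2 where p_eq: "p = restrict (field a2 b2) T" by (auto simp: chi_space_eq)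
    have "field a2 b2 x = field a' b x" if "x \<in> T" for x
    proof (rule field_unique[OF _ that])
      fix j x assume jx: "j < n" "x \<in> edge n v j"
      then have "x \<in> T" using edge_subset by blast
      then have "p x = field a2 b2 x" by (simp add: p_eq)
      moreover have "p x \<bullet> edge_normal n v j = 1 / edge_length n v j *
          edge_integral n v j (\<lambda>y. trace_vec T n v q y \<bullet> edge_normal n v j)"
        using p jx by blast
      ultimately show "field a2 b2 x \<bullet> edge_normal n v j = field a' b x \<bullet> edge_normal n v j"
        unfolding normal[OF jx] by simp
    qed
    then show "p = restrict (field a' b) T" unfolding p_eq by (rule restrict_ext)
  qed
  then show ?thesis using that[of a b] field' ab(2,3) by simp
qed

end

section \<open>The L2 estimate of the interpolation error\<close>

context barycentric_polygon
begin

lemma norm_curl: "norm (curl_within T f x) = norm (grad_within T f x)"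
  by (simp add: curl_eq norm_vec_def L2_set_def sum_2 add.commute)

lemma norm_field_le:
  assumes x: "x \<in> T" and g: "\<And>i. i < n \<Longrightarrow> norm (grad_within T (lam i) x) \<le> D"
    and a: "\<And>i. i < n \<Longrightarrow> \<bar>a i\<bar> \<le> A"
  shows "norm (field a b x) \<le> real n * (A * D) + \<bar>b\<bar> * diameter T"
proof -
  have "norm (field a b x) \<le> (\<Sum>i<n. norm (a i *\<^sub>R curl_within T (lam i) x)) + norm (b *\<^sub>R (x - xs))"
    unfolding field_def by (rule order_trans[OF norm_triangle_ineq add_right_mono[OF norm_sum]])
  also have "\<dots> \<le> (\<Sum>i<n. A * D) + \<bar>b\<bar> * diameter T"
  proof (rule add_mono[OF sum_mono])
    fix i assume "i \<in> {..<n}"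
    then show "norm (a i *\<^sub>R curl_within T (lam i) x) \<le> A * D"
      using mult_mono[OF a[of i] g[of i] order_trans[OF abs_ge_zero a[of i]] norm_ge_zero]
      by (simp add: norm_curl)
  next
    have "xs \<in> T" using center interior_subset by blast
    then show "norm (b *\<^sub>R (x - xs)) \<le> \<bar>b\<bar> * diameter T"
      using norm_diff_le_diameter[OF x] by (simp add: mult_left_mono)
  qed
  finally show ?thesis by simp
qed

lemma abs_edge_normal_le: "j < n \<Longrightarrow> \<bar>edge_normal n v j $ i\<bar> \<le> 1"
proof -
  assume j: "j < n"
  have "norm (vector [side j $ 2, - side j $ 1] :: real^2) = norm (side j)"
    by (simp add: norm_vec_def L2_set_def sum_2 add.commute)
  then have "norm (edge_normal n v j) = 1"
    using edge_length_pos[OF j] by (simp add: edge_normal_eq norm_side)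
  then show ?thesis using component_le_norm_cart[of "edge_normal n v j" i] by simp
qed

text \<open>The leading factor 2 counts the components of the field; components of the unit normal
  are at most 1.\<close>

lemma abs_flux_le:
  assumes q: "H1_vec_on T q" and j: "j < n"
    and B: "\<And>i. bd_L2_norm n v (trace_op T n v (\<lambda>x. q x $ i - c $ i)) \<le> B"
  shows "\<bar>flux q c j\<bar> \<le> 2 * (sqrt (diameter T) * B)"
proof -
  let ?t = "\<lambda>i. trace_op T n v (\<lambda>y. q y $ i)"
  have "\<bar>edge_normal n v j $ i * edge_integral n v j (\<lambda>x. ?t i x - c $ i)\<bar> \<le> sqrt (diameter T) * B" for i
  proof -
    have qi: "H1_on T (\<lambda>y. q y $ i)" using q by (simp add: H1_vec_on_def)
    let ?e = "edge_norm j (trace_op T n v (\<lambda>x. q x $ i - c $ i))" and ?l = "edge_length n v j"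
    have l: "0 < ?l" by (rule edge_length_pos[OF j])
    have "L2_on {0..1} (\<lambda>t. ?t i (on_edge j t) - c $ i)"
      by (rule L2_diff[OF trace_L2[OF qi j] L2_const[OF lmeasurable_compact[OF compact_Icc]]])
    then have "\<bar>edge_integral n v j (\<lambda>x. ?t i x - c $ i)\<bar> \<le> ?l * edge_norm j (\<lambda>x. ?t i x - c $ i)"
      by (rule edge_integral_le)
    \<comment> \<open>One root of the edge length belongs to the boundary norm, where it is absorbed
      by \<open>B\<close>; the other is at most the root of the diameter.\<close>
    also have "\<dots> = sqrt ?l * (sqrt ?l * ?e)" using l by (simp add: trace_shift[OF qi j] mult.assoc[symmetric])
    also have "\<dots> \<le> sqrt (diameter T) * B"
    proof (rule mult_mono)
      show "sqrt ?l \<le> sqrt (diameter T)" using edge_length_le[OF j] by simp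
      show "sqrt ?l * ?e \<le> B"
        using edge_norm_le[OF j, of "trace_op T n v (\<lambda>x. q x $ i - c $ i)"] B[of i] l
        by (simp add: pos_le_divide_eq mult.commute)
    qed (use l diameter_pos in \<open>auto simp: edge_norm_def L2_norm_nonneg\<close>)
    finally have *: "\<bar>edge_integral n v j (\<lambda>x. ?t i x - c $ i)\<bar> \<le> sqrt (diameter T) * B" .
    have "\<bar>edge_normal n v j $ i\<bar> * \<bar>edge_integral n v j (\<lambda>x. ?t i x - c $ i)\<bar> \<le> 1 * (sqrt (diameter T) * B)"
      using * abs_edge_normal_le[OF j, of i] by (intro mult_mono) auto
    then show ?thesis by (simp add: abs_mult)
  qed
  then have "\<bar>flux q c j\<bar> \<le> (\<Sum>i\<in>(UNIV::2 set). sqrt (diameter T) * B)"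
    unfolding flux_def by (intro order_trans[OF sum_abs] sum_mono)
  then show ?thesis by simp
qed

text \<open>With \<open>c\<close> the mean of q, the error is q - c, controlled by the Poincare
  inequality, minus a field that is bounded pointwise by \<open>R\<close> and hence in norm by
  \<open>R\<close> times the root of the area.\<close>

lemma interp_error:
  assumes q: "H1_vec_on T q" and c0: "0 < c0" and reg: "shape_regular T n v lam c0"
  shows "L2_norm T (\<lambda>x. q x - interp T n v lam xs q x)
    \<le> (2 * (c0 + 2 * real n * sqrt (c0 * (c0\<^sup>2 + 1)) * (c0 * sqrt c0 * (4 * real n + 1)))) * diameter T * H1_vec_norm T q"
proof -
  let ?h = "diameter T" and ?m = "measure lebesgue T"
  have h: "0 < ?h" by (rule diameter_pos)
  note reg' = reg[unfolded shape_regular_def Let_def]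
  have m: "inverse c0 * ?h\<^sup>2 \<le> ?m" "?m \<le> c0 * ?h\<^sup>2"
    and grad: "\<And>i x. i < n \<Longrightarrow> x \<in> T \<Longrightarrow> norm (grad_within T (lam i) x) \<le> c0 * inverse ?h"
    and tr: "\<And>\<phi>. H1_on T \<phi> \<Longrightarrow> (bd_L2_norm n v (trace_op T n v \<phi>))\<^sup>2
            \<le> c0 * (inverse ?h * (L2_norm T \<phi>)\<^sup>2 + ?h * (L2_norm T (weak_grad T \<phi>))\<^sup>2)"
    and poin: "\<And>\<phi>. H1_on T \<phi> \<Longrightarrow> L2_norm T (\<lambda>x. \<phi> x - const_proj T \<phi>) \<le> c0 * ?h * H1_norm T \<phi>"
    using reg' by blast+
  define Q where "Q = H1_vec_norm T q"
  define c :: "real^2" where "c = (\<chi> i. const_proj T (\<lambda>x. q x $ i))"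
  \<comment> \<open>From the trace inequality for q - c: the Poincare inequality inserted into its
    L2 term contributes \<open>c0\<^sup>2\<close>, its gradient term contributes 1.\<close>
  define \<kappa> where "\<kappa> = sqrt (c0 * (c0\<^sup>2 + 1))"
  have qi: "H1_on T (\<lambda>x. q x $ i)" for i using q by (simp add: H1_vec_on_def)
  have Q: "0 \<le> Q" and Q2: "Q\<^sup>2 = (\<Sum>i\<in>UNIV. (H1_norm T (\<lambda>x. q x $ i))\<^sup>2)"
    by (simp_all add: Q_def H1_vec_norm_def sum_nonneg)
  have Hi: "(H1_norm T (\<lambda>x. q x $ i))\<^sup>2 \<le> Q\<^sup>2" for i
    unfolding Q2 by (rule member_le_sum) auto
  have \<kappa>: "0 \<le> \<kappa>" "\<kappa>\<^sup>2 = c0 * (c0\<^sup>2 + 1)" using c0 by (simp_all add: \<kappa>_def)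
  have B: "bd_L2_norm n v (trace_op T n v (\<lambda>x. q x $ i - c $ i)) \<le> \<kappa> * (sqrt ?h * Q)" for i
  proof (rule power2_le_imp_le)
    let ?\<phi> = "\<lambda>x. q x $ i"
    have 1: "(L2_norm T (\<lambda>x. ?\<phi> x - c $ i))\<^sup>2 \<le> (c0 * ?h * H1_norm T ?\<phi>)\<^sup>2"
      unfolding c_def using poin[OF qi, of i] by (intro power_mono) (auto simp: L2_norm_nonneg)
    have 2: "(L2_norm T (weak_grad T ?\<phi>))\<^sup>2 \<le> (H1_norm T ?\<phi>)\<^sup>2" by (simp add: H1_norm_def)
    have "(bd_L2_norm n v (trace_op T n v (\<lambda>x. ?\<phi> x - c $ i)))\<^sup>2
        \<le> c0 * (inverse ?h * (L2_norm T (\<lambda>x. ?\<phi> x - c $ i))\<^sup>2 + ?h * (L2_norm T (weak_grad T ?\<phi>))\<^sup>2)"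
      using tr[OF H1_shift(1)[OF qi]] by (simp add: H1_shift(2)[OF qi])
    also have "\<dots> \<le> c0 * (inverse ?h * (c0 * ?h * H1_norm T ?\<phi>)\<^sup>2 + ?h * (H1_norm T ?\<phi>)\<^sup>2)"
      using c0 h 1 2 by (intro mult_left_mono add_mono) auto
    also have "\<dots> = c0 * (c0\<^sup>2 + 1) * ?h * (H1_norm T ?\<phi>)\<^sup>2"
      using h by (simp add: power2_eq_square field_simps)
    also have "\<dots> \<le> c0 * (c0\<^sup>2 + 1) * ?h * Q\<^sup>2"
      using c0 h Hi[of i] by (intro mult_left_mono) auto
    also have "\<dots> = (\<kappa> * (sqrt ?h * Q))\<^sup>2" using h by (simp add: power_mult_distrib \<kappa>(2))
    finally show "(bd_L2_norm n v (trace_op T n v (\<lambda>x. ?\<phi> x - c $ i)))\<^sup>2 \<le> (\<kappa> * (sqrt ?h * Q))\<^sup>2" .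
  qed (use \<kappa> Q h in simp)
  define S where "S = (\<Sum>j<n. \<bar>flux q c j\<bar>)"
  have S0: "0 \<le> S" by (simp add: S_def sum_nonneg)
  have S: "S \<le> 2 * real n * \<kappa> * ?h * Q"
  proof -
    have "S \<le> (\<Sum>j<n. 2 * (sqrt ?h * (\<kappa> * (sqrt ?h * Q))))"
      unfolding S_def using abs_flux_le[OF q _ B] by (intro sum_mono) auto
    also have "\<dots> = 2 * real n * \<kappa> * (sqrt ?h * sqrt ?h) * Q" by simp
    also have "sqrt ?h * sqrt ?h = ?h" using h by simp
    finally show ?thesis .
  qed
  obtain a b where p: "\<And>x. x \<in> T \<Longrightarrow> interp T n v lam xs q x = c + field a b x"
    and b: "b * (2 * ?m) = (\<Sum>j<n. flux q c j)" and a: "\<And>i. i < n \<Longrightarrow> \<bar>a i\<bar> \<le> 2 * S"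
    using interp_eq[OF q, of c] unfolding S_def by blast
  \<comment> \<open>Pointwise bound of the field: \<open>n\<close> curls with coefficients at most 2
    S and gradients at most c0/h, plus the position term from \<open>bh\<close>; the factor
    \<open>4 * real n + 1\<close> leaves some room.\<close>
  define R where "R = c0 * (4 * real n + 1) * S / ?h"
  have mpos: "0 < ?m" using m(1) c0 h by (smt (verit) zero_less_power mult_pos_pos positive_imp_inverse_positive)
  have bh: "\<bar>b\<bar> * ?h \<le> c0 * S / ?h"
  proof -
    have "\<bar>b\<bar> * (2 * ?m) = \<bar>b * (2 * ?m)\<bar>" using mpos by (simp add: abs_mult)
    also have "\<dots> \<le> S" unfolding b S_def by (rule sum_abs)
    finally have "\<bar>b\<bar> * (2 * ?m) \<le> S" .
    moreover have "\<bar>b\<bar> * (inverse c0 * ?h\<^sup>2) \<le> \<bar>b\<bar> * (2 * ?m)"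
      using m(1) mpos by (intro mult_left_mono) auto
    ultimately have "\<bar>b\<bar> * (inverse c0 * ?h\<^sup>2) \<le> S" by simp
    then show ?thesis using c0 h by (simp add: field_simps power2_eq_square)
  qed
  have field_R: "norm (field a b x) \<le> R" if x: "x \<in> T" for x
  proof -
    have "norm (field a b x) \<le> real n * (2 * S * (c0 * inverse ?h)) + \<bar>b\<bar> * ?h"
      by (rule norm_field_le[OF x grad[OF _ x] a])
    also have "\<dots> \<le> real n * (2 * S * (c0 * inverse ?h)) + c0 * S / ?h" using bh by simp
    also have "\<dots> \<le> R" using c0 h S0 by (simp add: R_def field_simps)
    finally show ?thesis .
  qed
  have qc: "L2_on T (\<lambda>x. q x $ i - c $ i)" for i
    by (rule L2_diff[OF H1_L2[OF qi] L2_const[OF lmeasurable]])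
  have qcL: "L2_on T (\<lambda>x. q x - c)" using qc by (intro L2_vecI) simp
  have qc_norm: "(L2_norm T (\<lambda>x. q x - c))\<^sup>2 \<le> (c0 * ?h * Q)\<^sup>2"
  proof -
    have "(L2_norm T (\<lambda>x. q x - c))\<^sup>2 = (\<Sum>i\<in>UNIV. (L2_norm T (\<lambda>x. q x $ i - c $ i))\<^sup>2)"
      using L2_vec_norm[OF qcL] by simp
    also have "\<dots> \<le> (\<Sum>i\<in>UNIV. (c0 * ?h * H1_norm T (\<lambda>x. q x $ i))\<^sup>2)"
      unfolding c_def using poin[OF qi] by (intro sum_mono power_mono) (auto simp: L2_norm_nonneg)
    also have "\<dots> = (c0 * ?h * Q)\<^sup>2" by (simp add: power_mult_distrib Q2 sum_distrib_left)
    finally show ?thesis .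
  qed
  have "(L2_norm T (\<lambda>x. q x - interp T n v lam xs q x))\<^sup>2 \<le> 2 * (L2_norm T (\<lambda>x. q x - c))\<^sup>2 + 2 * R\<^sup>2 * ?m"
  proof -
    have "(L2_norm T (\<lambda>x. q x - interp T n v lam xs q x))\<^sup>2
        = (\<integral>x. (norm (q x - interp T n v lam xs q x))\<^sup>2 \<partial>lebesgue_on T)" by (rule L2_norm_power2)
    also have "\<dots> \<le> (\<integral>x. 2 * (norm (q x - c))\<^sup>2 + 2 * R\<^sup>2 \<partial>lebesgue_on T)"
    \<comment> \<open>This form of monotonicity asks only for a nonnegative integrable
      majorant.\<close>
    proof (rule Bochner_Integration.integral_mono')
      interpret finite_measure "lebesgue_on T" by (rule finite_measure_lebesgue_on[OF lmeasurable])
      show "integrable (lebesgue_on T) (\<lambda>x. 2 * (norm (q x - c))\<^sup>2 + 2 * R\<^sup>2)"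
        using qcL by (simp add: L2_on_def)
      fix x assume "x \<in> space (lebesgue_on T)"
      then have x: "x \<in> T" by simp
      have "norm (q x - interp T n v lam xs q x) = norm ((q x - c) - field a b x)" by (simp add: p[OF x] diff_diff_eq)
      also have "\<dots> \<le> norm (q x - c) + norm (field a b x)" by (rule norm_triangle_ineq4)
      also have "\<dots> \<le> norm (q x - c) + R" using field_R[OF x] by simp
      finally have "(norm (q x - interp T n v lam xs q x))\<^sup>2 \<le> (norm (q x - c) + R)\<^sup>2"
        by (rule power_mono) simp
      also have "\<dots> \<le> 2 * (norm (q x - c))\<^sup>2 + 2 * R\<^sup>2"
        using sum_squares_bound[of "norm (q x - c)" R] by (simp add: power2_sum)
      finally show "(norm (q x - interp T n v lam xs q x))\<^sup>2 \<le> 2 * (norm (q x - c))\<^sup>2 + 2 * R\<^sup>2" .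
    qed simp
    also have "\<dots> = 2 * (L2_norm T (\<lambda>x. q x - c))\<^sup>2 + 2 * R\<^sup>2 * ?m"
    proof -
      interpret finite_measure "lebesgue_on T" by (rule finite_measure_lebesgue_on[OF lmeasurable])
      show ?thesis using qcL lmeasurable by (simp add: L2_on_def L2_norm_power2 measure_restrict_space)
    qed
    finally show ?thesis .
  qed
  also have "\<dots> \<le> 2 * (c0 * ?h * Q)\<^sup>2 + 2 * (c0 * sqrt c0 * (4 * real n + 1) * S)\<^sup>2"
  proof -
    have "R\<^sup>2 * ?m \<le> R\<^sup>2 * (c0 * ?h\<^sup>2)" using m(2) by (rule mult_left_mono) simp
    also have "\<dots> = (c0 * sqrt c0 * (4 * real n + 1) * S)\<^sup>2"
      using c0 h by (simp add: R_def power_mult_distrib power_divide)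
    finally show ?thesis using qc_norm by simp
  qed
  also have "\<dots> \<le> (2 * (c0 * ?h * Q + c0 * sqrt c0 * (4 * real n + 1) * S))\<^sup>2"
  proof -
    have "2 * x\<^sup>2 + 2 * y\<^sup>2 \<le> (2 * (x + y))\<^sup>2" if "0 \<le> x" "0 \<le> y" for x y :: real
      using that by (simp add: power_mult_distrib power2_sum)
    then show ?thesis using c0 h Q S0 by simp
  qed
  finally have "L2_norm T (\<lambda>x. q x - interp T n v lam xs q x) \<le> 2 * (c0 * ?h * Q + c0 * sqrt c0 * (4 * real n + 1) * S)"
    by (rule power2_le_imp_le) (use c0 h Q S0 in simp)
  also have "\<dots> \<le> 2 * (c0 * ?h * Q + c0 * sqrt c0 * (4 * real n + 1) * (2 * real n * \<kappa> * ?h * Q))"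
    using c0 S by (intro mult_left_mono add_left_mono) auto
  also have "\<dots> = (2 * (c0 + 2 * real n * \<kappa> * (c0 * sqrt c0 * (4 * real n + 1)))) * ?h * Q"
    by (simp add: algebra_simps)
  finally show ?thesis unfolding \<kappa>_def Q_def .
qed

section \<open>Weak divergences and the estimate of the divergence error\<close>

lemma weak_div_unique:
  assumes "is_weak_div T q d" "is_weak_div T q d'"
  shows "AE x in lebesgue_on T. d x = d' x"
proof (rule annihilator_unique)
  show "L2_on T d" "L2_on T d'" using assms by (auto simp: is_weak_div_def)
  fix \<psi> assume \<psi>: "\<psi> \<in> test_functions (interior T)"
  have "(\<integral>x. q x \<bullet> (\<chi> i. partial_deriv i \<psi> x) \<partial>lebesgue_on T) = - (\<integral>x. d x * \<psi> x \<partial>lebesgue_on T)"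
    "(\<integral>x. q x \<bullet> (\<chi> i. partial_deriv i \<psi> x) \<partial>lebesgue_on T) = - (\<integral>x. d' x * \<psi> x \<partial>lebesgue_on T)"
    using assms \<psi> unfolding is_weak_div_def by blast+
  then show "(\<integral>x. d x * \<psi> x \<partial>lebesgue_on T) = (\<integral>x. d' x * \<psi> x \<partial>lebesgue_on T)" by simp
qed

lemma weak_div: "is_weak_div T q d \<Longrightarrow> is_weak_div T q (weak_div T q)"
  unfolding weak_div_def using someI[of "is_weak_div T q"] by blast

text \<open>Guarantees that the choice in \<open>weak_div\<close> is meaningful for H1 fields and
  links its integral to the weak gradients, for which \<open>trace_gauss\<close> is
  available.\<close>

lemma weak_div_weak_grad:
  assumes q: "H1_vec_on T q"
  shows "is_weak_div T q (\<lambda>x. \<Sum>i\<in>UNIV. weak_grad T (\<lambda>y. q y $ i) x $ i)"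
  unfolding is_weak_div_def
proof (intro conjI ballI)
  let ?G = "\<lambda>i. weak_grad T (\<lambda>y. q y $ i)"
  have qi: "H1_on T (\<lambda>x. q x $ i)" for i using q by (simp add: H1_vec_on_def)
  have G: "L2_on T (\<lambda>x. ?G i x $ i)" for i by (rule weak_grad_L2[OF weak_grad[OF qi]])
  show "L2_on T (\<lambda>x. \<Sum>i\<in>UNIV. ?G i x $ i)"
    using L2_add[OF G[of 1] G[of 2]] by (simp add: sum_2)
  fix \<psi> assume \<psi>: "\<psi> \<in> test_functions (interior T)"
  note t = L2_test_function[OF \<psi>]
  have "(\<integral>x. q x \<bullet> (\<chi> i. partial_deriv i \<psi> x) \<partial>lebesgue_on T)
      = (\<Sum>i\<in>UNIV. \<integral>x. q x $ i * partial_deriv i \<psi> x \<partial>lebesgue_on T)"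
    unfolding inner_vec_def using L2_mult_integrable[OF H1_L2[OF qi] t(2)] by simp
  also have "\<dots> = (\<Sum>i\<in>UNIV. - (\<integral>x. ?G i x $ i * \<psi> x \<partial>lebesgue_on T))"
    using weak_grad_eq[OF weak_grad[OF qi] \<psi>] by simp
  also have "\<dots> = - (\<integral>x. (\<Sum>i\<in>UNIV. ?G i x $ i) * \<psi> x \<partial>lebesgue_on T)"
    using L2_mult_integrable[OF G t(1)] by (simp add: sum_distrib_right sum_negf)
  finally show "(\<integral>x. q x \<bullet> (\<chi> i. partial_deriv i \<psi> x) \<partial>lebesgue_on T)
      = - (\<integral>x. (\<Sum>i\<in>UNIV. ?G i x $ i) * \<psi> x \<partial>lebesgue_on T)" .
qed

text \<open>As \<open>u\<close> is only C^1, the divergence of its curl cannot be computed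
  classically. Integration by parts, applied to the partial derivatives of \<open>\<psi>\<close> as
  test functions, moves all derivatives onto \<open>\<psi>\<close>, whose mixed derivatives
  commute.\<close>

lemma curl_weak_div_free:
  assumes u: "C1_on T u" and \<psi>: "\<psi> \<in> test_functions (interior T)"
  shows "(\<integral>x. curl_within T u x \<bullet> gradient \<psi> x \<partial>lebesgue_on T) = 0"
proof -
  have gi: "integrable (lebesgue_on T) (\<lambda>x. grad_within T u x $ i * partial_deriv j \<psi> x)" for i j
    by (rule L2_mult_integrable[OF weak_grad_L2[OF C1_weak_grad[OF u]] L2_test_function(2)[OF \<psi>]])
  have "(\<integral>x. curl_within T u x \<bullet> gradient \<psi> x \<partial>lebesgue_on T)
      = (\<integral>x. grad_within T u x $ 1 * partial_deriv 2 \<psi> x - grad_within T u x $ 2 * partial_deriv 1 \<psi> x \<partial>lebesgue_on T)"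
    by (simp add: curl_eq inner_vec_def sum_2 gradient_def algebra_simps)
  also have "\<dots> = (\<integral>x. grad_within T u x $ 1 * partial_deriv 2 \<psi> x \<partial>lebesgue_on T)
      - (\<integral>x. grad_within T u x $ 2 * partial_deriv 1 \<psi> x \<partial>lebesgue_on T)"
    using gi by simp
  also have "\<dots> = 0"
    using integration_by_parts[OF u partial_deriv_test_function[OF \<psi>, of 2], of 1]
      integration_by_parts[OF u partial_deriv_test_function[OF \<psi>, of 1], of 2]
      partial_deriv_commute[OF test_function_continuous(4)[OF \<psi>], of 1 2] by simp
  finally show ?thesis .
qed

text \<open>Integration by parts for each affine coordinate function, whose gradient is an axis
  vector; the two coordinates give the factor 2.\<close>

lemma position_weak_div:
  assumes \<psi>: "\<psi> \<in> test_functions (interior T)"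
  shows "(\<integral>x. (x - xs) \<bullet> gradient \<psi> x \<partial>lebesgue_on T) = - (\<integral>x. 2 * \<psi> x \<partial>lebesgue_on T)"
proof -
  have C: "C1_on T (\<lambda>x. (x - xs) $ i)" and
    D: "x \<in> T \<Longrightarrow> grad_within T (\<lambda>x. (x - xs) $ i) x = axis i 1" for i x
    using C1_affine[where a = "axis i 1" and b = "- (xs $ i)"] by (simp_all add: inner_commute[of "axis i 1"] inner_axis)
  have "(\<integral>x. (x - xs) $ i * partial_deriv i \<psi> x \<partial>lebesgue_on T) = - (\<integral>x. \<psi> x \<partial>lebesgue_on T)" for i
  proof -
    have "(\<integral>x. grad_within T (\<lambda>x. (x - xs) $ i) x $ i * \<psi> x \<partial>lebesgue_on T) = (\<integral>x. \<psi> x \<partial>lebesgue_on T)"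
      by (intro Bochner_Integration.integral_cong refl) (use D in simp)
    then show ?thesis using integration_by_parts[OF C \<psi>, of i i] by simp
  qed
  moreover have "(\<integral>x. (x - xs) \<bullet> gradient \<psi> x \<partial>lebesgue_on T)
      = (\<Sum>i\<in>UNIV. \<integral>x. (x - xs) $ i * partial_deriv i \<psi> x \<partial>lebesgue_on T)"
    unfolding inner_vec_def using L2_mult_integrable[OF C1_L2[OF C] L2_test_function(2)[OF \<psi>]]
    by (simp add: gradient_def)
  ultimately show ?thesis by simp
qed

lemma field_weak_div:
  assumes \<psi>: "\<psi> \<in> test_functions (interior T)"
  shows "integrable (lebesgue_on T) (\<lambda>x. field a b x \<bullet> gradient \<psi> x)"
    "(\<integral>x. field a b x \<bullet> gradient \<psi> x \<partial>lebesgue_on T) = - (\<integral>x. 2 * b * \<psi> x \<partial>lebesgue_on T)"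
proof -
  have g: "continuous_on T (gradient \<psi>)"
    unfolding gradient_def[abs_def] using test_function_continuous(2)[OF \<psi>]
    by (intro continuous_on_vec_lambda)
  have ci: "integrable (lebesgue_on T) (\<lambda>x. curl_within T (lam i) x \<bullet> gradient \<psi> x)" if "i < n" for i
  proof -
    have "continuous_on T (curl_within T (lam i))"
      unfolding curl_within_def[abs_def] using C1_continuous_grad[OF lam_C1[OF that]]
      by (subst continuous_on_componentwise) (auto simp: Basis_vec_def inner_axis UNIV_2 intro!: continuous_intros)
    then show ?thesis
      using g by (intro L2_integrable[OF lmeasurable] L2_continuous[OF compact] continuous_intros)
  qed
  have xi: "integrable (lebesgue_on T) (\<lambda>x. (x - xs) \<bullet> gradient \<psi> x)"
    using g by (intro L2_integrable[OF lmeasurable] L2_continuous[OF compact] continuous_intros)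
  have eq: "field a b x \<bullet> gradient \<psi> x
      = (\<Sum>i<n. a i * (curl_within T (lam i) x \<bullet> gradient \<psi> x)) + b * ((x - xs) \<bullet> gradient \<psi> x)" for x
    by (simp add: field_def inner_add_left inner_sum_left)
  show "integrable (lebesgue_on T) (\<lambda>x. field a b x \<bullet> gradient \<psi> x)"
    unfolding eq using ci xi by (intro Bochner_Integration.integrable_add Bochner_Integration.integrable_sum integrable_mult_right) auto
  have "(\<integral>x. field a b x \<bullet> gradient \<psi> x \<partial>lebesgue_on T)
      = (\<Sum>i<n. a i * (\<integral>x. curl_within T (lam i) x \<bullet> gradient \<psi> x \<partial>lebesgue_on T))
        + b * (\<integral>x. (x - xs) \<bullet> gradient \<psi> x \<partial>lebesgue_on T)"
    unfolding eq using ci xi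
    by (subst Bochner_Integration.integral_add) (auto simp: Bochner_Integration.integral_sum)
  also have "\<dots> = b * - (\<integral>x. 2 * \<psi> x \<partial>lebesgue_on T)"
    using curl_weak_div_free[OF lam_C1 \<psi>] position_weak_div[OF \<psi>] by simp
  finally show "(\<integral>x. field a b x \<bullet> gradient \<psi> x \<partial>lebesgue_on T) = - (\<integral>x. 2 * b * \<psi> x \<partial>lebesgue_on T)"
    by simp
qed

text \<open>Orthogonality to the constant 1 already forces the mean value, since the area is not
  zero.\<close>

lemma const_proj_eq:
  assumes f: "L2_on T f" and c: "c * measure lebesgue T = integral\<^sup>L (lebesgue_on T) f"
  shows "const_proj T f = c"
proof -
  interpret finite_measure "lebesgue_on T" by (rule finite_measure_lebesgue_on[OF lmeasurable])
  have int: "(\<integral>x. (f x - d) * k \<partial>lebesgue_on T) = (c - d) * measure lebesgue T * k" for d k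
    using L2_integrable[OF lmeasurable f] lmeasurable
    by (simp add: measure_restrict_space c[symmetric] algebra_simps)
  have "measure lebesgue T \<noteq> 0" using sum_height sum_height_pos by simp
  then show ?thesis unfolding const_proj_def int
    by (intro the_equality) (auto dest: spec[of _ 1])
qed

text \<open>Here \<open>interp_eq\<close> is used with \<open>c = 0\<close>. By
  \<open>trace_gauss\<close> the total flux is the integral of div q, so \<open>2 * b\<close> is
  exactly \<open>const_proj\<close> of it. The curls have no weak divergence, so the error has weak
  divergence div q minus its mean and the Poincare inequality applies with its own constant.\<close>

lemma div_interp_error:
  assumes q: "H1_vec_on T q" and reg: "shape_regular T n v lam c0" and d: "H1_on T (weak_div T q)"
  shows "L2_norm T (weak_div T (\<lambda>x. q x - interp T n v lam xs q x)) \<le> c0 * diameter T * H1_norm T (weak_div T q)"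
proof -
  let ?d = "weak_div T q" and ?G = "\<lambda>i. weak_grad T (\<lambda>y. q y $ i)"
  have qi: "H1_on T (\<lambda>x. q x $ i)" for i using q by (simp add: H1_vec_on_def)
  have wd: "is_weak_div T q ?d" by (rule weak_div[OF weak_div_weak_grad[OF q]])
  have dL: "L2_on T ?d" by (rule H1_L2[OF d])
  have "\<exists>a b. (\<forall>x\<in>T. interp T n v lam xs q x = field a b x) \<and> b * (2 * measure lebesgue T) = (\<Sum>j<n. flux q 0 j)"
  proof (rule interp_eq[OF q, of 0])
    fix a b assume "\<And>x. x \<in> T \<Longrightarrow> interp T n v lam xs q x = 0 + field a b x"
      and "b * (2 * measure lebesgue T) = (\<Sum>j<n. flux q 0 j)"
    then show ?thesis by (intro exI[of _ a] exI[of _ b]) simp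
  qed
  then obtain a b where p: "\<And>x. x \<in> T \<Longrightarrow> interp T n v lam xs q x = field a b x"
    and b: "b * (2 * measure lebesgue T) = (\<Sum>j<n. flux q 0 j)" by blast
  have "(\<integral>x. ?d x \<partial>lebesgue_on T) = (\<integral>x. (\<Sum>i\<in>UNIV. ?G i x $ i) \<partial>lebesgue_on T)"
    using weak_div_unique[OF wd weak_div_weak_grad[OF q]] wd weak_div_weak_grad[OF q]
    by (intro integral_cong_AE) (auto simp: is_weak_div_def L2_on_def)
  also have "\<dots> = (\<Sum>i\<in>UNIV. \<integral>x. ?G i x $ i \<partial>lebesgue_on T)"
    using L2_integrable[OF lmeasurable weak_grad_L2[OF weak_grad[OF qi]]] by simp
  also have "\<dots> = (\<Sum>j<n. flux q 0 j)"
    unfolding trace_gauss[OF qi weak_grad[OF qi]] flux_def by (subst sum.swap) simp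
  finally have proj: "const_proj T ?d = 2 * b"
    using b by (intro const_proj_eq[OF dL]) simp
  have "L2_norm T (\<lambda>x. ?d x - const_proj T ?d) \<le> c0 * diameter T * H1_norm T ?d"
    using reg d unfolding shape_regular_def Let_def by blast
  then have est: "L2_norm T (\<lambda>x. ?d x - 2 * b) \<le> c0 * diameter T * H1_norm T ?d"
    unfolding proj .
  let ?e = "\<lambda>x. q x - interp T n v lam xs q x"
  have e: "is_weak_div T ?e (\<lambda>x. ?d x - 2 * b)"
    unfolding is_weak_div_def
  proof (intro conjI ballI)
    show "L2_on T (\<lambda>x. ?d x - 2 * b)" by (rule L2_diff[OF dL L2_const[OF lmeasurable]])
    fix \<psi> assume \<psi>: "\<psi> \<in> test_functions (interior T)"
    have "(\<integral>x. ?e x \<bullet> (\<chi> i. partial_deriv i \<psi> x) \<partial>lebesgue_on T)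
        = (\<integral>x. q x \<bullet> gradient \<psi> x - field a b x \<bullet> gradient \<psi> x \<partial>lebesgue_on T)"
      by (intro Bochner_Integration.integral_cong refl) (simp add: p gradient_def inner_diff_left)
    also have "\<dots> = (\<integral>x. q x \<bullet> gradient \<psi> x \<partial>lebesgue_on T) - (\<integral>x. field a b x \<bullet> gradient \<psi> x \<partial>lebesgue_on T)"
    proof (rule Bochner_Integration.integral_diff[OF _ field_weak_div(1)[OF \<psi>]])
      show "integrable (lebesgue_on T) (\<lambda>x. q x \<bullet> gradient \<psi> x)"
        unfolding inner_vec_def using L2_mult_integrable[OF H1_L2[OF qi] L2_test_function(2)[OF \<psi>]]
        by (simp add: gradient_def)
    qed
    also have "(\<integral>x. q x \<bullet> gradient \<psi> x \<partial>lebesgue_on T) = - (\<integral>x. ?d x * \<psi> x \<partial>lebesgue_on T)"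
      using wd \<psi> by (simp add: is_weak_div_def gradient_def)
    also have "\<dots> - (\<integral>x. field a b x \<bullet> gradient \<psi> x \<partial>lebesgue_on T) = - (\<integral>x. (?d x - 2 * b) * \<psi> x \<partial>lebesgue_on T)"
      using L2_mult_integrable[OF dL L2_test_function(1)[OF \<psi>]] L2_integrable[OF lmeasurable L2_test_function(1)[OF \<psi>]]
      by (simp add: field_weak_div(2)[OF \<psi>] left_diff_distrib)
    finally show "(\<integral>x. ?e x \<bullet> (\<chi> i. partial_deriv i \<psi> x) \<partial>lebesgue_on T) = - (\<integral>x. (?d x - 2 * b) * \<psi> x \<partial>lebesgue_on T)" .
  qed
  have "L2_norm T (weak_div T ?e) = L2_norm T (\<lambda>x. ?d x - 2 * b)"
    using weak_div_unique[OF weak_div[OF e] e] weak_div[OF e] e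
    by (intro L2_norm_cong_AE) (auto simp: is_weak_div_def L2_on_def)
  then show ?thesis using est by simp
qed

end

theorem lemma3p10:
  "\<exists>(C :: nat \<Rightarrow> real \<Rightarrow> real) (C' :: real \<Rightarrow> real).
     \<forall>(n :: nat) (c\<^sub>0 :: real) (T :: (real^2) set) (v :: nat \<Rightarrow> real^2)
       (lam :: nat \<Rightarrow> real^2 \<Rightarrow> real) (xs :: real^2).
       convex_polygon T n v \<longrightarrow> barycentric_coords T n v lam \<longrightarrow> xs \<in> interior T \<longrightarrow>
       0 < c\<^sub>0 \<longrightarrow> shape_regular T n v lam c\<^sub>0 \<longrightarrow>
       (\<forall>q. H1_vec_on T q \<longrightarrow>
          L2_norm T (\<lambda>x. q x - interp T n v lam xs q x)
            \<le> C n c\<^sub>0 * diameter T * H1_vec_norm T q \<and>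
          (H1_on T (weak_div T q) \<longrightarrow>
             L2_norm T (weak_div T (\<lambda>x. q x - interp T n v lam xs q x))
               \<le> C' c\<^sub>0 * diameter T * H1_norm T (weak_div T q)))"
proof (rule exI[of _ "\<lambda>n c. 2 * (c + 2 * real n * sqrt (c * (c\<^sup>2 + 1)) * (c * sqrt c * (4 * real n + 1)))"],
    rule exI[of _ "\<lambda>c. c"], intro allI impI)
  fix n :: nat and c\<^sub>0 :: real and T :: "(real^2) set" and v :: "nat \<Rightarrow> real^2"
    and lam :: "nat \<Rightarrow> real^2 \<Rightarrow> real" and xs :: "real^2" and q :: "real^2 \<Rightarrow> real^2"
  assume "convex_polygon T n v" "barycentric_coords T n v lam" "xs \<in> interior T"
    and reg: "0 < c\<^sub>0" "shape_regular T n v lam c\<^sub>0" and q: "H1_vec_on T q"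
  then interpret barycentric_polygon T n v lam xs by unfold_locales
  show "L2_norm T (\<lambda>x. q x - interp T n v lam xs q x)
      \<le> 2 * (c\<^sub>0 + 2 * real n * sqrt (c\<^sub>0 * (c\<^sub>0\<^sup>2 + 1)) * (c\<^sub>0 * sqrt c\<^sub>0 * (4 * real n + 1))) * diameter T * H1_vec_norm T q \<and>
      (H1_on T (weak_div T q) \<longrightarrow> L2_norm T (weak_div T (\<lambda>x. q x - interp T n v lam xs q x))
        \<le> c\<^sub>0 * diameter T * H1_norm T (weak_div T q))"
    using interp_error[OF q reg] div_interp_error[OF q reg(2)] by blast
qed

end
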